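(* Let $u,v\in M_{n,d,t}$ with $\min(u)=1$ and $\min(v)>1$, and let $I=(\mathcal{L}_t(u,v))\subset S=K[x_1,\dots,x_n]$. Assume that $I$ has a linear resolution. (a) If $I$ is a completely $t$-spread lexsegment ideal, then for all $i\ge 0$ $$\beta_i(I)=\sum_{w\in\mathcal{L}_t^f(u)}\binom{n-\min(w)-(d-1)t}{i}-\sum_{\substack{w\in\mathcal{L}_t^f(v)\\ w\ne v}}\binom{\max(w)-(d-1)t-1}{i}.$$ (b) If $I$ is an incompletely $t$-spread lexsegment ideal, then for all $i\ge 0$ $$\beta_i(I)=\sum_{\substack{w\in\mathcal{L}_t(u,v)\\ \min(w)\ge2}}\binom{\max(w)-(d-1)t-2}{i}+\sum_{j=0}^{i}\ \sum_{w\in\mathcal{L}_t^f(u/x_1)}\binom{\min(v)-1}{j}\binom{n-\min(w)-(d-2)t}{i-j}.$$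
   Context: $K$ is a field, $S=K[x_1,\dots,x_n]$ is the standard graded polynomial ring, and $n,d,t\ge 1$ are integers. A monomial $x_{i_1}\cdots x_{i_d}$ with $i_1\le\dots\le i_d$ is $t$-spread if $i_{j+1}-i_j\ge t$ for all $j=1,\dots,d-1$. $M_{n,d,t}$ is the set of all $t$-spread monomials of degree $d$ in $S$; it is assumed throughout that $n\ge 1+(d-1)t$, so that this set is non-empty. For a monomial $w\neq 1$, $\min(w)$ and $\max(w)$ are the smallest and largest index $i$ such that $x_i$ divides $w$. The squarefree lexicographic order on $M_{n,d,t}$: for $x_{i_1}\cdots x_{i_d}$ and $x_{j_1}\cdots x_{j_d}$ with increasing indices, $x_{i_1}\cdots x_{i_d}>_{\mathrm{slex}}x_{j_1}\cdots x_{j_d}$ if for some $1\le s\le d$ one has $i_1=j_1,\dots,i_{s-1}=j_{s-1}$ and $i_s<j_s$. For $u,v\in M_{n,d,t}$ with $u\ge_{\mathrm{slex}}v$, set $\mathcal{L}_t(u,v)=\{w\in M_{n,d,t}:u\ge_{\mathrm{slex}}w\ge_{\mathrm{slex}}v\}$, $\mathcal{L}_t^i(v)=\{w\in M_{n,d,t}: w\ge_{\mathrm{slex}}v\}$ and $\mathcal{L}_t^f(u)=\{w\in M_{n,d,t}:w\le_{\mathrm{slex}}u\}$. The same notation is used in other degrees: since $u/x_1$ has degree $d-1$, $\mathcal{L}_t^f(u/x_1)=\{w\in M_{n,d-1,t}: w\le_{\mathrm{slex}}u/x_1\}$. A $t$-spread lexsegment ideal is an ideal $I=(\mathcal{L}_t(u,v))$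 of $S$ generated by such a set $\mathcal{L}_t(u,v)$. It is completely $t$-spread lexsegment if $I=(\mathcal{L}_t^i(v))\cap(\mathcal{L}_t^f(u))$, and incompletely $t$-spread lexsegment otherwise. $\beta_{i,j}(I)=\dim_K\mathrm{Tor}_i^S(I,K)_j$ and $\beta_i(I)=\sum_j\beta_{i,j}(I)$. A graded ideal $I$ generated in degree $d$ has a ($d$-)linear resolution if $\beta_{i,i+j}(I)=0$ for all $i$ and all $j\ne d$. Binomial coefficients $\binom{a}{b}$ with $0\le a<b$ are $0$. *)

theory Defs
  imports
    Complex_Main
    "HOL-Algebra.Ideal"
    "HOL-Library.Poly_Mapping"
    "HOL-Library.Function_Algebras"
begin

section \<open>The polynomial ring $K[x_1,\dots,x_n]$\<close>

text \<open>
  A monomial is its exponent vector; \<^term>\<open>Poly_Mapping.single i 1\<close> is $x_i$.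
  The number $n$ of variables enters through the carrier of the ring below, so that it may
  vary within a formula.
\<close>

type_synonym monomial = "nat \<Rightarrow>\<^sub>0 nat"
type_synonym 'k mpoly = "monomial \<Rightarrow>\<^sub>0 'k"

definition mdeg :: "monomial \<Rightarrow> nat" where
  "mdeg m = (\<Sum>i\<in>Poly_Mapping.keys m. Poly_Mapping.lookup m i)"

definition min_var :: "monomial \<Rightarrow> nat" where
  "min_var w = Min (Poly_Mapping.keys w)"

definition max_var :: "monomial \<Rightarrow> nat" where
  "max_var w = Max (Poly_Mapping.keys w)"

definition polys :: "nat \<Rightarrow> 'k::field mpoly set" where
  "polys n = {p. \<forall>m\<in>Poly_Mapping.keys p. Poly_Mapping.keys m \<subseteq> {1..n}}"

definition poly_ring :: "nat \<Rightarrow> 'k::field mpoly ring" where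
  "poly_ring n = \<lparr>carrier = polys n, mult = (*), one = 1, zero = 0, add = (+)\<rparr>"

text \<open>Degrees are integers, since shifts of free modules may be negative.\<close>

definition homog :: "nat \<Rightarrow> int \<Rightarrow> 'k::field mpoly set" where
  "homog n e = {p \<in> polys n. \<forall>m\<in>Poly_Mapping.keys p. int (mdeg m) = e}"

definition monomial_ideal :: "nat \<Rightarrow> monomial set \<Rightarrow> 'k::field mpoly set" where
  "monomial_ideal n W = Idl\<^bsub>poly_ring n\<^esub> ((\<lambda>w. Poly_Mapping.single w 1) ` W)"

section \<open>\<open>t\<close>-spread monomials and lexsegments\<close>

text \<open>$x_{i_1}\cdots x_{i_d}$ for the list $[i_1,\dots,i_d]$\<close>

definition var_prod :: "nat list \<Rightarrow> monomial" where
  "var_prod js = (\<Sum>j\<leftarrow>js. Poly_Mapping.single j 1)"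

definition spread_monomials :: "nat \<Rightarrow> nat \<Rightarrow> nat \<Rightarrow> monomial set" where
  "spread_monomials n d t = {var_prod js | js. length js = d \<and> set js \<subseteq> {1..n} \<and>
     sorted js \<and> (\<forall>k. Suc k < d \<longrightarrow> js ! Suc k - js ! k \<ge> t)}"

text \<open>\<open>slex_gr u w\<close> is $u >_{\mathrm{slex}} w$; list positions are counted from 0.\<close>

definition slex_gr :: "monomial \<Rightarrow> monomial \<Rightarrow> bool" where
  "slex_gr u w \<longleftrightarrow> (\<exists>ks js. u = var_prod ks \<and> w = var_prod js \<and>
     sorted_wrt (<) ks \<and> sorted_wrt (<) js \<and> length ks = length js \<and>
     (\<exists>s<length ks. (\<forall>k<s. ks ! k = js ! k) \<and> ks ! s < js ! s))"

definition slex_ge :: "monomial \<Rightarrow> monomial \<Rightarrow> bool" where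
  "slex_ge u w \<longleftrightarrow> u = w \<or> slex_gr u w"

definition lexseg :: "nat \<Rightarrow> nat \<Rightarrow> nat \<Rightarrow> monomial \<Rightarrow> monomial \<Rightarrow> monomial set" where
  "lexseg n d t u v = {w \<in> spread_monomials n d t. slex_ge u w \<and> slex_ge w v}"

definition init_lexseg :: "nat \<Rightarrow> nat \<Rightarrow> nat \<Rightarrow> monomial \<Rightarrow> monomial set" where
  "init_lexseg n d t v = {w \<in> spread_monomials n d t. slex_ge w v}"

definition final_lexseg :: "nat \<Rightarrow> nat \<Rightarrow> nat \<Rightarrow> monomial \<Rightarrow> monomial set" where
  "final_lexseg n d t u = {w \<in> spread_monomials n d t. slex_ge u w}"

text \<open>The type \<open>'k\<close> of coefficients occurs only in the ideals, hence the explicit type argument.\<close>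

definition completely_lexseg ::
    "'k::field itself \<Rightarrow> nat \<Rightarrow> nat \<Rightarrow> nat \<Rightarrow> monomial \<Rightarrow> monomial \<Rightarrow> bool" where
  "completely_lexseg _ n d t u v \<longleftrightarrow>
     (monomial_ideal n (lexseg n d t u v) :: 'k mpoly set) =
     monomial_ideal n (init_lexseg n d t v) \<inter> monomial_ideal n (final_lexseg n d t u)"

abbreviation incompletely_lexseg ::
    "'k::field itself \<Rightarrow> nat \<Rightarrow> nat \<Rightarrow> nat \<Rightarrow> monomial \<Rightarrow> monomial \<Rightarrow> bool" where
  "incompletely_lexseg K n d t u v \<equiv> \<not> completely_lexseg K n d t u v"

section \<open>Graded free resolutions\<close>

text \<open>
  A complex of finitely generated graded free modules
  $\cdots \to F_1 \to F_0 \to S$ with $F_i = \bigoplus_k S(-a_{i,k})$, where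
  $a_{i,k}$ is \<open>shifts F i ! k\<close>.  An element of $F_i$ is the function of its coordinates,
  zero beyond the rank.  The maps are given by matrices: \<open>aug F k\<close> is the image in $S$ of the
  \<open>k\<close>-th basis element of $F_0$, and \<open>bd F i k l\<close> is the entry in row \<open>k\<close>, column \<open>l\<close> of
  $F_{i+1} \to F_i$.
\<close>

record 'p free_complex =
  shifts :: "nat \<Rightarrow> int list"
  aug :: "nat \<Rightarrow> 'p"
  bd :: "nat \<Rightarrow> nat \<Rightarrow> nat \<Rightarrow> 'p"

definition free_rank :: "'p free_complex \<Rightarrow> nat \<Rightarrow> nat" where
  "free_rank F i = length (shifts F i)"

definition free_module :: "nat \<Rightarrow> 'k::field mpoly free_complex \<Rightarrow> nat \<Rightarrow> (nat \<Rightarrow> 'k mpoly) set" where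
  "free_module n F i =
     {f. (\<forall>k<free_rank F i. f k \<in> polys n) \<and> (\<forall>k\<ge>free_rank F i. f k = 0)}"

definition aug_map :: "'k::field mpoly free_complex \<Rightarrow> (nat \<Rightarrow> 'k mpoly) \<Rightarrow> 'k mpoly" where
  "aug_map F f = (\<Sum>l<free_rank F 0. aug F l * f l)"

definition bd_map :: "'k::field mpoly free_complex \<Rightarrow> nat \<Rightarrow> (nat \<Rightarrow> 'k mpoly) \<Rightarrow> (nat \<Rightarrow> 'k mpoly)" where
  "bd_map F i f =
     (\<lambda>k. if k < free_rank F i then \<Sum>l<free_rank F (Suc i). bd F i k l * f l else 0)"

text \<open>
  Graded free resolutions of an ideal \<open>I\<close>, of finite length; by Hilbert's syzygy
  theorem every graded ideal has one.
\<close>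

definition graded_free_resolution ::
    "nat \<Rightarrow> 'k::field mpoly set \<Rightarrow> 'k mpoly free_complex \<Rightarrow> bool" where
  "graded_free_resolution n I F \<longleftrightarrow>
     (\<forall>l<free_rank F 0. aug F l \<in> homog n (shifts F 0 ! l)) \<and>
     (\<forall>i. \<forall>k<free_rank F i. \<forall>l<free_rank F (Suc i).
        bd F i k l \<in> homog n (shifts F (Suc i) ! l - shifts F i ! k)) \<and>
     aug_map F ` free_module n F 0 = I \<and>
     {f \<in> free_module n F 0. aug_map F f = 0} = bd_map F 0 ` free_module n F 1 \<and>
     (\<forall>i. {f \<in> free_module n F (Suc i). bd_map F i f = 0} =
        bd_map F (Suc i) ` free_module n F (Suc (Suc i))) \<and>
     (\<exists>N. \<forall>i\<ge>N. free_rank F i = 0)"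

section \<open>Tor and Betti numbers\<close>

text \<open>
  The complex $F \otimes_S K$, where $K = S/(x_1,\dots,x_n)$: in homological degree $i$ and
  internal degree $j$ it is the \<open>K\<close>-vector space on the basis elements of $F_i$ of degree $j$,
  and its maps are the matrices of $F$ reduced modulo $(x_1,\dots,x_n)$, that is, replaced by
  their constant coefficients.
\<close>

definition tensor_K :: "'k::field mpoly free_complex \<Rightarrow> nat \<Rightarrow> int \<Rightarrow> (nat \<Rightarrow> 'k) set" where
  "tensor_K F i j = {f. \<forall>k. f k \<noteq> 0 \<longrightarrow> k < free_rank F i \<and> shifts F i ! k = j}"

definition tensor_bd :: "'k::field mpoly free_complex \<Rightarrow> nat \<Rightarrow> (nat \<Rightarrow> 'k) \<Rightarrow> (nat \<Rightarrow> 'k)" where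
  "tensor_bd F i f =
     (\<lambda>k. if k < free_rank F i
          then \<Sum>l<free_rank F (Suc i). Poly_Mapping.lookup (bd F i k l) 0 * f l else 0)"

fun tensor_cycles :: "'k::field mpoly free_complex \<Rightarrow> nat \<Rightarrow> int \<Rightarrow> (nat \<Rightarrow> 'k) set" where
  "tensor_cycles F 0 j = tensor_K F 0 j"
| "tensor_cycles F (Suc i) j = {f \<in> tensor_K F (Suc i) j. tensor_bd F i f = 0}"

definition tensor_boundaries :: "'k::field mpoly free_complex \<Rightarrow> nat \<Rightarrow> int \<Rightarrow> (nat \<Rightarrow> 'k) set" where
  "tensor_boundaries F i j = tensor_bd F i ` tensor_K F (Suc i) j"

abbreviation K_dim :: "(nat \<Rightarrow> 'k::field) set \<Rightarrow> nat" where
  "K_dim \<equiv> vector_space.dim (\<lambda>c f k. c * f k)"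

text \<open>
  $\dim_K H_i(F\otimes_S K)_j$.  The boundaries form a subspace of the finite-dimensional space
  of cycles, so the difference of dimensions is that of the quotient.
\<close>

definition homology_dim :: "'k::field mpoly free_complex \<Rightarrow> nat \<Rightarrow> int \<Rightarrow> nat" where
  "homology_dim F i j = K_dim (tensor_cycles F i j) - K_dim (tensor_boundaries F i j)"

text \<open>
  $\beta_{i,j}(I) = \dim_K \mathrm{Tor}_i^S(I,K)_j$; Tor does not depend on the resolution used
  to compute it.
\<close>

definition graded_betti :: "nat \<Rightarrow> 'k::field mpoly set \<Rightarrow> nat \<Rightarrow> int \<Rightarrow> nat" where
  "graded_betti n I i j = homology_dim (SOME F. graded_free_resolution n I F) i j"

definition betti :: "nat \<Rightarrow> 'k::field mpoly set \<Rightarrow> nat \<Rightarrow> nat" where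
  "betti n I i = (\<Sum>j | graded_betti n I i j \<noteq> 0. graded_betti n I i j)"

definition linear_resolution :: "nat \<Rightarrow> nat \<Rightarrow> 'k::field mpoly set \<Rightarrow> bool" where
  "linear_resolution n d I \<longleftrightarrow>
     (\<exists>G\<subseteq>homog n (int d). I = Idl\<^bsub>poly_ring n\<^esub> G) \<and>
     (\<forall>i j. j \<noteq> int d \<longrightarrow> graded_betti n I i (int i + j) = 0)"

end

theory Submission
  imports Defs
begin

text \<open>
Let \<open>h e\<close> be the number of monomials of degree \<open>e\<close> in $n$ variables.  Taking dimensions degree by
degree in a finite graded free resolution \<open>F\<close> of $I$ expresses the Hilbert function of $I$ as the
alternating sum of the \<open>h (e - a)\<close> over all shifts \<open>a\<close> of \<open>F\<close>.  For a fixed shift, the alternating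
number of basis elements is the Euler characteristic of $F \otimes K$ in that degree, hence
equal to the alternating sum of the graded Betti numbers.  If the resolution of $I$ is linear, each
degree $i + d$ carries a single Betti number, so that
  \<open>dim I\<^sub>e = (\<Sum>i. (-1)^i * \<beta>\<^sub>i * h (e - d - i))\<close>,
and these equations determine the \<open>\<beta>\<^sub>i\<close> (\<open>betti_from_Hilbert_function\<close>).  The Betti numbers are
defined through a chosen resolution; that there is one to choose is shown with the Taylor complex
(\<open>squarefree_ideal_has_resolution\<close>).  It remains to count the monomials of degree \<open>e\<close> in $I$.

A squarefree monomial is the set of its variables; the squarefree lexicographic order compares two
sets at the smallest element of their symmetric difference.  A monomial $m$ with a $t$-spread divisor
of degree $d$ has a largest one, found by choosing indices greedily from below.  It follows that
$m$ lies in the ideal of an initial segment iff its greedy divisor $w$ lies in the segment.  The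
monomials with greedy divisor $w$ are the products of $w$ with the monomials in all but
\<open>max w - (d - 1) t - 1\<close> of the variables, and omitting one variable replaces \<open>h e\<close> by
\<open>h e - h (e - 1)\<close>; this is where the binomial coefficients come from
(\<open>Hilbert_function_initial_segment\<close>).  Final segments are treated in the same way with the greedy
choice from above (\<open>Hilbert_function_final_segment\<close>).

In case (a), $I$ is the intersection of the ideals of an initial and a final segment whose union
is the set of all $t$-spread monomials, and the formula is inclusion and exclusion.

In case (b), write $l = \min(v)$.  Linear first syzygies connect any two generators through
generators that divide their least common multiple, in steps that change one variable
(\<open>linear_syzygies_connect\<close>): a monomial of minimal degree at which this fails would give a
syzygy that does not come from syzygies of smaller degree, in a degree where linearity does not
allow it.  Applied to a generator with $x_1$ and one without $x_1$, this forces $v$ to be $x_l$ times the smallest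
$t$-spread monomial of degree $d - 1$ and $\min(u/x_1) > l + t$
(\<open>incomplete_structure\<close>).  Hence a monomial of $I$ is either a multiple of a generator without $x_1$,
or it is divisible by $x_1$, by an element of the final segment of $u/x_1$, and by none of
$x_2,\dots,x_l$.  The two kinds give the two sums of (b), the second after Vandermonde's identity.
\<close>

abbreviation (input) lookup :: "('a \<Rightarrow>\<^sub>0 'b::zero) \<Rightarrow> 'a \<Rightarrow> 'b" where
  "lookup \<equiv> Poly_Mapping.lookup"

abbreviation (input) keys :: "('a \<Rightarrow>\<^sub>0 'b::zero) \<Rightarrow> 'a set" where
  "keys \<equiv> Poly_Mapping.keys"

abbreviation (input) single :: "'a \<Rightarrow> 'b \<Rightarrow> ('a \<Rightarrow>\<^sub>0 'b::zero)" where
  "single \<equiv> Poly_Mapping.single"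

section \<open>Spread sets and the lexicographic order\<close>

definition t_spread :: "nat \<Rightarrow> nat set \<Rightarrow> bool" where
  "t_spread t X \<longleftrightarrow> (\<forall>x\<in>X. \<forall>y\<in>X. x < y \<longrightarrow> x + t \<le> y)"

definition spread_sets :: "nat \<Rightarrow> nat \<Rightarrow> nat \<Rightarrow> nat set set" where
  "spread_sets n d t = {X. X \<subseteq> {1..n} \<and> card X = d \<and> t_spread t X}"

text \<open>
\<open>X\<close> and \<open>Y\<close> agree below \<open>a\<close>, the first place where they differ, and \<open>X\<close> is the one that contains \<open>a\<close>.
For sets of equal cardinality this is the comparison of the increasing sequences of their elements.
\<close>

definition lex_above :: "nat set \<Rightarrow> nat set \<Rightarrow> bool" where
  "lex_above X Y \<longleftrightarrow> (\<exists>a\<in>X - Y. \<forall>b<a. b \<in> X \<longleftrightarrow> b \<in> Y)"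

definition lex_geq :: "nat set \<Rightarrow> nat set \<Rightarrow> bool" where
  "lex_geq X Y \<longleftrightarrow> X = Y \<or> lex_above X Y"

lemma t_spread_subset: "t_spread t X \<Longrightarrow> Y \<subseteq> X \<Longrightarrow> t_spread t Y"
  unfolding t_spread_def by blast

lemma t_spread_close: "t_spread t X \<Longrightarrow> x \<in> X \<Longrightarrow> y \<in> X \<Longrightarrow> x \<le> y \<Longrightarrow> y < x + t \<Longrightarrow> x = y"
  unfolding t_spread_def by (metis le_neq_implies_less not_less)

lemma lex_above_asym: "lex_above X Y \<Longrightarrow> \<not> lex_above Y X"
  unfolding lex_above_def by (metis Diff_iff linorder_neqE_nat)

lemma lex_above_trans:
  assumes "lex_above X Y" and "lex_above Y Z"
  shows "lex_above X Z"
proof -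
  from assms obtain a b where a: "a \<in> X - Y" "\<forall>c<a. c \<in> X \<longleftrightarrow> c \<in> Y"
    and b: "b \<in> Y - Z" "\<forall>c<b. c \<in> Y \<longleftrightarrow> c \<in> Z"
    unfolding lex_above_def by blast
  have "a \<noteq> b" using a(1) b(1) by blast
  then have "min a b \<in> X - Z" "\<forall>c<min a b. c \<in> X \<longleftrightarrow> c \<in> Z"
    using a b by (auto simp: min_def)
  then show ?thesis unfolding lex_above_def by blast
qed

lemma lex_above_total:
  assumes "X \<noteq> Y"
  shows "lex_above X Y \<or> lex_above Y X"
proof -
  define a where "a = (LEAST a. (a \<in> X) \<noteq> (a \<in> Y))"
  have "\<exists>a. (a \<in> X) \<noteq> (a \<in> Y)" using assms by blast
  then have "(a \<in> X) \<noteq> (a \<in> Y)" unfolding a_def by (rule LeastI_ex)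
  moreover have "\<forall>b<a. b \<in> X \<longleftrightarrow> b \<in> Y" unfolding a_def using not_less_Least by blast
  ultimately show ?thesis unfolding lex_above_def by blast
qed

lemma lex_geq_refl [simp]: "lex_geq X X" by (simp add: lex_geq_def)

lemma lex_geq_trans: "lex_geq X Y \<Longrightarrow> lex_geq Y Z \<Longrightarrow> lex_geq X Z"
  unfolding lex_geq_def using lex_above_trans by blast

lemma lex_geq_antisym: "lex_geq X Y \<Longrightarrow> lex_geq Y X \<Longrightarrow> X = Y"
  unfolding lex_geq_def using lex_above_asym by blast

lemma not_lex_geq: "\<not> lex_geq X Y \<longleftrightarrow> lex_above Y X"
  unfolding lex_geq_def using lex_above_asym lex_above_total by blast

lemma lex_above_if_Min_less:
  assumes "finite X" "finite Y" "X \<noteq> {}" "Y \<noteq> {}" "Min X < Min Y"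
  shows "lex_above X Y"
  unfolding lex_above_def
proof (intro bexI[of _ "Min X"] allI impI)
  have "Min X \<notin> Y" using Min_le[OF assms(2), of "Min X"] assms(5) by auto
  then show "Min X \<in> X - Y" using assms by simp
  fix b assume b: "b < Min X"
  then have "b \<notin> X" using Min_le[OF assms(1), of b] by auto
  moreover have "b \<notin> Y" using Min_le[OF assms(2), of b] b assms(5) by auto
  ultimately show "b \<in> X \<longleftrightarrow> b \<in> Y" by simp
qed

lemma lex_geq_Min_le:
  assumes "finite X" "finite Y" "X \<noteq> {}" "Y \<noteq> {}" "lex_geq X Y"
  shows "Min X \<le> Min Y"
  using lex_above_if_Min_less[of Y X] assms not_lex_geq[of X Y] by linarith

lemma lex_above_insert_iff:
  assumes "a \<notin> X" "a \<notin> Y"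
  shows "lex_above (insert a X) (insert a Y) \<longleftrightarrow> lex_above X Y"
proof -
  have "insert a X - insert a Y = X - Y" using assms by auto
  moreover have "(c \<in> insert a X \<longleftrightarrow> c \<in> insert a Y) \<longleftrightarrow> (c \<in> X \<longleftrightarrow> c \<in> Y)" for c
    using assms by auto
  ultimately show ?thesis unfolding lex_above_def by simp
qed

lemma lex_geq_insert_iff:
  assumes "a \<notin> X" "a \<notin> Y"
  shows "lex_geq (insert a X) (insert a Y) \<longleftrightarrow> lex_geq X Y"
  using lex_above_insert_iff[OF assms] assms unfolding lex_geq_def by (simp add: insert_ident)

text \<open>
The indices that the greedy choice from below passes over once it has chosen \<open>X\<close>: those within
distance \<open>t\<close> above an element that is not the last, and everything from the last element on.
Thus \<open>X\<close> is the greedy choice from a set \<open>Y\<close> iff \<open>X \<subseteq> Y \<subseteq> init_cover t X\<close>.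
\<close>

definition init_cover :: "nat \<Rightarrow> nat set \<Rightarrow> nat set" where
  "init_cover t X = (\<Union>x\<in>X - {Max X}. {x..<x + t}) \<union> {Max X..}"

text \<open>
The mirror image: the greedy choice from above.
\<close>

definition fin_cover :: "nat \<Rightarrow> nat set \<Rightarrow> nat set" where
  "fin_cover t X = (\<Union>x\<in>X - {Min X}. {y. y \<le> x \<and> x < y + t}) \<union> {..Min X}"

text \<open>
At the first index where a \<open>t\<close>-spread subset \<open>Z\<close> of \<open>Y\<close> could be ahead of \<open>X\<close>, the cover
either puts it too close to an element shared by both sets, or beyond all of \<open>X\<close>, in which case \<open>Z\<close>
would have too many elements.
\<close>

lemma init_cover_lex_max:
  assumes X: "finite X" "X \<noteq> {}" "X \<subseteq> Y" "Y \<subseteq> init_cover t X"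
    and Z: "finite Z" "Z \<subseteq> Y" "t_spread t Z" "card Z = card X"
  shows "lex_geq X Z"
proof (rule ccontr)
  assume "\<not> lex_geq X Z"
  then obtain a where a: "a \<in> Z" "a \<notin> X" "\<forall>b<a. b \<in> Z \<longleftrightarrow> b \<in> X"
    unfolding not_lex_geq lex_above_def by blast
  then have "a \<in> init_cover t X" using X Z by blast
  then consider x where "x \<in> X" "x \<le> a" "a < x + t" | "Max X \<le> a"
    unfolding init_cover_def by auto
  then show False
  proof cases
    case 1
    then have "x < a" using a by (cases "x = a") auto
    then show ?thesis using 1 a t_spread_close[OF Z(3), of x a] by auto
  next
    case 2
    have "x < a" if "x \<in> X" for x
    proof -
      have "x \<le> Max X" using X(1) that by simp
      then show ?thesis using 2 a(2) that by (cases "x = a") auto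
    qed
    then have "insert a X \<subseteq> Z" using a by auto
    then have "card (insert a X) \<le> card Z" using Z(1) by (rule card_mono[rotated])
    then show ?thesis using a X Z by simp
  qed
qed

text \<open>
Every interval of the cover contains at most one element of a \<open>t\<close>-spread set, so in each ray
\<open>{c..}\<close> the set \<open>X\<close> has at least as many elements as \<open>Z\<close>.  Such domination contradicts
\<open>X\<close> being strictly above \<open>Z\<close>.
\<close>

lemma fin_cover_lex_min:
  assumes X: "finite X" "X \<noteq> {}" "X \<subseteq> Y" "Y \<subseteq> fin_cover t X"
    and Z: "finite Z" "Z \<subseteq> Y" "t_spread t Z" "card Z = card X"
  shows "lex_geq Z X"
proof (rule ccontr)
  \<comment> \<open>\<open>g\<close> below sends an element of \<open>Z\<close> to the element of \<open>X\<close> whose interval contains it.\<close>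
  have dom: "card (Z \<inter> {c..}) \<le> card (X \<inter> {c..})" for c
  proof (cases "c \<le> Min X")
    case True
    have "c \<le> x" if "x \<in> X" for x using True Min_le[OF X(1) that] by simp
    then have "X \<inter> {c..} = X" by auto
    moreover have "card (Z \<inter> {c..}) \<le> card Z" using Z(1) by (intro card_mono) auto
    ultimately show ?thesis using Z(4) by simp
  next
    case False
    have "\<exists>x\<in>X \<inter> {c..}. y \<le> x \<and> x < y + t" if "y \<in> Z \<inter> {c..}" for y
    proof -
      have "y \<in> fin_cover t X" using that X(4) Z(2) by blast
      moreover have "\<not> y \<le> Min X" using that False by (simp del: Min_ge_iff Min_le_iff)
      ultimately obtain x where "x \<in> X" "y \<le> x" "x < y + t" unfolding fin_cover_def by blast
      moreover have "c \<le> y" using that by simp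
      ultimately show ?thesis by (intro bexI[of _ x]) simp_all
    qed
    then have "\<forall>y\<in>Z \<inter> {c..}. \<exists>x. x \<in> X \<inter> {c..} \<and> y \<le> x \<and> x < y + t" by blast
    then obtain g where g: "\<forall>y\<in>Z \<inter> {c..}. g y \<in> X \<inter> {c..} \<and> y \<le> g y \<and> g y < y + t"
      by (rule bchoice[THEN exE])
    have "inj_on g (Z \<inter> {c..})"
    proof (rule inj_onI)
      fix y y' assume h: "y \<in> Z \<inter> {c..}" "y' \<in> Z \<inter> {c..}" "g y = g y'"
      have "y \<le> g y" "g y < y + t" "y' \<le> g y'" "g y' < y' + t"
        using bspec[OF g h(1)] bspec[OF g h(2)] by simp_all
      then show "y = y'"
        using t_spread_close[OF Z(3), of y y'] t_spread_close[OF Z(3), of y' y] h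
        by (cases "y \<le> y'") simp_all
    qed
    moreover have "g ` (Z \<inter> {c..}) \<subseteq> X \<inter> {c..}" using g by blast
    ultimately show ?thesis using X(1) by (simp add: card_inj_on_le)
  qed
  assume "\<not> lex_geq Z X"
  then obtain a where a: "a \<in> X" "a \<notin> Z" "\<forall>b<a. b \<in> X \<longleftrightarrow> b \<in> Z"
    unfolding not_lex_geq lex_above_def by blast
  have split: "card S = card (S \<inter> {..<a}) + card (S \<inter> {a..})" if "finite S" for S
  proof -
    have "S = (S \<inter> {..<a}) \<union> (S \<inter> {a..})" by auto
    moreover have "card ((S \<inter> {..<a}) \<union> (S \<inter> {a..})) = card (S \<inter> {..<a}) + card (S \<inter> {a..})"
      using that by (intro card_Un_disjoint) auto
    ultimately show ?thesis by simp
  qed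
  note split[OF X(1)]
  moreover note split[OF Z(1)]
  moreover have "X \<inter> {..<a} = Z \<inter> {..<a}" using a by auto
  moreover have "X \<inter> {a..} = insert a (X \<inter> {Suc a..})" using a(1)
    by (auto simp: Suc_le_eq order.order_iff_strict)
  moreover have "Z \<inter> {a..} = Z \<inter> {Suc a..}" using a(2)
    by (auto simp: Suc_le_eq order.order_iff_strict)
  moreover have "card (insert a (X \<inter> {Suc a..})) = Suc (card (X \<inter> {Suc a..}))"
    using X by simp
  ultimately show False using dom[of "Suc a"] Z(4) by simp
qed

text \<open>
The choice with the least sum of elements is greedy: an element of \<open>Y\<close> outside the cover
could replace the next larger element of \<open>X\<close>.
\<close>

lemma init_cover_exists:
  assumes "finite Y" "Z \<subseteq> Y" "t_spread t Z" "Z \<noteq> {}" "t > 0"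
  shows "\<exists>X. X \<subseteq> Y \<and> t_spread t X \<and> card X = card Z \<and> Y \<subseteq> init_cover t X"
proof -
  define P where "P = (\<lambda>X. X \<subseteq> Y \<and> t_spread t X \<and> card X = card Z)"
  have "P Z" unfolding P_def using assms by simp
  then have "\<exists>X. P X \<and> (\<forall>X'. P X' \<longrightarrow> \<Sum>X \<le> \<Sum>X')"
    by (rule ex_has_least_nat[where m = "\<lambda>X. \<Sum>X"])
  then obtain X where X: "P X" and mn: "\<And>X'. P X' \<Longrightarrow> \<Sum>X \<le> \<Sum>X'"
    by (elim exE conjE) simp
  have fX: "finite X" "X \<subseteq> Y" "t_spread t X" "card X = card Z"
    using X finite_subset[OF _ assms(1)] unfolding P_def by simp_all
  have "finite Z" using assms finite_subset by blast
  then have ne: "X \<noteq> {}" using fX assms by auto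
  have "Y \<subseteq> init_cover t X"
  proof (rule ccontr)
    assume "\<not> Y \<subseteq> init_cover t X"
    then obtain y where y: "y \<in> Y" "y \<notin> init_cover t X" by blast
    have yM: "y < Max X" using y(2) by (simp add: init_cover_def not_le)
    have yc: "x + t \<le> y" if "x \<in> X" "x \<noteq> Max X" "x \<le> y" for x
      using y(2) that by (force simp: init_cover_def)
    \<comment> \<open>The element of \<open>X\<close> that \<open>y\<close> can replace.\<close>
    define z where "z = Min {x\<in>X. y < x}"
    have "Max X \<in> {x\<in>X. y < x}" using yM fX ne by simp
    then have "z \<in> {x\<in>X. y < x}" unfolding z_def
      using fX by (intro Min_in) auto
    then have z: "z \<in> X" "y < z" by auto
    have zm: "z \<le> x" if "x \<in> X" "y < x" for x unfolding z_def using that fX by simp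
    have low: "x + t \<le> y" if "x \<in> X" "x \<le> y" for x using yc[of x] that yM by (cases "x = Max X") simp_all
    show False
    proof -
      have yX: "y \<notin> X" using low[of y] assms(5) by auto
      have sp: "t_spread t (insert y (X - {z}))"
        unfolding t_spread_def
      proof (intro ballI impI)
        fix a b assume h: "a \<in> insert y (X - {z})" "b \<in> insert y (X - {z})" "a < b"
        consider "a = y" "b \<in> X" "b \<noteq> z" | "b = y" "a \<in> X" | "a \<in> X" "b \<in> X" using h by auto
        then show "a + t \<le> b"
        proof cases
          case 1
          then have "z < b" using zm[of b] h by auto
          then have "z + t \<le> b" using fX(3) z 1 unfolding t_spread_def by blast
          then show ?thesis using 1 z by simp
        next
          case 2 then show ?thesis using low[of a] h by simp
        next
          case 3 then show ?thesis using fX(3) h unfolding t_spread_def by blast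
        qed
      qed
      have "card (insert y (X - {z})) = card X"
        using yX z fX card_Suc_Diff1[of X z] by simp
      then have "P (insert y (X - {z}))" using sp y fX unfolding P_def by auto
      moreover have "\<Sum>(insert y (X - {z})) < \<Sum>X"
        using yX z(2) fX(1) sum.remove[OF fX(1) z(1), of "\<lambda>x. x"] by simp
      ultimately show False using mn[of "insert y (X - {z})"] by simp
    qed
  qed
  then show ?thesis using fX by blast
qed

lemma fin_cover_exists:
  assumes "finite Y" "Z \<subseteq> Y" "t_spread t Z" "Z \<noteq> {}" "t > 0"
  shows "\<exists>X. X \<subseteq> Y \<and> t_spread t X \<and> card X = card Z \<and> Y \<subseteq> fin_cover t X"
proof -
  define P where "P = (\<lambda>X. X \<subseteq> Y \<and> t_spread t X \<and> card X = card Z)"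
  have "P Z" unfolding P_def using assms by simp
  then have "\<exists>X. P X \<and> (\<forall>X'. P X' \<longrightarrow> \<Sum>Y - \<Sum>X \<le> \<Sum>Y - \<Sum>X')"
    by (rule ex_has_least_nat[where m = "\<lambda>X. \<Sum>Y - \<Sum>X"])
  then obtain X where X: "P X" and mn: "\<And>X'. P X' \<Longrightarrow> \<Sum>Y - \<Sum>X \<le> \<Sum>Y - \<Sum>X'"
    by (elim exE conjE) simp
  have bd: "\<Sum>X' \<le> \<Sum>Y" if "P X'" for X'
    using that assms(1) unfolding P_def by (intro sum_mono2) auto
  have fX: "finite X" "X \<subseteq> Y" "t_spread t X" "card X = card Z"
    using X finite_subset[OF _ assms(1)] unfolding P_def by simp_all
  have "finite Z" using assms finite_subset by blast
  then have ne: "X \<noteq> {}" using fX assms by auto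
  have "Y \<subseteq> fin_cover t X"
  proof (rule ccontr)
    assume "\<not> Y \<subseteq> fin_cover t X"
    then obtain y where y: "y \<in> Y" "y \<notin> fin_cover t X" by blast
    have yM: "Min X < y" using y(2) by (simp add: fin_cover_def not_le)
    have yc: "y + t \<le> x" if "x \<in> X" "x \<noteq> Min X" "y \<le> x" for x
      using y(2) that by (force simp: fin_cover_def)
    define z where "z = Max {x\<in>X. x < y}"
    have "Min X \<in> {x\<in>X. x < y}" using yM fX ne by simp
    then have "z \<in> {x\<in>X. x < y}" unfolding z_def
      using fX by (intro Max_in) auto
    then have z: "z \<in> X" "z < y" by auto
    have zm: "x \<le> z" if "x \<in> X" "x < y" for x unfolding z_def using that fX by simp
    have high: "y + t \<le> x" if "x \<in> X" "y \<le> x" for x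
      using yc[of x] that yM by (cases "x = Min X") simp_all
    have yX: "y \<notin> X" using high[of y] assms(5) by auto
    have sp: "t_spread t (insert y (X - {z}))"
      unfolding t_spread_def
    proof (intro ballI impI)
      fix a b assume h: "a \<in> insert y (X - {z})" "b \<in> insert y (X - {z})" "a < b"
      consider "a = y" "b \<in> X" | "b = y" "a \<in> X" "a \<noteq> z" | "a \<in> X" "b \<in> X" using h by auto
      then show "a + t \<le> b"
      proof cases
        case 1 then show ?thesis using high[of b] h by simp
      next
        case 2
        then have "a < z" using zm[of a] h by auto
        then have "a + t \<le> z" using fX(3) z 2 unfolding t_spread_def by blast
        then show ?thesis using 2 z by simp
      next
        case 3 then show ?thesis using fX(3) h unfolding t_spread_def by blast
      qed
    qed
    have "card (insert y (X - {z})) = card X"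
      using yX z fX card_Suc_Diff1[of X z] by simp
    then have P': "P (insert y (X - {z}))" using sp y fX unfolding P_def by auto
    have "\<Sum>(insert y (X - {z})) > \<Sum>X"
      using yX z(2) fX(1) sum.remove[OF fX(1) z(1), of "\<lambda>x. x"] by simp
    then show False using mn[OF P'] bd[OF P'] by simp
  qed
  then show ?thesis using fX by blast
qed

text \<open>
The intervals of the cover are disjoint because \<open>X\<close> is \<open>t\<close>-spread.
\<close>

lemma card_init_cover:
  assumes "X \<subseteq> {c..n}" "t_spread t X" "X \<noteq> {}" "t > 0"
  shows "card ({c..n} \<inter> init_cover t X) = (card X - 1) * t + (n + 1 - Max X)"
proof -
  have fX: "finite X" using assms(1) finite_subset by blast
  have M: "Max X \<in> X" using fX assms by simp
  let ?X = "X - {Max X}"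
  have lt: "x + t \<le> Max X" if "x \<in> ?X" for x
  proof -
    have "x < Max X" using Max_ge[OF fX, of x] that by auto
    then show ?thesis using assms(2) that M unfolding t_spread_def by blast
  qed
  have "{c..n} \<inter> init_cover t X = (\<Union>x\<in>?X. {x..<x + t}) \<union> {Max X..n}"
  proof (intro equalityI subsetI)
    fix y assume "y \<in> {c..n} \<inter> init_cover t X"
    then show "y \<in> (\<Union>x\<in>?X. {x..<x + t}) \<union> {Max X..n}" by (auto simp: init_cover_def)
  next
    fix y assume y: "y \<in> (\<Union>x\<in>?X. {x..<x + t}) \<union> {Max X..n}"
    have "c \<le> Max X" "Max X \<le> n" using M assms(1) by auto
    moreover have "c \<le> y \<and> y < Max X" if "x \<in> ?X" "y \<in> {x..<x+t}" for x
    proof -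
      have "c \<le> x" using that(1) assms(1) by auto
      then show ?thesis using lt[OF that(1)] that(2) by simp
    qed
    ultimately have "y \<in> {c..n}" using y by fastforce
    then show "y \<in> {c..n} \<inter> init_cover t X" using y by (auto simp: init_cover_def)
  qed
  moreover have "card ((\<Union>x\<in>?X. {x..<x + t}) \<union> {Max X..n}) = card (\<Union>x\<in>?X. {x..<x + t}) + card {Max X..n}"
  proof (rule card_Un_disjoint)
    show "(\<Union>x\<in>?X. {x..<x + t}) \<inter> {Max X..n} = {}" using lt by fastforce
  qed (use fX in auto)
  moreover have "card (\<Union>x\<in>?X. {x..<x + t}) = (\<Sum>x\<in>?X. card {x..<x + t})"
  proof (rule card_UN_disjoint)
    show "\<forall>i\<in>?X. \<forall>j\<in>?X. i \<noteq> j \<longrightarrow> {i..<i + t} \<inter> {j..<j + t} = {}"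
    proof (intro ballI impI)
      fix i j assume "i \<in> ?X" "j \<in> ?X" "i \<noteq> j"
      then have "i + t \<le> j \<or> j + t \<le> i" using assms(2) unfolding t_spread_def by (meson DiffD1 linorder_neqE_nat)
      then show "{i..<i + t} \<inter> {j..<j + t} = {}" by auto
    qed
  qed (use fX in auto)
  moreover have "card ?X = card X - 1" using fX M by simp
  ultimately show ?thesis by simp
qed

lemma card_fin_cover:
  assumes "X \<subseteq> {1..n}" "t_spread t X" "X \<noteq> {}" "t > 0"
  shows "card ({1..n} \<inter> fin_cover t X) = (card X - 1) * t + Min X"
proof -
  have fX: "finite X" using assms(1) finite_subset by blast
  have M: "Min X \<in> X" using fX assms by simp
  let ?X = "X - {Min X}"
  have M1: "1 \<le> Min X" "Min X \<le> n" using M assms(1) by auto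
  have lt: "Min X + t \<le> x" if "x \<in> ?X" for x
  proof -
    have "Min X < x" using Min_le[OF fX, of x] that by auto
    then show ?thesis using assms(2) that M unfolding t_spread_def by blast
  qed
  have iv: "{1..n} \<inter> {y. y \<le> x \<and> x < y + t} = {x + 1 - t..x}" if "x \<in> ?X" for x
  proof -
    have "x \<le> n" using that assms(1) by auto
    then show ?thesis using lt[OF that] M1 assms(4) by auto
  qed
  have "{1..n} \<inter> fin_cover t X =
      (\<Union>x\<in>?X. {1..n} \<inter> {y. y \<le> x \<and> x < y + t}) \<union> ({1..n} \<inter> {..Min X})"
    unfolding fin_cover_def by blast
  also have "{1..n} \<inter> {..Min X} = {1..Min X}" using M1 by auto
  also have "(\<Union>x\<in>?X. {1..n} \<inter> {y. y \<le> x \<and> x < y + t}) = (\<Union>x\<in>?X. {x + 1 - t..x})"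
    by (rule SUP_cong) (simp_all only: iv)
  finally have "{1..n} \<inter> fin_cover t X = (\<Union>x\<in>?X. {x + 1 - t..x}) \<union> {1..Min X}" .
  moreover have "card ((\<Union>x\<in>?X. {x + 1 - t..x}) \<union> {1..Min X}) = card (\<Union>x\<in>?X. {x + 1 - t..x}) + card {1..Min X}"
  proof (rule card_Un_disjoint)
    have "\<not> y \<le> Min X" if "x \<in> ?X" "y \<in> {x + 1 - t..x}" for x y
      using lt[OF that(1)] that(2) by auto
    then show "(\<Union>x\<in>?X. {x + 1 - t..x}) \<inter> {1..Min X} = {}" by (meson IntE UN_E atLeastAtMost_iff equals0I)
  qed (use fX in auto)
  moreover have "card (\<Union>x\<in>?X. {x + 1 - t..x}) = (\<Sum>x\<in>?X. card {x + 1 - t..x})"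
  proof (rule card_UN_disjoint)
    show "\<forall>i\<in>?X. \<forall>j\<in>?X. i \<noteq> j \<longrightarrow> {i + 1 - t..i} \<inter> {j + 1 - t..j} = {}"
    proof (intro ballI impI)
      fix i j assume "i \<in> ?X" "j \<in> ?X" "i \<noteq> j"
      then have "i + t \<le> j \<or> j + t \<le> i" using assms(2) unfolding t_spread_def by (meson DiffD1 linorder_neqE_nat)
      then show "{i + 1 - t..i} \<inter> {j + 1 - t..j} = {}" by auto
    qed
  qed (use fX in auto)
  moreover have "(\<Sum>x\<in>?X. card {x + 1 - t..x}) = (\<Sum>x\<in>?X. t)"
  proof (rule sum.cong)
    fix x assume "x \<in> ?X"
    from lt[OF this] show "card {x + 1 - t..x} = t" using assms(4) by simp
  qed simp
  moreover have "card ?X = card X - 1" using fX M by simp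
  ultimately show ?thesis by simp
qed

section \<open>Squarefree monomials and numbers of monomials\<close>

text \<open>
The monomial that is the product of the variables with index in the set; it is squarefree.
\<close>

definition sqfree :: "nat set \<Rightarrow> monomial" where
  "sqfree X = (\<Sum>i\<in>X. single i 1)"

lemma lookup_sqfree: "finite X \<Longrightarrow> lookup (sqfree X) i = (if i \<in> X then 1 else 0)"
  unfolding sqfree_def by (simp add: lookup_sum lookup_single when_def)

lemma keys_sqfree [simp]: "finite X \<Longrightarrow> keys (sqfree X) = X"
  by (auto simp: in_keys_iff lookup_sqfree split: if_splits)

lemma sqfree_empty [simp]: "sqfree {} = 0" by (simp add: sqfree_def)

lemma sqfree_Un: "finite X \<Longrightarrow> finite Y \<Longrightarrow> X \<inter> Y = {} \<Longrightarrow> sqfree (X \<union> Y) = sqfree X + sqfree Y"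
  unfolding sqfree_def by (rule sum.union_disjoint)

lemma mdeg_eq: "finite A \<Longrightarrow> keys m \<subseteq> A \<Longrightarrow> mdeg m = (\<Sum>i\<in>A. lookup m i)"
  unfolding mdeg_def by (rule sum.mono_neutral_left) (auto simp: in_keys_iff)

lemma keys_add_monomial: "keys ((a::monomial) + b) = keys a \<union> keys b"
  by (auto simp: in_keys_iff lookup_add)

lemma mdeg_add: "mdeg (a + b) = mdeg a + mdeg b"
proof -
  let ?A = "keys a \<union> keys b"
  have "mdeg (a + b) = (\<Sum>i\<in>?A. lookup (a + b) i)"
    by (rule mdeg_eq) (auto simp: keys_add_monomial)
  also have "\<dots> = mdeg a + mdeg b"
    by (simp add: lookup_add sum.distrib mdeg_eq[of ?A])
  finally show ?thesis .
qed

lemma mdeg_zero [simp]: "mdeg 0 = 0" by (simp add: mdeg_def)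

lemma mdeg_eq_0_iff: "mdeg m = 0 \<longleftrightarrow> m = 0"
  by (auto simp: mdeg_def in_keys_iff poly_mapping_eq_iff fun_eq_iff)

lemma mdeg_sqfree [simp]: "finite X \<Longrightarrow> mdeg (sqfree X) = card X"
  by (simp add: mdeg_def lookup_sqfree)

lemma subset_keys_imp_add:
  assumes "finite X" "X \<subseteq> keys m"
  shows "(m - sqfree X) + sqfree X = m"
proof (rule poly_mapping_eqI)
  fix i
  have "lookup m i \<ge> 1" if "i \<in> X" using assms that by (auto simp: in_keys_iff Suc_le_eq)
  then show "lookup (m - sqfree X + sqfree X) i = lookup m i"
    using assms by (simp add: lookup_add lookup_minus lookup_sqfree)
qed

definition monomials :: "nat set \<Rightarrow> int \<Rightarrow> monomial set" where
  "monomials V e = {m. keys m \<subseteq> V \<and> int (mdeg m) = e}"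

lemma monomials_neg [simp]: "e < 0 \<Longrightarrow> monomials V e = {}"
  by (auto simp: monomials_def)

lemma monomials_empty: "monomials {} e = (if e = 0 then {0} else {})"
proof -
  have "m = 0" if "keys m = {}" for m :: monomial
    using that by simp
  then show ?thesis by (auto simp: monomials_def)
qed

text \<open>
Either \<open>x\<close> does not divide the monomial, or it can be divided out once.
\<close>

lemma monomials_insert:
  assumes "x \<notin> V"
  shows "monomials (insert x V) e = monomials V e \<union> (\<lambda>m. m + sqfree {x}) ` monomials (insert x V) (e - 1)"
proof (intro equalityI subsetI)
  fix m assume m: "m \<in> monomials (insert x V) e"
  show "m \<in> monomials V e \<union> (\<lambda>m. m + sqfree {x}) ` monomials (insert x V) (e - 1)"
  proof (cases "x \<in> keys m")
    case True
    then have eq: "(m - sqfree {x}) + sqfree {x} = m" by (intro subset_keys_imp_add) auto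
    have "mdeg m = mdeg (m - sqfree {x}) + 1" using mdeg_add[of "m - sqfree {x}" "sqfree {x}"] eq by simp
    moreover have "keys (m - sqfree {x}) \<subseteq> keys m"
      using keys_add_monomial[of "m - sqfree {x}" "sqfree {x}"] eq by auto
    ultimately have "m - sqfree {x} \<in> monomials (insert x V) (e - 1)" using m by (auto simp: monomials_def)
    then show ?thesis using eq by (metis UnI2 image_eqI)
  next
    case False
    then show ?thesis using m by (auto simp: monomials_def)
  qed
next
  fix m assume "m \<in> monomials V e \<union> (\<lambda>m. m + sqfree {x}) ` monomials (insert x V) (e - 1)"
  then show "m \<in> monomials (insert x V) e"
    by (auto simp: monomials_def keys_add_monomial mdeg_add)
qed

lemma finite_monomials:
  assumes "finite V"
  shows "finite (monomials V e)"
  using assms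
proof (induction V arbitrary: e rule: finite_induct)
  case empty
  then show ?case by (simp add: monomials_empty)
next
  case (insert x V)
  have "finite (monomials (insert x V) (int k - 1))" for k
  proof (induction k)
    case 0
    then show ?case by simp
  next
    case (Suc k)
    then show ?case using insert monomials_insert[of x V "int (Suc k) - 1"] by simp
  qed
  from this[of "nat (e + 1)"] show ?case by (cases "e < 0") (simp_all)
qed

definition num_monomials :: "nat set \<Rightarrow> int \<Rightarrow> int" where
  "num_monomials V e = int (card (monomials V e))"

lemma num_monomials_insert:
  assumes "finite V" "x \<notin> V"
  shows "num_monomials V e = num_monomials (insert x V) e - num_monomials (insert x V) (e - 1)"
proof -
  have "card (monomials (insert x V) e) = card (monomials V e) + card ((\<lambda>m. m + sqfree {x}) ` monomials (insert x V) (e - 1))"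
    unfolding monomials_insert[OF assms(2), of e]
  proof (rule card_Un_disjoint)
    show "monomials V e \<inter> (\<lambda>m. m + sqfree {x}) ` monomials (insert x V) (e - 1) = {}"
      using assms by (auto simp: monomials_def keys_add_monomial)
  qed (use assms finite_monomials in auto)
  moreover have "card ((\<lambda>m. m + sqfree {x}) ` monomials (insert x V) (e - 1)) = card (monomials (insert x V) (e - 1))"
    by (rule card_image) (auto simp: inj_on_def)
  ultimately show ?thesis by (simp add: num_monomials_def)
qed

text \<open>
The Hilbert series of a polynomial ring is multiplied by \<open>1 - z\<close> for every omitted variable;
this is the coefficient form of the expansion of \<open>(1 - z) ^ card D\<close>.
\<close>

lemma num_monomials_remove:
  assumes "finite V" "finite D" "V \<inter> D = {}" "card D \<le> N"
  shows "num_monomials V e = (\<Sum>i\<le>N. (-1) ^ i * int (card D choose i) * num_monomials (V \<union> D) (e - int i))"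
  using assms(2,1,3,4)
proof (induction D arbitrary: V N rule: finite_induct)
  case empty
  have "(\<Sum>i\<le>N. (-1) ^ i * int (0 choose i) * num_monomials V (e - int i)) = (\<Sum>i\<in>{0}. (-1) ^ i * int (0 choose i) * num_monomials V (e - int i))"
    by (rule sum.mono_neutral_right) (auto simp: binomial_eq_0)
  then show ?case by simp
next
  case (insert x D)
  then obtain M where N: "N = Suc M" "card D \<le> M" by (cases N) auto
  let ?h = "\<lambda>i. num_monomials (V \<union> insert x D) (e - int i)"
  let ?a = "\<lambda>i. (-1) ^ i * int (card D choose i)"
  have "num_monomials V e = (\<Sum>i\<le>M. ?a i * num_monomials (V \<union> D) (e - int i))"
    using insert N by (intro insert.IH) auto
  also have "\<dots> = (\<Sum>i\<le>M. ?a i * (?h i - ?h (Suc i)))"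
  proof (rule sum.cong)
    fix i
    have "num_monomials (V \<union> D) (e - int i) = ?h i - ?h (Suc i)"
      using insert.prems insert.hyps num_monomials_insert[of "V \<union> D" x "e - int i"] by (simp add: algebra_simps)
    then show "?a i * num_monomials (V \<union> D) (e - int i) = ?a i * (?h i - ?h (Suc i))" by simp
  qed simp
  also have "\<dots> = (\<Sum>i\<le>M. ?a i * ?h i) - (\<Sum>i\<le>M. ?a i * ?h (Suc i))"
    by (simp add: right_diff_distrib sum_subtractf)
  also have "(\<Sum>i\<le>M. ?a i * ?h i) = (\<Sum>i\<le>Suc M. ?a i * ?h i)"
    using N by (simp add: binomial_eq_0)
  also have "\<dots> = ?h 0 + (\<Sum>i\<le>M. ?a (Suc i) * ?h (Suc i))"
    by (subst sum.atMost_Suc_shift) simp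
  also have "?h 0 + (\<Sum>i\<le>M. ?a (Suc i) * ?h (Suc i)) - (\<Sum>i\<le>M. ?a i * ?h (Suc i)) =
      ?h 0 + (\<Sum>i\<le>M. (-1) ^ Suc i * int (Suc (card D) choose Suc i) * ?h (Suc i))"
  proof -
    have "?a (Suc i) * ?h (Suc i) - ?a i * ?h (Suc i) = (-1) ^ Suc i * int (Suc (card D) choose Suc i) * ?h (Suc i)" for i
      by (simp add: algebra_simps)
    then show ?thesis by (simp add: sum_subtractf[symmetric])
  qed
  also have "\<dots> = (\<Sum>i\<le>N. (-1) ^ i * int (Suc (card D) choose i) * ?h i)"
    unfolding N by (subst sum.atMost_Suc_shift) simp
  finally show ?case using insert by simp
qed

text \<open>
Multiples of the generators are sorted by the unique generator \<open>X\<close> whose cover \<open>C X\<close> contains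
all variables of the multiple.  The quotient by that generator is then an arbitrary monomial in
the variables of \<open>C X\<close>.
\<close>

lemma card_divisible_by_cover:
  assumes V: "finite V" and W: "finite W"
    and sub: "\<And>X::nat set. X \<in> W \<Longrightarrow> X \<subseteq> V \<inter> C X \<and> card X = d"
    and ex: "\<And>Y. Y \<subseteq> V \<Longrightarrow> \<exists>X\<in>W. X \<subseteq> Y \<Longrightarrow> \<exists>X\<in>W. X \<subseteq> Y \<and> Y \<subseteq> C X"
    and uniq: "\<And>X X' Y. X \<in> W \<Longrightarrow> X' \<in> W \<Longrightarrow> Y \<subseteq> V \<Longrightarrow> X \<subseteq> Y \<Longrightarrow> Y \<subseteq> C X \<Longrightarrow> X' \<subseteq> Y \<Longrightarrow> Y \<subseteq> C X' \<Longrightarrow> X = X'"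
  shows "int (card {m \<in> monomials V e. \<exists>X\<in>W. X \<subseteq> keys m}) = (\<Sum>X\<in>W. num_monomials (V \<inter> C X) (e - int d))"
proof -
  let ?S = "\<lambda>X. (\<lambda>m. m + sqfree X) ` monomials (V \<inter> C X) (e - int d)"
  have fin: "finite X" if "X \<in> W" for X using sub[OF that] V finite_subset by blast
  have key: "X \<subseteq> keys m \<and> keys m \<subseteq> C X \<and> m \<in> monomials V e" if "X \<in> W" "m \<in> ?S X" for X m
    using that sub[OF that(1)] fin[OF that(1)] by (auto simp: monomials_def keys_add_monomial mdeg_add)
  have "{m \<in> monomials V e. \<exists>X\<in>W. X \<subseteq> keys m} = (\<Union>X\<in>W. ?S X)"
  proof (intro equalityI subsetI)
    fix m assume "m \<in> {m \<in> monomials V e. \<exists>X\<in>W. X \<subseteq> keys m}"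
    then have m: "m \<in> monomials V e" "\<exists>X\<in>W. X \<subseteq> keys m" by auto
    then obtain X where X: "X \<in> W" "X \<subseteq> keys m" "keys m \<subseteq> C X"
      using ex[of "keys m"] by (auto simp: monomials_def)
    have eq: "(m - sqfree X) + sqfree X = m" using X fin by (intro subset_keys_imp_add) auto
    have "mdeg m = mdeg (m - sqfree X) + card X"
      using mdeg_add[of "m - sqfree X" "sqfree X"] eq fin[OF X(1)] by simp
    moreover have "keys (m - sqfree X) \<subseteq> keys m"
      using keys_add_monomial[of "m - sqfree X" "sqfree X"] eq by auto
    ultimately have "m - sqfree X \<in> monomials (V \<inter> C X) (e - int d)"
      using m X sub[OF X(1)] by (auto simp: monomials_def)
    then have "m \<in> ?S X" using eq by (metis image_eqI)
    then show "m \<in> (\<Union>X\<in>W. ?S X)" using X by blast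
  next
    fix m assume "m \<in> (\<Union>X\<in>W. ?S X)"
    then show "m \<in> {m \<in> monomials V e. \<exists>X\<in>W. X \<subseteq> keys m}" using key by blast
  qed
  moreover have "card (\<Union>X\<in>W. ?S X) = (\<Sum>X\<in>W. card (?S X))"
  proof (rule card_UN_disjoint)
    show "\<forall>i\<in>W. \<forall>j\<in>W. i \<noteq> j \<longrightarrow> ?S i \<inter> ?S j = {}"
    proof (intro ballI impI, rule ccontr)
      fix i j assume ij: "i \<in> W" "j \<in> W" "i \<noteq> j" "?S i \<inter> ?S j \<noteq> {}"
      then obtain m where "m \<in> ?S i" "m \<in> ?S j" by blast
      from key[OF ij(1) this(1)] key[OF ij(2) this(2)] uniq[OF ij(1,2), of "keys m"] ij(3)
      show False by (auto simp: monomials_def)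
    qed
  qed (use W V finite_monomials in auto)
  moreover have "card (?S X) = card (monomials (V \<inter> C X) (e - int d))" for X
    by (rule card_image) (auto simp: inj_on_def)
  ultimately show ?thesis by (simp add: num_monomials_def)
qed

section \<open>Hilbert functions of initial and final segments\<close>

text \<open>
The greedy divisor of a monomial is the lexicographically largest of its \<open>t\<close>-spread divisors of
degree \<open>d\<close>; as \<open>W\<close> is closed upwards, it contains this divisor as soon as it contains one of
them.  The parameter \<open>c\<close> leaves the variables below \<open>c\<close> free; the values 1 and 2 occur below.
\<close>

lemma Hilbert_function_initial_segment:
  assumes "t > 0" "d > 0" "1 \<le> c" "n \<le> N"
    and W: "\<And>X. X \<in> W \<Longrightarrow> X \<subseteq> {c..n} \<and> card X = d \<and> t_spread t X"
    and up: "\<And>X Z. X \<in> W \<Longrightarrow> Z \<subseteq> {c..n} \<Longrightarrow> card Z = d \<Longrightarrow> t_spread t Z \<Longrightarrow> lex_geq Z X \<Longrightarrow> Z \<in> W"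
  shows "int (card {m \<in> monomials {1..n} e. \<exists>X\<in>W. X \<subseteq> keys m}) =
    (\<Sum>X\<in>W. \<Sum>i\<le>N. (-1) ^ i * int ((Max X - (d - 1) * t - c) choose i) * num_monomials {1..n} (e - int d - int i))"
proof -
  let ?C = "\<lambda>X. {..<c} \<union> init_cover t X"
  have fin: "finite X" "X \<noteq> {}" if "X \<in> W" for X
    using W[OF that] assms(2) finite_subset[OF _ finite_atLeastAtMost] by auto
  have "finite W" by (rule finite_subset[of _ "Pow {c..n}"]) (use W in auto)
  moreover have "X \<subseteq> {1..n} \<inter> ?C X \<and> card X = d" if "X \<in> W" for X
  proof -
    have "X \<subseteq> init_cover t X"
      using assms(1) by (auto simp: init_cover_def)
    moreover have "{c..n} \<subseteq> {1..n}" using assms(3) by auto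
    ultimately show ?thesis using W[OF that] by blast
  qed
  moreover have "\<exists>X\<in>W. X \<subseteq> Y \<and> Y \<subseteq> ?C X" if Y: "Y \<subseteq> {1..n}" and ex: "\<exists>X\<in>W. X \<subseteq> Y" for Y
  proof -
    from ex obtain Z where Z: "Z \<in> W" "Z \<subseteq> Y" by blast
    have fY: "finite (Y \<inter> {c..n})" by simp
    have "Z \<subseteq> Y \<inter> {c..n}" using Z W by blast
    then have "\<exists>X. X \<subseteq> Y \<inter> {c..n} \<and> t_spread t X \<and> card X = card Z \<and> Y \<inter> {c..n} \<subseteq> init_cover t X"
      using init_cover_exists[OF fY \<open>Z \<subseteq> Y \<inter> {c..n}\<close>] W[OF Z(1)] fin[OF Z(1)] assms(1) by simp
    then obtain X where X: "X \<subseteq> Y \<inter> {c..n}" "t_spread t X" "card X = card Z" "Y \<inter> {c..n} \<subseteq> init_cover t X"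
      by blast
    have "finite X" using X(1) fY by (rule finite_subset)
    moreover have "X \<noteq> {}" using X(3) W[OF Z(1)] assms(2) by auto
    ultimately have "lex_geq X Z"
      using init_cover_lex_max[OF _ _ X(1) X(4), of Z] fin[OF Z(1)] \<open>Z \<subseteq> Y \<inter> {c..n}\<close> W[OF Z(1)] X(3) by simp
    then have "X \<in> W" using up[OF Z(1), of X] X W[OF Z(1)] by auto
    moreover have "Y \<subseteq> ?C X"
    proof
      fix y assume "y \<in> Y"
      then show "y \<in> ?C X" using X(4) subsetD[OF Y, of y] by (cases "y < c") auto
    qed
    ultimately show ?thesis using X(1) by blast
  qed
  moreover have "X = X'"
    if h: "X \<in> W" "X' \<in> W" "Y \<subseteq> {1..n}" "X \<subseteq> Y" "Y \<subseteq> ?C X" "X' \<subseteq> Y" "Y \<subseteq> ?C X'" for X X' Y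
  proof -
    have s: "X \<subseteq> Y \<inter> {c..}" "X' \<subseteq> Y \<inter> {c..}" "Y \<inter> {c..} \<subseteq> init_cover t X" "Y \<inter> {c..} \<subseteq> init_cover t X'"
      using h(4,5,6,7) W[OF h(1)] W[OF h(2)] by auto
    have "lex_geq X X'"
      by (rule init_cover_lex_max[OF _ _ s(1,3)]) (use fin h s W in auto)
    moreover have "lex_geq X' X"
      by (rule init_cover_lex_max[OF _ _ s(2,4)]) (use fin h s W in auto)
    ultimately show ?thesis by (rule lex_geq_antisym)
  qed
  ultimately have "int (card {m \<in> monomials {1..n} e. \<exists>X\<in>W. X \<subseteq> keys m}) = (\<Sum>X\<in>W. num_monomials ({1..n} \<inter> ?C X) (e - int d))"
    by (intro card_divisible_by_cover) simp_all
  also have "\<dots> = (\<Sum>X\<in>W. \<Sum>i\<le>N. (-1) ^ i * int ((Max X - (d - 1) * t - c) choose i) * num_monomials {1..n} (e - int d - int i))"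
  proof (rule sum.cong)
    fix X assume X: "X \<in> W"
    let ?D = "{c..n} - init_cover t X"
    have M: "Max X \<in> {c..n}" using W[OF X] fin[OF X] Max_in by blast
    have cc: "card ({c..n} \<inter> init_cover t X) = (d - 1) * t + (n + 1 - Max X)"
      using card_init_cover[of X c n t] W[OF X] fin[OF X] assms(1) by simp
    have "card ?D = card {c..n} - card ({c..n} \<inter> init_cover t X)"
      by (rule card_Diff_subset_Int) simp
    then have D: "card ?D = Max X - (d - 1) * t - c" unfolding cc using M by simp
    have un: "({1..n} \<inter> ?C X) \<union> ?D = {1..n}" using assms(3) by auto
    have "num_monomials ({1..n} \<inter> ?C X) (e - int d) = (\<Sum>i\<le>N. (-1) ^ i * int (card ?D choose i) *
       num_monomials (({1..n} \<inter> ?C X) \<union> ?D) (e - int d - int i))"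
    proof (rule num_monomials_remove)
      show "card ?D \<le> N" using D M assms(4) by auto
    qed auto
    then show "num_monomials ({1..n} \<inter> ?C X) (e - int d) = (\<Sum>i\<le>N. (-1) ^ i * int ((Max X - (d - 1) * t - c) choose i) * num_monomials {1..n} (e - int d - int i))"
      unfolding un D .
  qed simp
  finally show ?thesis .
qed

text \<open>
Here the greedy divisor from above is the smallest of the divisors.  The set \<open>G\<close> allows for
variables that are excluded from the monomials that are counted; they are smaller than every
variable of a generator, so they belong to all covers and add \<open>card G\<close> to the omitted variables.
\<close>

lemma Hilbert_function_final_segment:
  assumes "t > 0" "d > 0" "n \<le> N" "G \<subseteq> {1..n}"
    and W: "\<And>X. X \<in> W \<Longrightarrow> X \<in> spread_sets n d t \<and> (\<forall>g\<in>G. g < Min X)"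
    and down: "\<And>X Z. X \<in> W \<Longrightarrow> Z \<in> spread_sets n d t \<Longrightarrow> lex_geq X Z \<Longrightarrow> Z \<in> W"
  shows "int (card {m \<in> monomials ({1..n} - G) e. \<exists>X\<in>W. X \<subseteq> keys m}) =
    (\<Sum>X\<in>W. \<Sum>i\<le>N. (-1) ^ i * int ((card G + (n - Min X - (d - 1) * t)) choose i) * num_monomials {1..n} (e - int d - int i))"
proof -
  let ?V = "{1..n} - G"
  have fin: "finite X" "X \<noteq> {}" if "X \<in> W" for X
    using W[OF that] assms(2) finite_subset[OF _ finite_atLeastAtMost] unfolding spread_sets_def by auto
  have W': "X \<subseteq> {1..n} \<and> card X = d \<and> t_spread t X \<and> X \<subseteq> ?V" if "X \<in> W" for X
  proof -
    have "X \<inter> G = {}" using W[OF that] fin[OF that] by (meson Min_le disjoint_iff not_le)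
    then show ?thesis using W[OF that] by (auto simp: spread_sets_def)
  qed
  have "finite W" by (rule finite_subset[of _ "Pow {1..n}"]) (use W' in auto)
  moreover have "X \<subseteq> ?V \<inter> fin_cover t X \<and> card X = d" if "X \<in> W" for X
  proof -
    have "X \<subseteq> fin_cover t X" using assms(1) by (auto simp: fin_cover_def)
    then show ?thesis using W'[OF that] by blast
  qed
  moreover have "\<exists>X\<in>W. X \<subseteq> Y \<and> Y \<subseteq> fin_cover t X" if Y: "Y \<subseteq> ?V" and ex: "\<exists>X\<in>W. X \<subseteq> Y" for Y
  proof -
    from ex obtain Z where Z: "Z \<in> W" "Z \<subseteq> Y" by blast
    have fY: "finite Y" using Y by (rule finite_subset) simp
    have "\<exists>X. X \<subseteq> Y \<and> t_spread t X \<and> card X = card Z \<and> Y \<subseteq> fin_cover t X"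
      using fin_cover_exists[OF fY Z(2)] W'[OF Z(1)] fin[OF Z(1)] assms(1) by simp
    then obtain X where X: "X \<subseteq> Y" "t_spread t X" "card X = card Z" "Y \<subseteq> fin_cover t X"
      by blast
    have "finite X" using X(1) fY by (rule finite_subset)
    moreover have "X \<noteq> {}" using X(3) W'[OF Z(1)] assms(2) by auto
    ultimately have "lex_geq Z X"
      using fin_cover_lex_min[OF _ _ X(1) X(4), of Z] fin[OF Z(1)] Z(2) W'[OF Z(1)] X(3) by simp
    moreover have "X \<in> spread_sets n d t" using X Y W'[OF Z(1)] by (auto simp: spread_sets_def)
    ultimately have "X \<in> W" using down[OF Z(1)] by blast
    then show ?thesis using X by blast
  qed
  moreover have "X = X'"
    if h: "X \<in> W" "X' \<in> W" "Y \<subseteq> ?V" "X \<subseteq> Y" "Y \<subseteq> fin_cover t X" "X' \<subseteq> Y" "Y \<subseteq> fin_cover t X'" for X X' Y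
  proof -
    have "lex_geq X' X"
      by (rule fin_cover_lex_min[OF _ _ h(4,5)]) (use fin h W' in auto)
    moreover have "lex_geq X X'"
      by (rule fin_cover_lex_min[OF _ _ h(6,7)]) (use fin h W' in auto)
    ultimately show ?thesis by (simp add: lex_geq_antisym)
  qed
  ultimately have "int (card {m \<in> monomials ?V e. \<exists>X\<in>W. X \<subseteq> keys m}) = (\<Sum>X\<in>W. num_monomials (?V \<inter> fin_cover t X) (e - int d))"
    by (intro card_divisible_by_cover) simp_all
  also have "\<dots> = (\<Sum>X\<in>W. \<Sum>i\<le>N. (-1) ^ i * int ((card G + (n - Min X - (d - 1) * t)) choose i) * num_monomials {1..n} (e - int d - int i))"
  proof (rule sum.cong)
    fix X assume X: "X \<in> W"
    let ?E = "{1..n} - fin_cover t X"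
    let ?D = "?E \<union> G"
    have M: "Min X \<in> {1..n}" using W'[OF X] fin[OF X] Min_in by blast
    have cc: "card ({1..n} \<inter> fin_cover t X) = (d - 1) * t + Min X"
      using card_fin_cover[of X n t] W'[OF X] fin[OF X] assms(1) by simp
    have "card ?E = card {1..n} - card ({1..n} \<inter> fin_cover t X)"
      by (rule card_Diff_subset_Int) simp
    then have E: "card ?E = n - Min X - (d - 1) * t" unfolding cc by simp
    have fG: "finite G" using assms(4) finite_subset by blast
    have "G \<subseteq> fin_cover t X" using W[OF X] by (auto simp: fin_cover_def)
    then have "?E \<inter> G = {}" by blast
    then have D: "card ?D = card G + (n - Min X - (d - 1) * t)"
      using E fG by (simp add: card_Un_disjoint)
    have un: "(?V \<inter> fin_cover t X) \<union> ?D = {1..n}" using assms(4) by auto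
    have "num_monomials (?V \<inter> fin_cover t X) (e - int d) = (\<Sum>i\<le>N. (-1) ^ i * int (card ?D choose i) *
       num_monomials ((?V \<inter> fin_cover t X) \<union> ?D) (e - int d - int i))"
    proof (rule num_monomials_remove)
      have "card ?D \<le> card {1..n}" using un by (intro card_mono) auto
      then show "card ?D \<le> N" using assms(3) by simp
    qed (use fG in auto)
    then show "num_monomials (?V \<inter> fin_cover t X) (e - int d) = (\<Sum>i\<le>N. (-1) ^ i * int ((card G + (n - Min X - (d - 1) * t)) choose i) * num_monomials {1..n} (e - int d - int i))"
      unfolding un D .
  qed simp
  finally show ?thesis .
qed

section \<open>Lexicographic order on monomials and on sets\<close>

lemma sqfree_inj: "finite X \<Longrightarrow> finite Y \<Longrightarrow> sqfree X = sqfree Y \<Longrightarrow> X = Y"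
  by (metis keys_sqfree)

lemma var_prod_strict_sorted: "sorted_wrt (<) ks \<Longrightarrow> var_prod ks = sqfree (set ks)"
  unfolding var_prod_def sqfree_def by (subst sum_list_distinct_conv_sum_set) (auto simp: strict_sorted_iff)

text \<open>
The first position where the lists differ is also the first element where the sets differ: an
element of the larger list from that position on exceeds \<open>ks ! s\<close>.
\<close>

lemma lex_above_of_sorted_lists:
  assumes "sorted_wrt (<) ks" "sorted_wrt (<) js" "length ks = length js"
    and s: "s < length ks" "\<forall>k<s. ks ! k = js ! k" "ks ! s < js ! s"
  shows "lex_above (set ks) (set js)"
  unfolding lex_above_def
proof (intro bexI allI impI)
  have less_ks: "ks ! i < ks ! j" if "i < j" "j < length ks" for i j
    using assms(1) that by (simp add: sorted_wrt_iff_nth_less)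
  have less_js: "js ! i < js ! j" if "i < j" "j < length js" for i j
    using assms(2) that by (simp add: sorted_wrt_iff_nth_less)
  have "ks ! s \<notin> set js"
  proof
    assume "ks ! s \<in> set js"
    then obtain k where k: "k < length js" "js ! k = ks ! s" by (auto simp: in_set_conv_nth)
    consider "k < s" | "k = s" | "s < k" by linarith
    then show False
    proof cases
      case 1 then show ?thesis using less_ks[of k s] s k by simp
    next
      case 2 then show ?thesis using s k by simp
    next
      case 3 then show ?thesis using less_js[of s k] s k by simp
    qed
  qed
  then show "ks ! s \<in> set ks - set js" using s by simp
  fix b assume b: "b < ks ! s"
  have "k < s" if "k < length ks" "ks ! k = b" for k
    using less_ks[of s k] that b by (metis linorder_neqE_nat less_asym)
  moreover have "k < s" if "k < length js" "js ! k = b" for k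
    using less_js[of s k] that b s(3) by (metis linorder_neqE_nat less_asym less_trans)
  ultimately show "b \<in> set ks \<longleftrightarrow> b \<in> set js"
    using s assms(3) unfolding in_set_conv_nth by (metis less_trans)
qed

text \<open>
If the set comparison holds, the lists of elements differ at some first position, and the wrong sign
there would reverse the comparison of the sets.
\<close>

lemma slex_gr_sqfree:
  assumes "finite X" "finite Y"
  shows "slex_gr (sqfree X) (sqfree Y) \<longleftrightarrow> card X = card Y \<and> lex_above X Y"
proof
  assume "slex_gr (sqfree X) (sqfree Y)"
  then obtain ks js s where h: "sqfree X = var_prod ks" "sqfree Y = var_prod js"
    "sorted_wrt (<) ks" "sorted_wrt (<) js" "length ks = length js"
    "s < length ks" "\<forall>k<s. ks ! k = js ! k" "ks ! s < js ! s"
    unfolding slex_gr_def by blast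
  have "X = set ks" "Y = set js"
    using h assms var_prod_strict_sorted sqfree_inj by (metis List.finite_set)+
  moreover have "card (set ks) = length ks" "card (set js) = length js"
    using h(3,4) by (simp_all add: strict_sorted_iff distinct_card)
  ultimately show "card X = card Y \<and> lex_above X Y"
    using lex_above_of_sorted_lists[OF h(3-8)] h(5) by simp
next
  assume a: "card X = card Y \<and> lex_above X Y"
  define ks js where "ks = sorted_list_of_set X" and "js = sorted_list_of_set Y"
  have ks: "sorted_wrt (<) ks" "set ks = X" "length ks = card X" using assms by (auto simp: ks_def)
  have js: "sorted_wrt (<) js" "set js = Y" "length js = card Y" using assms by (auto simp: js_def)
  have len: "length ks = length js" using ks js a by simp
  have ne: "ks \<noteq> js" using ks js a by (auto simp: lex_above_def)
  define s where "s = (LEAST s. ks ! s \<noteq> js ! s)"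
  have ex: "\<exists>s. s < length ks \<and> ks ! s \<noteq> js ! s" using ne len by (metis nth_equalityI)
  then have "ks ! s \<noteq> js ! s" unfolding s_def by (metis (mono_tags, lifting) LeastI)
  moreover have "s < length ks" using ex unfolding s_def
    by (metis (mono_tags, lifting) Least_le le_less_trans)
  moreover have below: "\<forall>k<s. ks ! k = js ! k" unfolding s_def using not_less_Least by blast
  moreover have "\<not> js ! s < ks ! s"
  proof
    assume "js ! s < ks ! s"
    then have "lex_above (set js) (set ks)"
      using lex_above_of_sorted_lists[OF js(1) ks(1), of s] len below \<open>s < length ks\<close> by simp
    then show False using a lex_above_asym ks js by blast
  qed
  ultimately have "ks ! s < js ! s" by simp
  then show "slex_gr (sqfree X) (sqfree Y)" unfolding slex_gr_def
    using ks js len below \<open>s < length ks\<close> var_prod_strict_sorted by metis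
qed

lemma slex_ge_sqfree:
  assumes "finite X" "finite Y"
  shows "slex_ge (sqfree X) (sqfree Y) \<longleftrightarrow> card X = card Y \<and> lex_geq X Y"
  using slex_gr_sqfree[OF assms] sqfree_inj[OF assms] unfolding slex_ge_def lex_geq_def by metis

text \<open>
As \<open>t > 0\<close>, the gap condition makes the index lists strictly increasing, so that they are
determined by their sets.
\<close>

lemma spread_monomials_eq:
  assumes "t > 0"
  shows "spread_monomials n d t = sqfree ` spread_sets n d t"
proof (intro equalityI subsetI)
  fix m assume "m \<in> spread_monomials n d t"
  then obtain js where js: "m = var_prod js" "length js = d" "set js \<subseteq> {1..n}" "sorted js"
    and gap: "\<forall>k. Suc k < d \<longrightarrow> js ! Suc k - js ! k \<ge> t"
    unfolding spread_monomials_def by blast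
  have step: "js ! k + t \<le> js ! Suc k" if "Suc k < d" for k
    using gap that assms by fastforce
  have nth: "js ! i + t \<le> js ! j" if "i < j" "j < d" for i j
    using that
  proof (induction j)
    case (Suc j)
    then show ?case using step[of j] by (cases "i = j") auto
  qed simp
  have st: "sorted_wrt (<) js"
    using nth js(2) assms by (force simp: sorted_wrt_iff_nth_less)
  have "t_spread t (set js)" unfolding t_spread_def
  proof (intro ballI impI)
    fix x y assume "x \<in> set js" "y \<in> set js" "x < y"
    then obtain i j where ij: "i < d" "js ! i = x" "j < d" "js ! j = y" using js(2) by (auto simp: in_set_conv_nth)
    then have "i < j" using \<open>x < y\<close> nth[of j i] by (metis add_leD1 leD linorder_neqE_nat less_irrefl)
    then show "x + t \<le> y" using nth[of i j] ij by simp
  qed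
  moreover have "card (set js) = d" using st js(2) by (simp add: strict_sorted_iff distinct_card)
  ultimately have "set js \<in> spread_sets n d t" using js by (simp add: spread_sets_def)
  then show "m \<in> sqfree ` spread_sets n d t" using js(1) var_prod_strict_sorted[OF st] by blast
next
  fix m assume "m \<in> sqfree ` spread_sets n d t"
  then obtain X where X: "m = sqfree X" "X \<subseteq> {1..n}" "card X = d" "t_spread t X"
    unfolding spread_sets_def by blast
  have fX: "finite X" using X finite_subset by blast
  let ?js = "sorted_list_of_set X"
  have st: "sorted_wrt (<) ?js" using fX by simp
  have "?js ! Suc k - ?js ! k \<ge> t" if "Suc k < d" for k
  proof -
    have l: "length ?js = d" using X fX by simp
    have "?js ! k < ?js ! Suc k" using st that l by (simp add: sorted_wrt_iff_nth_less)
    moreover have "?js ! k \<in> X" "?js ! Suc k \<in> X"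
      using that l fX by (metis Suc_lessD nth_mem set_sorted_list_of_set)+
    ultimately have "?js ! k + t \<le> ?js ! Suc k" using X(4) by (simp add: t_spread_def)
    then show ?thesis by simp
  qed
  moreover have "m = var_prod ?js" using X(1) var_prod_strict_sorted[OF st] fX by simp
  ultimately show "m \<in> spread_monomials n d t" unfolding spread_monomials_def
    using X fX by (intro CollectI exI[of _ ?js]) (simp)
qed

section \<open>Dimensions of subspaces\<close>

text \<open>
The ambient spaces of polynomials are infinite-dimensional, so finiteness is a property of the
subspace; \<open>dim\<close> alone gives no information on a subspace without a finite spanning set.
\<close>

definition fin_dim :: "('k::field \<Rightarrow> 'a::ab_group_add \<Rightarrow> 'a) \<Rightarrow> 'a set \<Rightarrow> bool" where
  "fin_dim s V \<longleftrightarrow> module.subspace s V \<and> (\<exists>B. finite B \<and> V \<subseteq> module.span s B)"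

text \<open>
A basis \<open>BK\<close> of the kernel is extended to a basis of \<open>V\<close>; the image of the added part \<open>C\<close> is
a basis of the image of \<open>V\<close>, since the span of \<open>C\<close> meets the kernel only in 0.
\<close>

lemma rank_nullity:
  assumes lin: "Vector_Spaces.linear s1 s2 f" and V: "fin_dim s1 V"
  shows "vector_space.dim s1 V = vector_space.dim s1 {x\<in>V. f x = 0} + vector_space.dim s2 (f ` V)"
proof -
  interpret f: Vector_Spaces.linear s1 s2 f by (rule lin)
  interpret p: vector_space_pair s1 s1 by unfold_locales
  from V have sub: "f.vs1.subspace V" by (simp add: fin_dim_def)
  from V obtain B where B: "finite B" "V \<subseteq> f.vs1.span B" by (auto simp: fin_dim_def)
  let ?K = "{x\<in>V. f x = 0}"
  have subK: "f.vs1.subspace ?K"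
    using sub unfolding f.vs1.subspace_def by (auto simp: f.add f.scale)
  obtain BK where BK: "BK \<subseteq> ?K" "f.vs1.independent BK" "?K \<subseteq> f.vs1.span BK" "card BK = f.vs1.dim ?K"
    using f.vs1.basis_exists by blast
  have "BK \<subseteq> V" using BK by blast
  then obtain BV where BV: "BK \<subseteq> BV" "BV \<subseteq> V" "f.vs1.independent BV" "V \<subseteq> f.vs1.span BV"
    using f.vs1.maximal_independent_subset_extend[OF _ BK(2)] by blast
  have finV: "finite BV" using f.vs1.independent_span_bound[OF B(1) BV(3)] BV(2) B(2) by blast
  have dimV: "f.vs1.dim V = card BV" using f.vs1.basis_card_eq_dim[OF BV(2,4,3)] by simp
  define C where "C = BV - BK"
  have spC: "f.vs1.span C \<subseteq> V" using f.vs1.span_minimal[of C V] sub BV(2) C_def by blast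
  \<comment> \<open>A map that is the identity on \<open>BK\<close> and 0 on \<open>C\<close> shows that their spans meet only in 0.\<close>
  obtain g where g: "Vector_Spaces.linear s1 s1 g" "\<forall>x\<in>BV. g x = (if x \<in> BK then x else 0)"
    using p.linear_independent_extend[OF BV(3), of "\<lambda>x. if x \<in> BK then x else 0"] by blast
  interpret g: Vector_Spaces.linear s1 s1 g by (rule g(1))
  have inj: "inj_on f (f.vs1.span C)"
    unfolding f.inj_on_iff_eq_0[OF f.vs1.subspace_span]
  proof (intro ballI impI)
    fix x assume x: "x \<in> f.vs1.span C" "f x = 0"
    then have "x \<in> f.vs1.span BK" using spC BK(3) by blast
    moreover have "g y = y" if "y \<in> BK" for y using that g(2) BV(1) by auto
    ultimately have "g x = x"
      using p.linear_eq_on_span[OF g(1) f.vs1.linear_id, of BK x] by simp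
    moreover have "g x = 0" using g.eq_0_on_span[OF _ x(1)] g(2) by (auto simp: C_def)
    ultimately show "x = 0" by simp
  qed
  have indC: "f.vs1.independent C" using BV(3) f.vs1.independent_mono C_def by blast
  have "f.vs2.independent (f ` C)" by (rule f.independent_injective_image[OF indC inj])
  moreover have "f ` C \<subseteq> f ` V" using BV(2) C_def by blast
  moreover have "f ` V \<subseteq> f.vs2.span (f ` C)"
  proof -
    have "f ` V \<subseteq> f ` f.vs1.span BV" using BV(4) by blast
    also have "\<dots> = f.vs2.span (f ` BV)" by (rule f.span_image[symmetric])
    also have "\<dots> \<subseteq> f.vs2.span (insert 0 (f ` C))"
      by (rule f.vs2.span_mono) (use BK(1) C_def in auto)
    finally show ?thesis by simp
  qed
  ultimately have "f.vs2.dim (f ` V) = card (f ` C)" using f.vs2.basis_card_eq_dim by metis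
  also have "card (f ` C) = card C"
    by (rule card_image) (rule inj_on_subset[OF inj f.vs1.span_superset])
  also have "card BV = card BK + card C"
    unfolding C_def using finV BV(1) by (simp add: card_Diff_subset finite_subset card_mono)
  finally show ?thesis using dimV BK(4) \<open>card BV = card BK + card C\<close> by simp
qed

lemma fin_dim_subset:
  assumes "vector_space s" "fin_dim s V" "module.subspace s U" "U \<subseteq> V"
  shows "fin_dim s U"
  using assms unfolding fin_dim_def by blast

lemma fin_dim_image:
  assumes lin: "Vector_Spaces.linear s1 s2 f" and V: "fin_dim s1 V"
  shows "fin_dim s2 (f ` V)"
proof -
  interpret f: Vector_Spaces.linear s1 s2 f by (rule lin)
  from V obtain B where B: "finite B" "V \<subseteq> f.vs1.span B" by (auto simp: fin_dim_def)
  have "f ` V \<subseteq> f.vs2.span (f ` B)" using B(2) f.span_image by blast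
  then show ?thesis using V B(1) f.subspace_image unfolding fin_dim_def by blast
qed

lemma dim_mono_fin:
  assumes "vector_space s" "fin_dim s V" "U \<subseteq> V"
  shows "vector_space.dim s U \<le> vector_space.dim s V"
proof -
  interpret vector_space s by (rule assms)
  obtain B where B: "finite B" "V \<subseteq> span B" using assms(2) by (auto simp: fin_dim_def)
  obtain BU where BU: "BU \<subseteq> U" "independent BU" "U \<subseteq> span BU" "card BU = dim U"
    using basis_exists by blast
  have "BU \<subseteq> V" using BU assms by blast
  then obtain BV where BV: "BU \<subseteq> BV" "BV \<subseteq> V" "independent BV" "V \<subseteq> span BV"
    using maximal_independent_subset_extend[OF _ BU(2)] by blast
  have "finite BV" using independent_span_bound[OF B(1) BV(3)] BV(2) B(2) by blast
  then show ?thesis using BU(1,4) BV(1) basis_card_eq_dim[OF BV(2,4,3)] by (metis card_mono)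
qed

lemma subspace_eq_of_dim_eq:
  assumes "vector_space s" "fin_dim s V" "module.subspace s U" "U \<subseteq> V"
    and "vector_space.dim s V \<le> vector_space.dim s U"
  shows "U = V"
proof -
  interpret vector_space s by (rule assms)
  obtain B where B: "finite B" "V \<subseteq> span B" using assms(2) by (auto simp: fin_dim_def)
  obtain BU where BU: "BU \<subseteq> U" "independent BU" "U \<subseteq> span BU" "card BU = dim U"
    using basis_exists by blast
  have "BU \<subseteq> V" using BU assms by blast
  then obtain BV where BV: "BU \<subseteq> BV" "BV \<subseteq> V" "independent BV" "V \<subseteq> span BV"
    using maximal_independent_subset_extend[OF _ BU(2)] by blast
  have "finite BV" using independent_span_bound[OF B(1) BV(3)] BV(2) B(2) by blast
  moreover have "card BV \<le> card BU" using BU(4) basis_card_eq_dim[OF BV(2,4,3)] assms(5) by simp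
  ultimately have "BU = BV" using BV(1) by (metis card_seteq)
  then have "V \<subseteq> span U" using BV(4) BU(1) span_mono by blast
  then show ?thesis using assms(3,4) span_minimal[of U U] by blast
qed

lemma dim_trivial:
  assumes "vector_space s" "V \<subseteq> {0}"
  shows "vector_space.dim s V = 0"
proof -
  interpret vector_space s by (rule assms)
  have "dim V \<le> card ({}::'b set)" by (rule dim_le_card) (use assms(2) in auto)
  then show ?thesis by simp
qed

lemma dim_inj_image:
  assumes lin: "Vector_Spaces.linear s1 s2 f" and V: "module.subspace s1 V"
    and inj: "\<And>x. x \<in> V \<Longrightarrow> f x = 0 \<Longrightarrow> x = 0" and fin: "fin_dim s2 (f ` V)"
  shows "fin_dim s1 V \<and> vector_space.dim s1 V = vector_space.dim s2 (f ` V)"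
proof -
  interpret f: Vector_Spaces.linear s1 s2 f by (rule lin)
  from fin obtain B where B: "finite B" "f ` V \<subseteq> f.vs2.span B" by (auto simp: fin_dim_def)
  obtain BV where BV: "BV \<subseteq> V" "f.vs1.independent BV" "V \<subseteq> f.vs1.span BV" "card BV = f.vs1.dim V"
    using f.vs1.basis_exists by blast
  have "f.vs1.span BV = V" using BV(1,3) V f.vs1.span_minimal by blast
  then have i: "inj_on f (f.vs1.span BV)" using f.inj_on_iff_eq_0[OF V] inj by simp
  have "f.vs2.independent (f ` BV)" by (rule f.independent_injective_image[OF BV(2) i])
  then have "finite (f ` BV)" using f.vs2.independent_span_bound[OF B(1)] BV(1) B(2) by blast
  moreover have "inj_on f BV" by (rule inj_on_subset[OF i f.vs1.span_superset])
  ultimately have "finite BV" by (simp add: finite_image_iff)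
  then have fd: "fin_dim s1 V" using V BV(3) by (auto simp: fin_dim_def)
  have "f.vs1.dim {x\<in>V. f x = 0} = 0"
    by (rule dim_trivial) (use inj f.vs1.vector_space_axioms in auto)
  then show ?thesis using rank_nullity[OF lin fd] fd by simp
qed

abbreviation (input) fun_scale :: "'k::field \<Rightarrow> ('a \<Rightarrow> 'k) \<Rightarrow> 'a \<Rightarrow> 'k" where
  "fun_scale \<equiv> \<lambda>c f k. c * f k"

lemma vector_space_fun: "vector_space (fun_scale :: 'k::field \<Rightarrow> ('a \<Rightarrow> 'k) \<Rightarrow> _)"
  by unfold_locales (auto simp: fun_eq_iff algebra_simps)

lemma sum_fun_apply: "(\<Sum>x\<in>A. g x) y = (\<Sum>x\<in>A. (g x y :: 'b::comm_monoid_add))"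
  by (induction A rule: infinite_finite_induct) auto

definition supported_on :: "'a set \<Rightarrow> ('a \<Rightarrow> 'k::field) set" where
  "supported_on X = {f. \<forall>x. f x \<noteq> 0 \<longrightarrow> x \<in> X}"

lemma dim_supported_on:
  assumes "finite X"
  shows "fin_dim fun_scale (supported_on X :: ('a \<Rightarrow> 'k::field) set) \<and>
    vector_space.dim fun_scale (supported_on X :: ('a \<Rightarrow> 'k) set) = card X"
proof -
  interpret vector_space "fun_scale :: 'k \<Rightarrow> ('a \<Rightarrow> 'k) \<Rightarrow> _" by (rule vector_space_fun)
  define unit where "unit = (\<lambda>x y :: 'a. if y = x then 1 else 0 :: 'k)"
  have u: "inj unit" by (rule injI) (metis unit_def zero_neq_one)
  have sub: "subspace (supported_on X)" unfolding subspace_def supported_on_def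
    by (auto) (metis add.right_neutral)
  have "unit ` X \<subseteq> supported_on X" by (auto simp: unit_def supported_on_def split: if_splits)
  moreover have "supported_on X \<subseteq> span (unit ` X)"
  proof
    fix f :: "'a \<Rightarrow> 'k" assume f: "f \<in> supported_on X"
    have "f = (\<Sum>x\<in>X. fun_scale (f x) (unit x))"
    proof
      fix y
      have "(\<Sum>x\<in>X. fun_scale (f x) (unit x)) y = (\<Sum>x\<in>X. if x = y then f x else 0)"
        unfolding sum_fun_apply by (rule sum.cong) (auto simp: unit_def)
      also have "\<dots> = f y" using f assms by (auto simp: supported_on_def)
      finally show "f y = (\<Sum>x\<in>X. fun_scale (f x) (unit x)) y" by simp
    qed
    also have "\<dots> \<in> span (unit ` X)" by (intro span_sum span_scale span_base) auto
    finally show "f \<in> span (unit ` X)" .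
  qed
  moreover have "independent (unit ` X)"
  proof (rule independent_if_scalars_zero)
    fix c :: "('a \<Rightarrow> 'k) \<Rightarrow> 'k" and x
    assume z: "(\<Sum>x\<in>unit ` X. fun_scale (c x) x) = 0" and "x \<in> unit ` X"
    then obtain a where a: "x = unit a" "a \<in> X" by blast
    have "0 = (\<Sum>x\<in>X. fun_scale (c (unit x)) (unit x)) a"
      using z by (subst (asm) sum.reindex) (auto intro: inj_on_subset[OF u])
    also have "\<dots> = (\<Sum>x\<in>X. if x = a then c (unit x) else 0)"
      unfolding sum_fun_apply by (rule sum.cong) (auto simp: unit_def)
    also have "\<dots> = c x" using a assms by simp
    finally show "c x = 0" by simp
  qed (use assms in simp)
  ultimately have "dim (supported_on X) = card (unit ` X)" using basis_card_eq_dim by metis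
  also have "\<dots> = card X" by (rule card_image) (rule inj_on_subset[OF u], simp)
  finally show ?thesis using sub assms \<open>supported_on X \<subseteq> span (unit ` X)\<close> unfolding fin_dim_def by blast
qed

section \<open>Polynomials and their graded parts\<close>

text \<open>
The sum of those terms of a polynomial whose monomial satisfies the predicate.
\<close>

definition restr :: "(monomial \<Rightarrow> bool) \<Rightarrow> 'k::field mpoly \<Rightarrow> 'k mpoly" where
  "restr P p = Poly_Mapping.mapp (\<lambda>m c. c when P m) p"

lemma lookup_restr: "lookup (restr P p) m = (if P m then lookup p m else 0)"
  by (auto simp: restr_def lookup_mapp when_def in_keys_iff)

lemma restr_sum: "restr P (\<Sum>i\<in>A. p i) = (\<Sum>i\<in>A. restr P (p i))"
  by (rule poly_mapping_eqI) (simp add: lookup_restr lookup_sum)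

lemma keys_restr: "keys (restr P p) = {m \<in> keys p. P m}"
  by (auto simp: in_keys_iff lookup_restr split: if_splits)

lemma poly_expand: "(\<Sum>m\<in>keys p. single m (lookup p m)) = p"
  by (rule poly_mapping_eqI) (simp add: lookup_sum lookup_single when_def in_keys_iff)

lemma lookup_times_keys:
  "lookup ((p::'k::field mpoly) * q) m =
    (\<Sum>a\<in>keys p. \<Sum>b\<in>keys q. (lookup p a * lookup q b when a + b = m))"
proof -
  have "p * q = (\<Sum>a\<in>keys p. \<Sum>b\<in>keys q.
      single (a + b) (lookup p a * lookup q b))"
    by (subst (1 2) poly_expand[symmetric]) (simp add: sum_product mult_single)
  then show ?thesis by (simp add: lookup_sum lookup_single)
qed

lemma lookup_times:
  assumes "finite A" "keys p \<subseteq> A" "finite B" "keys q \<subseteq> B"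
  shows "lookup ((p::'k::field mpoly) * q) m =
    (\<Sum>a\<in>A. \<Sum>b\<in>B. (lookup p a * lookup q b when a + b = m))"
proof -
  have "lookup (p * q) m =
    (\<Sum>a\<in>keys p. \<Sum>b\<in>B. (lookup p a * lookup q b when a + b = m))"
    unfolding lookup_times_keys
    by (intro sum.cong sum.mono_neutral_left assms refl) (auto simp: in_keys_iff)
  also have "\<dots> = (\<Sum>a\<in>A. \<Sum>b\<in>B. (lookup p a * lookup q b when a + b = m))"
    by (intro sum.mono_neutral_left assms) (auto simp: in_keys_iff)
  finally show ?thesis .
qed

lemma lookup_single_times:
  "lookup (single a c * (p::'k::field mpoly)) m =
    (if \<exists>b. m = a + b then c * lookup p (m - a) else 0)"
proof -
  have "lookup (single a c * p) m =
      (\<Sum>x\<in>{a}. \<Sum>b\<in>keys p. (lookup (single a c) x * lookup p b when x + b = m))"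
    by (rule lookup_times) auto
  also have "\<dots> = (\<Sum>b\<in>keys p. (c * lookup p b when a + b = m))" by simp
  also have "\<dots> = (if \<exists>b. m = a + b then c * lookup p (m - a) else 0)"
  proof (cases "\<exists>b. m = a + b")
    case True
    then obtain b where b: "m = a + b" by blast
    have "(\<Sum>b'\<in>keys p. (c * lookup p b' when a + b' = m)) =
        (\<Sum>b'\<in>keys p. if b' = b then c * lookup p b else 0)"
      by (rule sum.cong) (auto simp: b when_def)
    also have "\<dots> = c * lookup p b" by (simp add: in_keys_iff)
    finally show ?thesis using b by auto
  next
    case False
    then show ?thesis by (auto simp: when_def intro!: sum.neutral)
  qed
  finally show ?thesis .
qed

lemma lookup_single_times_add [simp]:
  "lookup (single a c * (p::'k::field mpoly)) (a + m) = c * lookup p m"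
  by (subst lookup_single_times) auto

text \<open>
A product of monomials is 1 only if both factors are.
\<close>

lemma lookup_times_0: "lookup ((p::'k::field mpoly) * q) 0 = lookup p 0 * lookup q 0"
proof -
  let ?A = "insert 0 (keys p)" and ?B = "insert 0 (keys q)"
  have z: "a + b = 0 \<longleftrightarrow> a = 0 \<and> b = 0" for a b :: monomial
    using mdeg_add[of a b] mdeg_eq_0_iff[of a] mdeg_eq_0_iff[of b] mdeg_eq_0_iff[of "a + b"] by auto
  have "lookup (p * q) 0 =
    (\<Sum>a\<in>?A. \<Sum>b\<in>?B. (lookup p a * lookup q b when a + b = 0))"
    by (rule lookup_times) auto
  also have "\<dots> = (\<Sum>a\<in>{0}. \<Sum>b\<in>?B. (lookup p a * lookup q b when a + b = 0))"
    by (rule sum.mono_neutral_right) (auto simp: z intro!: sum.neutral)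
  also have "\<dots> = (\<Sum>b\<in>?B. if b = 0 then lookup p 0 * lookup q 0 else 0)"
  proof -
    have "(\<Sum>a\<in>{0}. \<Sum>b\<in>?B. (lookup p a * lookup q b when a + b = 0)) =
        (\<Sum>b\<in>?B. (lookup p 0 * lookup q b when 0 + b = 0))" by simp
    also have "\<dots> = (\<Sum>b\<in>?B. if b = 0 then lookup p 0 * lookup q 0 else 0)"
      by (rule sum.cong) (auto simp: when_def)
    finally show ?thesis .
  qed
  also have "\<dots> = lookup p 0 * lookup q 0" by (subst sum.delta) auto
  finally show ?thesis .
qed

lemma polys_zero [simp]: "0 \<in> polys n" by (simp add: polys_def)

lemma polys_add: "p \<in> polys n \<Longrightarrow> q \<in> polys n \<Longrightarrow> p + q \<in> polys n"
  unfolding polys_def using Poly_Mapping.keys_add[of p q] by blast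

lemma polys_uminus: "p \<in> polys n \<Longrightarrow> - p \<in> polys n"
  unfolding polys_def by simp

lemma polys_mult: "p \<in> polys n \<Longrightarrow> q \<in> polys n \<Longrightarrow> p * q \<in> polys n"
proof -
  assume h: "p \<in> polys n" "q \<in> polys n"
  show ?thesis unfolding polys_def
  proof (intro CollectI ballI)
    fix m assume "m \<in> keys (p * q)"
    then obtain a b where "m = a + b" "a \<in> keys p" "b \<in> keys q" using keys_mult[of p q] by blast
    then show "keys m \<subseteq> {1..n}" using h by (auto simp: polys_def keys_add_monomial)
  qed
qed

lemma polys_sum: "(\<And>i. i \<in> A \<Longrightarrow> p i \<in> polys n) \<Longrightarrow> (\<Sum>i\<in>A. p i) \<in> polys n"
  by (induction A rule: infinite_finite_induct) (auto intro: polys_add)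

lemma polys_single: "keys m \<subseteq> {1..n} \<Longrightarrow> single m c \<in> polys n"
  by (auto simp: polys_def)

lemma polys_restr: "p \<in> polys n \<Longrightarrow> restr P p \<in> polys n"
  by (auto simp: polys_def keys_restr)

lemma homog_iff: "p \<in> homog n e \<longleftrightarrow> keys p \<subseteq> monomials {1..n} e"
  by (auto simp: homog_def polys_def monomials_def)

lemma homog_polys: "p \<in> homog n e \<Longrightarrow> p \<in> polys n" by (simp add: homog_def)

lemma homog_zero [simp]: "0 \<in> homog n e" by (simp add: homog_iff)

lemma homog_add: "p \<in> homog n e \<Longrightarrow> q \<in> homog n e \<Longrightarrow> p + q \<in> homog n e"
  unfolding homog_iff using Poly_Mapping.keys_add[of p q] by blast

lemma homog_uminus: "p \<in> homog n e \<Longrightarrow> - p \<in> homog n e"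
  unfolding homog_iff by simp

lemma homog_diff: "p \<in> homog n e \<Longrightarrow> q \<in> homog n e \<Longrightarrow> p - q \<in> homog n e"
  using homog_add[of p n e "- q"] homog_uminus[of q n e] by simp

lemma homog_sum: "(\<And>i. i \<in> A \<Longrightarrow> p i \<in> homog n e) \<Longrightarrow> (\<Sum>i\<in>A. p i) \<in> homog n e"
  by (induction A rule: infinite_finite_induct) (auto intro: homog_add)

lemma homog_mult: "p \<in> homog n e \<Longrightarrow> q \<in> homog n f \<Longrightarrow> e + f = g \<Longrightarrow> p * q \<in> homog n g"
proof -
  assume h: "p \<in> homog n e" "q \<in> homog n f" "e + f = g"
  show ?thesis unfolding homog_iff
  proof
    fix m assume "m \<in> keys (p * q)"
    then obtain a b where "m = a + b" "a \<in> keys p" "b \<in> keys q" using keys_mult[of p q] by blast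
    moreover from this have "a \<in> monomials {1..n} e" "b \<in> monomials {1..n} f" using h by (auto simp: homog_iff)
    ultimately show "m \<in> monomials {1..n} g" using h(3) by (auto simp: monomials_def keys_add_monomial mdeg_add)
  qed
qed

lemma homog_single: "m \<in> monomials {1..n} e \<Longrightarrow> single m c \<in> homog n e"
  by (auto simp: homog_iff)

definition graded_part :: "int \<Rightarrow> 'k::field mpoly \<Rightarrow> 'k mpoly" where
  "graded_part e = restr (\<lambda>m. int (mdeg m) = e)"

lemma graded_part_homog: "p \<in> polys n \<Longrightarrow> graded_part e p \<in> homog n e"
  by (auto simp: graded_part_def homog_def keys_restr polys_restr)

lemma graded_part_id: "p \<in> homog n e \<Longrightarrow> graded_part e p = p"
  by (rule poly_mapping_eqI) (auto simp: graded_part_def lookup_restr homog_def in_keys_iff)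

lemma graded_part_zero [simp]: "graded_part e 0 = 0"
  by (rule poly_mapping_eqI) (auto simp: graded_part_def lookup_restr)

text \<open>
Multiplication by a homogeneous polynomial shifts degrees, so it commutes with taking graded parts.
\<close>

lemma graded_part_mult:
  assumes "a \<in> homog n s"
  shows "graded_part e (a * p) = a * graded_part (e - s) p"
proof (rule poly_mapping_eqI)
  fix m
  have deg: "int (mdeg x) = s" if "x \<in> keys a" for x using assms that by (simp add: homog_def)
  have "lookup (a * graded_part (e - s) p) m =
    (\<Sum>x\<in>keys a. \<Sum>b\<in>keys p. (lookup a x * lookup (graded_part (e - s) p) b when x + b = m))"
    by (rule lookup_times) (auto simp: graded_part_def keys_restr)
  also have "\<dots> = (\<Sum>x\<in>keys a. \<Sum>b\<in>keys p.
      (if int (mdeg m) = e then (lookup a x * lookup p b when x + b = m) else 0))"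
  proof (intro sum.cong refl)
    fix x b assume "x \<in> keys a"
    then show "(lookup a x * lookup (graded_part (e - s) p) b when x + b = m) =
      (if int (mdeg m) = e then (lookup a x * lookup p b when x + b = m) else 0)"
      using deg[of x] by (auto simp: graded_part_def lookup_restr when_def mdeg_add)
  qed
  also have "\<dots> = lookup (graded_part e (a * p)) m"
    by (simp add: graded_part_def lookup_restr lookup_times_keys)
  finally show "lookup (graded_part e (a * p)) m = lookup (a * graded_part (e - s) p) m" by simp
qed

lemma graded_part_sum: "graded_part e (\<Sum>i\<in>A. p i) = (\<Sum>i\<in>A. graded_part e (p i))"
  by (simp add: graded_part_def restr_sum)

section \<open>Monomial ideals\<close>

definition divisible :: "nat set set \<Rightarrow> monomial \<Rightarrow> bool" where
  "divisible W m \<longleftrightarrow> (\<exists>X\<in>W. X \<subseteq> keys m)"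

lemma divisible_add: "divisible W m \<Longrightarrow> divisible W (m + k)"
  by (auto simp: divisible_def keys_add_monomial)

lemma cring_poly_ring: "cring (poly_ring n :: 'k::field mpoly ring)"
proof (rule cringI)
  show "abelian_group (poly_ring n :: 'k mpoly ring)"
  proof (rule abelian_groupI)
    fix x assume "x \<in> carrier (poly_ring n :: 'k mpoly ring)"
    then show "\<exists>y\<in>carrier (poly_ring n). y \<oplus>\<^bsub>poly_ring n\<^esub> x = \<zero>\<^bsub>poly_ring n\<^esub>"
      by (intro bexI[of _ "- x"]) (auto simp: poly_ring_def polys_uminus)
  qed (auto simp: poly_ring_def polys_add algebra_simps)
  show "comm_monoid (poly_ring n :: 'k mpoly ring)"
    by (rule comm_monoidI) (auto simp: poly_ring_def polys_mult algebra_simps, simp add: polys_def)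
qed (auto simp: poly_ring_def algebra_simps)

text \<open>
The right-hand side is an ideal that contains the generators; conversely every term of such a
polynomial is a multiple of a generator.
\<close>

lemma monomial_ideal_eq:
  assumes "\<Union>W \<subseteq> {1..n}"
  shows "(monomial_ideal n (sqfree ` W) :: 'k::field mpoly set) =
    {p \<in> polys n. \<forall>m\<in>keys p. divisible W m}"
proof -
  interpret cring "poly_ring n :: 'k mpoly ring" by (rule cring_poly_ring)
  let ?J = "{p \<in> polys n. \<forall>m\<in>keys p. divisible W m} :: 'k mpoly set"
  let ?g = "\<lambda>w. single w 1 :: 'k mpoly"
  have W: "X \<subseteq> {1..n}" if "X \<in> W" for X using assms that by blast
  have fin: "finite X" if "X \<in> W" for X using W[OF that] finite_subset by blast
  have gens: "?g ` sqfree ` W \<subseteq> ?J"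
  proof
    fix p assume "p \<in> ?g ` sqfree ` W"
    then obtain X where X: "X \<in> W" "p = ?g (sqfree X)" by blast
    then have "keys p = {sqfree X}" "keys (sqfree X) = X" using fin by simp_all
    then show "p \<in> ?J" using X(1) W[OF X(1)] by (auto simp: polys_def divisible_def simp del: One_nat_def)
  qed
  have idl: "ideal ?J (poly_ring n)"
  proof (rule idealI)
    show "ring (poly_ring n :: 'k mpoly ring)" by (rule ring_axioms)
    have inv: "\<ominus>\<^bsub>poly_ring n\<^esub> x = - x" if "x \<in> polys n" for x :: "'k mpoly"
      by (rule minus_equality) (use that in \<open>auto simp: poly_ring_def polys_uminus\<close>)
    show "subgroup ?J (add_monoid (poly_ring n))"
    proof (rule subgroup.intro)
      show "?J \<subseteq> carrier (add_monoid (poly_ring n))" by (auto simp: poly_ring_def)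
      show "x \<otimes>\<^bsub>add_monoid (poly_ring n)\<^esub> y \<in> ?J" if "x \<in> ?J" "y \<in> ?J" for x y
        using that Poly_Mapping.keys_add[of x y] by (auto simp: poly_ring_def polys_add)
      show "\<one>\<^bsub>add_monoid (poly_ring n)\<^esub> \<in> ?J" by (auto simp: poly_ring_def)
      show "inv\<^bsub>add_monoid (poly_ring n)\<^esub> x \<in> ?J" if "x \<in> ?J" for x
        using that inv[of x] by (auto simp: a_inv_def polys_uminus)
    qed
    have mul: "x * a \<in> ?J" if "a \<in> ?J" "x \<in> polys n" for a x
    proof -
      have "divisible W m" if "m \<in> keys (x * a)" for m
      proof -
        obtain k l where "m = k + l" "l \<in> keys a" using keys_mult[of x a] \<open>m \<in> _\<close> by blast
        then show ?thesis using divisible_add[of W l k] \<open>a \<in> ?J\<close> by (auto simp: add.commute)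
      qed
      then show ?thesis using that polys_mult by blast
    qed
    show "x \<otimes>\<^bsub>poly_ring n\<^esub> a \<in> ?J" if "a \<in> ?J" "x \<in> carrier (poly_ring n)" for a x
      using mul[of a x] that by (simp add: poly_ring_def)
    show "a \<otimes>\<^bsub>poly_ring n\<^esub> x \<in> ?J" if "a \<in> ?J" "x \<in> carrier (poly_ring n)" for a x
      using mul[of a x] that by (simp add: poly_ring_def mult.commute)
  qed
  have "monomial_ideal n (sqfree ` W) \<subseteq> ?J"
    unfolding monomial_ideal_def by (rule genideal_minimal[OF idl gens])
  moreover have "?J \<subseteq> monomial_ideal n (sqfree ` W)"
  proof
    fix p assume p: "p \<in> ?J"
    have car: "?g ` sqfree ` W \<subseteq> carrier (poly_ring n)" using gens by (auto simp: poly_ring_def)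
    interpret I: ideal "monomial_ideal n (sqfree ` W) :: 'k mpoly set" "poly_ring n"
      unfolding monomial_ideal_def by (rule genideal_ideal[OF car])
    have base: "?g ` sqfree ` W \<subseteq> monomial_ideal n (sqfree ` W)"
      unfolding monomial_ideal_def by (rule genideal_self[OF car])
    have mono_in: "single m c \<in> (monomial_ideal n (sqfree ` W) :: 'k mpoly set)"
      if dv: "divisible W m" and km: "keys m \<subseteq> {1..n}" for m c
    proof -
      obtain X where X: "X \<in> W" "X \<subseteq> keys m" using dv by (auto simp: divisible_def)
      have eq: "(m - sqfree X) + sqfree X = m" by (rule subset_keys_imp_add) (use X fin in auto)
      have "keys (m - sqfree X) \<subseteq> {1..n}"
        using km keys_add_monomial[of "m - sqfree X" "sqfree X"] unfolding eq by blast
      then have "single (m - sqfree X) c \<in> carrier (poly_ring n)"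
        by (simp add: poly_ring_def polys_single)
      moreover have "?g (sqfree X) \<in> monomial_ideal n (sqfree ` W)" using base X by blast
      ultimately have "single (m - sqfree X) c \<otimes>\<^bsub>poly_ring n\<^esub> ?g (sqfree X) \<in> monomial_ideal n (sqfree ` W)"
        by (rule I.I_l_closed[rotated])
      then show ?thesis by (simp add: poly_ring_def mult_single eq)
    qed
    have zero: "0 \<in> (monomial_ideal n (sqfree ` W) :: 'k mpoly set)" using I.zero_closed by (simp add: poly_ring_def)
    have add: "a + b \<in> monomial_ideal n (sqfree ` W)"
      if "a \<in> monomial_ideal n (sqfree ` W)" "b \<in> monomial_ideal n (sqfree ` W)" for a b :: "'k mpoly"
      using I.a_closed[OF that] by (simp add: poly_ring_def)
    have "(\<Sum>m\<in>A. single m (lookup p m)) \<in> monomial_ideal n (sqfree ` W)"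
      if "A \<subseteq> keys p" "finite A" for A
      using that(2,1)
    proof (induction A rule: finite_induct)
      case (insert m A)
      then have "divisible W m" "keys m \<subseteq> {1..n}" using p by (auto simp: polys_def simp del: One_nat_def)
      then show ?case using insert by (simp add: add mono_in)
    qed (simp add: zero)
    from this[of "keys p"] show "p \<in> monomial_ideal n (sqfree ` W)" by (simp add: poly_expand)
  qed
  ultimately show ?thesis by blast
qed

section \<open>Hilbert functions and graded free resolutions\<close>

abbreviation (input) poly_scale :: "'k::field \<Rightarrow> 'k mpoly \<Rightarrow> 'k mpoly" where
  "poly_scale \<equiv> \<lambda>c p. single 0 c * p"

abbreviation (input) vec_scale :: "'k::field \<Rightarrow> (nat \<Rightarrow> 'k mpoly) \<Rightarrow> nat \<Rightarrow> 'k mpoly" where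
  "vec_scale \<equiv> \<lambda>c f k. single 0 c * f k"

lemma vector_space_poly: "vector_space (poly_scale :: 'k::field \<Rightarrow> _)"
  by unfold_locales (auto simp: algebra_simps single_add mult_single)

lemma vector_space_vec: "vector_space (vec_scale :: 'k::field \<Rightarrow> _)"
  by unfold_locales (auto simp: fun_eq_iff algebra_simps single_add mult_single)

lemma linear_mapI:
  assumes "vector_space s1" "vector_space s2"
    and "\<And>x y. f (x + y) = f x + f y" "\<And>c x. f (s1 c x) = s2 c (f x)"
  shows "Vector_Spaces.linear s1 s2 f"
  using assms unfolding Vector_Spaces.linear_iff by blast

lemma linear_aug_map: "Vector_Spaces.linear vec_scale poly_scale (aug_map (F :: 'k::field mpoly free_complex))"
  by (rule linear_mapI[OF vector_space_vec vector_space_poly])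
    (simp_all add: aug_map_def algebra_simps sum.distrib sum_distrib_left)

lemma linear_bd_map: "Vector_Spaces.linear vec_scale vec_scale (bd_map (F :: 'k::field mpoly free_complex) i)"
  by (rule linear_mapI[OF vector_space_vec vector_space_vec])
    (auto simp: bd_map_def fun_eq_iff algebra_simps sum.distrib sum_distrib_left)

lemma linear_tensor_bd: "Vector_Spaces.linear fun_scale fun_scale (tensor_bd (F :: 'k::field mpoly free_complex) i)"
  by (rule linear_mapI[OF vector_space_fun vector_space_fun])
    (auto simp: tensor_bd_def fun_eq_iff algebra_simps sum.distrib sum_distrib_left)

text \<open>
The part of degree \<open>e\<close> of the free module, whose \<open>k\<close>-th basis element has degree \<open>shifts F i ! k\<close>.
\<close>

definition degree_piece :: "nat \<Rightarrow> 'k::field mpoly free_complex \<Rightarrow> nat \<Rightarrow> int \<Rightarrow> (nat \<Rightarrow> 'k mpoly) set" where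
  "degree_piece n F i e = {f \<in> free_module n F i. \<forall>k<free_rank F i. f k \<in> homog n (e - shifts F i ! k)}"

definition vec_part :: "'k::field mpoly free_complex \<Rightarrow> nat \<Rightarrow> int \<Rightarrow> (nat \<Rightarrow> 'k mpoly) \<Rightarrow> nat \<Rightarrow> 'k mpoly" where
  "vec_part F i e f = (\<lambda>k. graded_part (e - shifts F i ! k) (f k))"

lemma vec_part_in: "f \<in> free_module n F i \<Longrightarrow> vec_part F i e f \<in> degree_piece n F i e"
  by (auto simp: degree_piece_def free_module_def vec_part_def intro: graded_part_homog homog_polys[OF graded_part_homog])

lemma vec_part_id: "f \<in> degree_piece n F i e \<Longrightarrow> vec_part F i e f = f"
proof
  fix k assume "f \<in> degree_piece n F i e"
  then show "vec_part F i e f k = f k"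
    by (cases "k < free_rank F i") (auto simp: degree_piece_def free_module_def vec_part_def graded_part_id)
qed

lemma module_subspaceI:
  assumes "vector_space s" "0 \<in> V" "\<And>x y. x \<in> V \<Longrightarrow> y \<in> V \<Longrightarrow> x + y \<in> V" "\<And>c x. x \<in> V \<Longrightarrow> s c x \<in> V"
  shows "module.subspace s V"
proof -
  interpret vector_space s by (rule assms)
  show ?thesis using assms by (simp add: subspace_def)
qed

lemma homog_scale: "p \<in> homog n e \<Longrightarrow> single 0 c * p \<in> homog n e"
  by (rule homog_mult[of _ n 0]) (auto simp: homog_iff monomials_def)

lemma subspace_degree_piece: "module.subspace vec_scale (degree_piece n F i e)"
proof (rule module_subspaceI[OF vector_space_vec])
  fix c f assume "f \<in> degree_piece n F i e"
  then show "(\<lambda>k. single 0 c * f k) \<in> degree_piece n F i e"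
    by (auto simp: degree_piece_def free_module_def intro: homog_scale homog_polys[OF homog_scale])
qed (auto simp: degree_piece_def free_module_def intro: homog_add polys_add)

text \<open>
The coefficients of the coordinates identify the graded piece with the functions on a finite set
of pairs of a basis element and a monomial of complementary degree.
\<close>

lemma dim_degree_piece:
  "fin_dim vec_scale (degree_piece n F i e) \<and>
   int (vector_space.dim vec_scale (degree_piece n F i e)) = (\<Sum>k<free_rank F i. num_monomials {1..n} (e - shifts F i ! k))"
proof -
  let ?X = "SIGMA k:{..<free_rank F i}. monomials {1..n} (e - shifts F i ! k)"
  let ?c = "\<lambda>(f::nat \<Rightarrow> 'a mpoly) (k, m). lookup (f k) m"
  have lin: "Vector_Spaces.linear vec_scale fun_scale ?c"
  proof (rule linear_mapI[OF vector_space_vec vector_space_fun])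
    show "?c (vec_scale r f) = fun_scale r (?c f)" for r f
    proof
      fix x show "?c (vec_scale r f) x = fun_scale r (?c f) x"
        using lookup_single_times_add[of 0 r "f (fst x)" "snd x"] by (simp add: case_prod_beta)
    qed
  qed (auto simp: fun_eq_iff lookup_add)
  have img: "?c ` degree_piece n F i e = supported_on ?X"
  proof (intro equalityI subsetI)
    fix g assume "g \<in> ?c ` degree_piece n F i e"
    then obtain f where f: "f \<in> degree_piece n F i e" "g = ?c f" by blast
    show "g \<in> supported_on ?X" unfolding supported_on_def f(2)
    proof (intro CollectI allI impI)
      fix x assume x: "?c f x \<noteq> 0"
      obtain k m where km: "x = (k, m)" by (cases x)
      then have "lookup (f k) m \<noteq> 0" using x by simp
      then have "f k \<noteq> 0" "m \<in> keys (f k)" by (auto simp: in_keys_iff)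
      moreover from this have "k < free_rank F i" using f(1) by (auto simp: degree_piece_def free_module_def not_less[symmetric])
      ultimately show "x \<in> ?X" using f(1) by (auto simp: km degree_piece_def homog_iff)
    qed
  next
    fix g :: "nat \<times> monomial \<Rightarrow> 'a" assume g: "g \<in> supported_on ?X"
    define f where "f = (\<lambda>k. Abs_poly_mapping (\<lambda>m. g (k, m)))"
    have fin: "finite {m. g (k, m) \<noteq> 0}" for k
      by (rule finite_subset[of _ "monomials {1..n} (e - shifts F i ! k)"])
        (use g finite_monomials in \<open>auto simp: supported_on_def\<close>)
    have look: "lookup (f k) m = g (k, m)" for k m
      unfolding f_def using fin by simp
    have keys: "m \<in> monomials {1..n} (e - shifts F i ! k) \<and> k < free_rank F i" if "m \<in> keys (f k)" for k m
      using that g by (auto simp: in_keys_iff look supported_on_def)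
    then have h: "f k \<in> homog n (e - shifts F i ! k)" for k by (auto simp: homog_iff)
    have "f k = 0" if "k \<ge> free_rank F i" for k
    proof (rule poly_mapping_eqI)
      fix m show "lookup (f k) m = lookup 0 m"
        using keys[of m k] that by (auto simp: in_keys_iff)
    qed
    then have "f \<in> degree_piece n F i e" using h homog_polys[OF h] by (auto simp: degree_piece_def free_module_def)
    moreover have "?c f = g" by (auto simp: fun_eq_iff look)
    ultimately show "g \<in> ?c ` degree_piece n F i e" by blast
  qed
  have inj: "f = 0" if f0: "?c f = 0" for f :: "nat \<Rightarrow> 'a mpoly"
  proof
    fix k
    have "lookup (f k) m = 0" for m using fun_cong[OF f0, of "(k, m)"] by simp
    then show "f k = 0 k" by (intro poly_mapping_eqI) simp
  qed
  have finX: "finite ?X" using finite_monomials by auto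
  have "fin_dim vec_scale (degree_piece n F i e) \<and>
      vector_space.dim vec_scale (degree_piece n F i e) = vector_space.dim fun_scale (?c ` degree_piece n F i e)"
    by (rule dim_inj_image[OF lin subspace_degree_piece]) (use inj dim_supported_on[OF finX] in \<open>auto simp: img\<close>)
  moreover have "card ?X = (\<Sum>k<free_rank F i. card (monomials {1..n} (e - shifts F i ! k)))"
    using finite_monomials by (intro card_SigmaI) auto
  ultimately show ?thesis using dim_supported_on[OF finX, where 'k='a] unfolding img by (simp add: num_monomials_def)
qed

lemma dim_divisible_piece:
  "vector_space.dim poly_scale {p \<in> homog n e. \<forall>m\<in>keys p. P m} =
   card {m \<in> monomials {1..n} e. P m}"
proof -
  let ?V = "{p \<in> homog n e. \<forall>m\<in>keys p. P m} :: 'a mpoly set"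
  let ?X = "{m \<in> monomials {1..n} e. P m}"
  have lin: "Vector_Spaces.linear poly_scale fun_scale (lookup :: 'a mpoly \<Rightarrow> _)"
  proof (rule linear_mapI[OF vector_space_poly vector_space_fun])
    show "lookup (poly_scale r f) = fun_scale r (lookup f)" for r and f :: "'a mpoly"
      using lookup_single_times_add[of 0 r f] by (simp add: fun_eq_iff)
  qed (auto simp: fun_eq_iff lookup_add)
  have img: "lookup ` ?V = supported_on ?X"
  proof (intro equalityI subsetI)
    fix g assume "g \<in> lookup ` ?V"
    then obtain p where p: "p \<in> ?V" "g = lookup p" by (rule imageE)
    show "g \<in> supported_on ?X" unfolding supported_on_def p(2)
    proof (intro CollectI allI impI)
      fix m assume "lookup p m \<noteq> 0"
      then have "m \<in> keys p" by (simp add: in_keys_iff)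
      then show "m \<in> monomials {1..n} e \<and> P m" using p(1) unfolding homog_iff by blast
    qed
  next
    fix g :: "monomial \<Rightarrow> 'a" assume g: "g \<in> supported_on ?X"
    have "finite {m. g m \<noteq> 0}"
      by (rule finite_subset[of _ "monomials {1..n} e"]) (use g finite_monomials in \<open>auto simp: supported_on_def\<close>)
    then have l: "lookup (Abs_poly_mapping g) = g" by simp
    have "m \<in> ?X" if "m \<in> keys (Abs_poly_mapping g)" for m
    proof -
      have "g m \<noteq> 0" using that l by (simp add: in_keys_iff)
      then show ?thesis using g unfolding supported_on_def by blast
    qed
    then have "Abs_poly_mapping g \<in> ?V" unfolding homog_iff by blast
    from imageI[OF this, of lookup] show "g \<in> lookup ` ?V" unfolding l .
  qed
  have sub: "module.subspace poly_scale ?V"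
  proof (rule module_subspaceI[OF vector_space_poly])
    fix x y assume "x \<in> ?V" "y \<in> ?V"
    then show "x + y \<in> ?V" using Poly_Mapping.keys_add[of x y] homog_add[of x n e y] by blast
  next
    fix c x assume "x \<in> ?V"
    moreover have "keys (poly_scale c x) \<subseteq> keys x"
    proof
      fix m assume "m \<in> keys (poly_scale c x)"
      then show "m \<in> keys x" using lookup_single_times_add[of 0 c x m] by (simp add: in_keys_iff)
    qed
    ultimately show "poly_scale c x \<in> ?V" using homog_scale[of x n e c] by blast
  qed auto
  have fX: "finite ?X" using finite_monomials[of "{1..n}" e] by simp
  have "vector_space.dim poly_scale ?V = vector_space.dim fun_scale (lookup ` ?V)"
  proof (rule conjunct2[OF dim_inj_image[OF lin sub]])
    show "x = 0" if "lookup x = 0" for x :: "'a mpoly"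
      using that by (simp add: poly_mapping_eq_iff fun_eq_iff)
    show "fin_dim fun_scale (lookup ` ?V)"
      unfolding img using dim_supported_on[OF fX] by blast
  qed
  then show ?thesis using dim_supported_on[OF fX, where 'k='a] unfolding img by simp
qed

lemma resolution_aug_homog:
  assumes "graded_free_resolution n I F" "l < free_rank F 0"
  shows "aug F l \<in> homog n (shifts F 0 ! l)"
proof -
  have "\<forall>l<free_rank F 0. aug F l \<in> homog n (shifts F 0 ! l)"
    using assms(1) unfolding graded_free_resolution_def by (elim conjE)
  then show ?thesis using assms(2) by simp
qed

lemma resolution_bd_homog:
  assumes "graded_free_resolution n I F" "k < free_rank F i" "l < free_rank F (Suc i)"
  shows "bd F i k l \<in> homog n (shifts F (Suc i) ! l - shifts F i ! k)"
proof -
  have "\<forall>i. \<forall>k<free_rank F i. \<forall>l<free_rank F (Suc i). bd F i k l \<in> homog n (shifts F (Suc i) ! l - shifts F i ! k)"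
    using assms(1) unfolding graded_free_resolution_def by (elim conjE)
  then show ?thesis using assms(2,3) by simp
qed

lemma resolution_image_aug:
  assumes "graded_free_resolution n I F"
  shows "aug_map F ` free_module n F 0 = I"
  using assms unfolding graded_free_resolution_def by (elim conjE)

lemma resolution_exact_0:
  assumes "graded_free_resolution n I F"
  shows "{f \<in> free_module n F 0. aug_map F f = 0} = bd_map F 0 ` free_module n F 1"
  using assms unfolding graded_free_resolution_def by (elim conjE)

lemma resolution_exact:
  assumes "graded_free_resolution n I F"
  shows "{f \<in> free_module n F (Suc i). bd_map F i f = 0} = bd_map F (Suc i) ` free_module n F (Suc (Suc i))"
proof -
  have "\<forall>i. {f \<in> free_module n F (Suc i). bd_map F i f = 0} = bd_map F (Suc i) ` free_module n F (Suc (Suc i))"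
    using assms unfolding graded_free_resolution_def by (elim conjE)
  then show ?thesis ..
qed

text \<open>
The matrix entries are homogeneous of the degrees that make the maps preserve degrees.
Therefore exactness passes to the graded pieces, as the following lemmas record.
\<close>

lemma bd_vec_part:
  assumes R: "graded_free_resolution n I F"
  shows "vec_part F i e (bd_map F i f) = bd_map F i (vec_part F (Suc i) e f)"
proof
  fix k
  show "vec_part F i e (bd_map F i f) k = bd_map F i (vec_part F (Suc i) e f) k"
  proof (cases "k < free_rank F i")
    case True
    have "graded_part (e - shifts F i ! k) (bd F i k l * f l) =
        bd F i k l * graded_part (e - shifts F (Suc i) ! l) (f l)" if "l < free_rank F (Suc i)" for l
    proof -
      have "bd F i k l \<in> homog n (shifts F (Suc i) ! l - shifts F i ! k)"
        by (rule resolution_bd_homog[OF R True that])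
      from graded_part_mult[OF this] show ?thesis by simp
    qed
    then show ?thesis using True by (simp add: vec_part_def bd_map_def graded_part_sum)
  next
    case False
    then show ?thesis by (simp add: vec_part_def bd_map_def)
  qed
qed

lemma aug_vec_part:
  assumes R: "graded_free_resolution n I F"
  shows "graded_part e (aug_map F f) = aug_map F (vec_part F 0 e f)"
proof -
  have "graded_part e (aug F l * f l) = aug F l * graded_part (e - shifts F 0 ! l) (f l)" if "l < free_rank F 0" for l
  proof -
    have "aug F l \<in> homog n (shifts F 0 ! l)"
      by (rule resolution_aug_homog[OF R that])
    from graded_part_mult[OF this] show ?thesis by simp
  qed
  then show ?thesis by (simp add: vec_part_def aug_map_def graded_part_sum)
qed

lemma degree_piece_free: "f \<in> degree_piece n F i e \<Longrightarrow> f \<in> free_module n F i"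
  by (simp add: degree_piece_def)

lemma aug_map_degree_piece:
  assumes R: "graded_free_resolution n I F"
  shows "aug_map F ` degree_piece n F 0 e = I \<inter> homog n e"
proof (intro equalityI subsetI)
  fix p assume "p \<in> aug_map F ` degree_piece n F 0 e"
  then obtain f where f: "f \<in> degree_piece n F 0 e" "p = aug_map F f" by blast
  have "p = graded_part e p" using aug_vec_part[OF R, of e f] vec_part_id[OF f(1)] f(2) by simp
  moreover have "p \<in> I" using resolution_image_aug[OF R] f(2) degree_piece_free[OF f(1)] by blast
  moreover have "p \<in> polys n" unfolding f(2) aug_map_def
  proof (intro polys_sum polys_mult)
    fix l assume l: "l \<in> {..<free_rank F 0}"
    then show "aug F l \<in> polys n" using resolution_aug_homog[OF R, of l] homog_polys by simp
    show "f l \<in> polys n" using l degree_piece_free[OF f(1)] by (simp add: free_module_def)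
  qed
  ultimately show "p \<in> I \<inter> homog n e" using graded_part_homog[of p n e] by simp
next
  fix p assume p: "p \<in> I \<inter> homog n e"
  then have "p \<in> aug_map F ` free_module n F 0" using resolution_image_aug[OF R] by simp
  then obtain f where f: "f \<in> free_module n F 0" "p = aug_map F f" by blast
  have "p = aug_map F (vec_part F 0 e f)" using aug_vec_part[OF R, of e f] graded_part_id[of p n e] p f by simp
  then show "p \<in> aug_map F ` degree_piece n F 0 e" using vec_part_in[OF f(1)] by blast
qed

lemma bd_map_degree_piece_exact_0:
  assumes R: "graded_free_resolution n I F"
  shows "{f \<in> degree_piece n F 0 e. aug_map F f = 0} = bd_map F 0 ` degree_piece n F 1 e"
proof (intro equalityI subsetI)
  have ex: "{f \<in> free_module n F 0. aug_map F f = 0} = bd_map F 0 ` free_module n F 1"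
    by (rule resolution_exact_0[OF R])
  {
    fix f assume f: "f \<in> {f \<in> degree_piece n F 0 e. aug_map F f = 0}"
    then have "f \<in> bd_map F 0 ` free_module n F 1" unfolding ex[symmetric] using degree_piece_free by blast
    then obtain g where g: "g \<in> free_module n F 1" "f = bd_map F 0 g" by blast
    have "f = bd_map F 0 (vec_part F 1 e g)"
      using bd_vec_part[OF R, of 0 e g] vec_part_id[of f n F 0 e] f g by simp
    then show "f \<in> bd_map F 0 ` degree_piece n F 1 e" using vec_part_in[OF g(1)] by blast
  }
  fix f assume "f \<in> bd_map F 0 ` degree_piece n F 1 e"
  then obtain g where g: "g \<in> degree_piece n F 1 e" "f = bd_map F 0 g" by blast
  then have fm: "f \<in> {f \<in> free_module n F 0. aug_map F f = 0}" unfolding ex using degree_piece_free by blast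
  have "vec_part F 0 e f = f" using bd_vec_part[OF R, of 0 e g] vec_part_id[OF g(1)] g(2) by simp
  then show "f \<in> {f \<in> degree_piece n F 0 e. aug_map F f = 0}" using fm vec_part_in[of f n F 0 e] by simp
qed

lemma bd_map_degree_piece_exact:
  assumes R: "graded_free_resolution n I F"
  shows "{f \<in> degree_piece n F (Suc i) e. bd_map F i f = 0} = bd_map F (Suc i) ` degree_piece n F (Suc (Suc i)) e"
proof (intro equalityI subsetI)
  have ex: "{f \<in> free_module n F (Suc i). bd_map F i f = 0} = bd_map F (Suc i) ` free_module n F (Suc (Suc i))"
    by (rule resolution_exact[OF R])
  {
    fix f assume f: "f \<in> {f \<in> degree_piece n F (Suc i) e. bd_map F i f = 0}"
    then have "f \<in> bd_map F (Suc i) ` free_module n F (Suc (Suc i))" unfolding ex[symmetric] using degree_piece_free by blast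
    then obtain g where g: "g \<in> free_module n F (Suc (Suc i))" "f = bd_map F (Suc i) g" by blast
    have "f = bd_map F (Suc i) (vec_part F (Suc (Suc i)) e g)"
      using bd_vec_part[OF R, of "Suc i" e g] vec_part_id[of f n F "Suc i" e] f g by simp
    then show "f \<in> bd_map F (Suc i) ` degree_piece n F (Suc (Suc i)) e" using vec_part_in[OF g(1)] by blast
  }
  fix f assume "f \<in> bd_map F (Suc i) ` degree_piece n F (Suc (Suc i)) e"
  then obtain g where g: "g \<in> degree_piece n F (Suc (Suc i)) e" "f = bd_map F (Suc i) g" by blast
  then have fm: "f \<in> {f \<in> free_module n F (Suc i). bd_map F i f = 0}" unfolding ex using degree_piece_free by blast
  have "vec_part F (Suc i) e f = f" using bd_vec_part[OF R, of "Suc i" e g] vec_part_id[OF g(1)] g(2) by simp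
  then show "f \<in> {f \<in> degree_piece n F (Suc i) e. bd_map F i f = 0}" using fm vec_part_in[of f n F "Suc i" e] by simp
qed

text \<open>
With \<open>c\<close> for chains, \<open>z\<close> for cycles and \<open>b\<close> for boundaries, this is the invariance of the Euler
characteristic under passing to homology.
\<close>

lemma alternating_sum_telescope:
  fixes c z b :: "nat \<Rightarrow> nat"
  assumes "c 0 = z 0" "\<And>i. c (Suc i) = z (Suc i) + b i" "\<And>i. b i \<le> z i" "c (Suc N) = 0"
  shows "(\<Sum>i\<le>N. (-1) ^ i * int (c i)) = (\<Sum>i\<le>N. (-1) ^ i * int (z i - b i))"
proof -
  have "(\<Sum>i\<le>M. (-1) ^ i * int (c i)) = (\<Sum>i\<le>M. (-1) ^ i * int (z i - b i)) + (-1) ^ M * int (b M)" for M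
  proof (induction M)
    case 0
    then show ?case using assms(1) assms(3)[of 0] by (simp add: of_nat_diff)
  next
    case (Suc M)
    then show ?case using assms(2)[of M] assms(3)[of "Suc M"] by (simp add: of_nat_diff algebra_simps)
  qed
  from this[of N] show ?thesis using assms(2)[of N] assms(4) by simp
qed

lemma Hilbert_function_of_resolution:
  assumes R: "graded_free_resolution n I F" and N: "\<forall>i>N. free_rank F i = 0"
  shows "int (vector_space.dim poly_scale (I \<inter> homog n e)) =
    (\<Sum>i\<le>N. (-1) ^ i * (\<Sum>k<free_rank F i. num_monomials {1..n} (e - shifts F i ! k)))"
proof -
  let ?D = "\<lambda>V::(nat \<Rightarrow> 'a mpoly) set. vector_space.dim vec_scale V"
  define c where "c = (\<lambda>i. ?D (degree_piece n F i e))"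
  \<comment> \<open>Every element of \<open>F\<^sub>0\<close> counts as a cycle, so that the homology in degree 0 is \<open>I\<close>.\<close>
  define z where "z = (\<lambda>i. case i of 0 \<Rightarrow> c 0 | Suc j \<Rightarrow> ?D {f \<in> degree_piece n F (Suc j) e. bd_map F j f = 0})"
  define b where "b = (\<lambda>i. ?D (bd_map F i ` degree_piece n F (Suc i) e))"
  have cz: "c (Suc i) = z (Suc i) + b i" for i
    using rank_nullity[OF linear_bd_map conjunct1[OF dim_degree_piece[of n F "Suc i" e]], of F i] by (simp add: c_def z_def b_def)
  have zb: "z (Suc i) = b (Suc i)" for i
    unfolding z_def b_def by (simp add: bd_map_degree_piece_exact[OF R])
  have z0: "z 0 = b 0 + vector_space.dim poly_scale (I \<inter> homog n e)"
    using rank_nullity[OF linear_aug_map conjunct1[OF dim_degree_piece[of n F 0 e]], of F]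
    unfolding bd_map_degree_piece_exact_0[OF R] aug_map_degree_piece[OF R] by (simp add: z_def b_def c_def)
  have "c i = (\<Sum>k<free_rank F i. num_monomials {1..n} (e - shifts F i ! k))" for i
    using dim_degree_piece[of n F i e] by (simp add: c_def)
  moreover from this[of "Suc N"] N have "c (Suc N) = 0" by simp
  moreover have "b i \<le> z i" for i using z0 zb by (cases i) simp_all
  ultimately have "(\<Sum>i\<le>N. (-1) ^ i * (\<Sum>k<free_rank F i. num_monomials {1..n} (e - shifts F i ! k))) = (\<Sum>i\<le>N. (-1) ^ i * int (z i - b i))"
    using alternating_sum_telescope[of c z b N] cz by (simp add: z_def)
  also have "\<dots> = (\<Sum>i\<in>{0}. (-1) ^ i * int (z i - b i))"
  proof (rule sum.mono_neutral_right)
    have "z i - b i = 0" if "i \<noteq> 0" for i using that zb by (cases i) simp_all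
    then show "\<forall>i\<in>{..N} - {0}. (-1) ^ i * int (z i - b i) = 0" by simp
  qed auto
  finally show ?thesis using z0 by simp
qed

lemma fin_dim_tensor_K:
  "fin_dim fun_scale (tensor_K (F :: 'k::field mpoly free_complex) i j) \<and>
   vector_space.dim fun_scale (tensor_K F i j) = card {k. k < free_rank F i \<and> shifts F i ! k = j}"
proof -
  have "tensor_K F i j = supported_on {k. k < free_rank F i \<and> shifts F i ! k = j}"
    by (auto simp: tensor_K_def supported_on_def)
  then show ?thesis using dim_supported_on[of "{k. k < free_rank F i \<and> shifts F i ! k = j}", where 'k='k] by simp
qed

lemma const_bd_eq_0:
  assumes R: "graded_free_resolution n I F" and "k < free_rank F i" "l < free_rank F (Suc i)"
    and "shifts F (Suc i) ! l \<noteq> shifts F i ! k"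
  shows "lookup (bd F i k l) 0 = 0"
proof (rule ccontr)
  assume "lookup (bd F i k l) 0 \<noteq> 0"
  then have "0 \<in> keys (bd F i k l)" by (simp add: in_keys_iff)
  moreover have "bd F i k l \<in> homog n (shifts F (Suc i) ! l - shifts F i ! k)"
    by (rule resolution_bd_homog[OF R assms(2,3)])
  ultimately have "int (mdeg 0) = shifts F (Suc i) ! l - shifts F i ! k" unfolding homog_def by blast
  then show False using assms(4) by simp
qed

lemma tensor_bd_in:
  assumes R: "graded_free_resolution n I F" and f: "f \<in> tensor_K F (Suc i) j"
  shows "tensor_bd F i f \<in> tensor_K F i j"
  unfolding tensor_K_def
proof (intro CollectI allI impI)
  fix k assume nz: "tensor_bd F i f k \<noteq> 0"
  then have k: "k < free_rank F i" by (auto simp: tensor_bd_def split: if_splits)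
  then have "(\<Sum>l<free_rank F (Suc i). lookup (bd F i k l) 0 * f l) \<noteq> 0"
    using nz by (simp add: tensor_bd_def)
  then obtain l where l: "l < free_rank F (Suc i)" "lookup (bd F i k l) 0 * f l \<noteq> 0"
    by (meson lessThan_iff sum.neutral)
  then have "shifts F (Suc i) ! l = shifts F i ! k" using const_bd_eq_0[OF R k l(1)] by auto
  moreover have "shifts F (Suc i) ! l = j" using f l by (auto simp: tensor_K_def)
  ultimately show "k < free_rank F i \<and> shifts F i ! k = j" using k by simp
qed

definition const_vec :: "(nat \<Rightarrow> 'k::field) \<Rightarrow> nat \<Rightarrow> 'k mpoly" where
  "const_vec f = (\<lambda>k. single 0 (f k))"

lemma const_vec_free: "f \<in> tensor_K F i j \<Longrightarrow> const_vec f \<in> free_module n F i"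
  unfolding const_vec_def free_module_def tensor_K_def
proof (intro CollectI conjI allI impI)
  fix k assume f: "f \<in> {f. \<forall>k. f k \<noteq> 0 \<longrightarrow> k < free_rank F i \<and> shifts F i ! k = j}"
  show "single 0 (f k) \<in> polys n" by (simp add: polys_single)
  assume "free_rank F i \<le> k"
  moreover have "f k \<noteq> 0 \<longrightarrow> k < free_rank F i" using f by simp
  ultimately have "f k = 0" by auto
  then show "single 0 (f k) = 0" by simp
qed

text \<open>
Taking constant coefficients is the reduction modulo all variables; it is multiplicative, so it
carries the maps of the resolution to those of the tensor product.
\<close>

lemma tensor_bd_lookup: "tensor_bd F i (\<lambda>l. lookup (f l) 0) k = lookup (bd_map F i f k) 0"
  by (simp add: tensor_bd_def bd_map_def lookup_sum lookup_times_0)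

lemma tensor_bd_const: "tensor_bd F i f k = lookup (bd_map F i (const_vec f) k) 0"
  using tensor_bd_lookup[of F i "const_vec f" k] by (simp add: const_vec_def)

lemma resolution_bd_bd:
  assumes R: "graded_free_resolution n I F" and f: "f \<in> free_module n F (Suc (Suc i))"
  shows "bd_map F i (bd_map F (Suc i) f) = 0"
proof -
  have "{f \<in> free_module n F (Suc i). bd_map F i f = 0} = bd_map F (Suc i) ` free_module n F (Suc (Suc i))"
    by (rule resolution_exact[OF R])
  then show ?thesis using f by blast
qed

lemma tensor_bd_bd:
  assumes R: "graded_free_resolution n I F" and f: "f \<in> tensor_K F (Suc (Suc i)) j"
  shows "tensor_bd F i (tensor_bd F (Suc i) f) = 0"
proof
  fix k
  have "tensor_bd F (Suc i) f = (\<lambda>l. lookup (bd_map F (Suc i) (const_vec f) l) 0)"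
    by (rule ext) (rule tensor_bd_const)
  then have "tensor_bd F i (tensor_bd F (Suc i) f) k = lookup (bd_map F i (bd_map F (Suc i) (const_vec f)) k) 0"
    by (simp only: tensor_bd_lookup)
  then show "tensor_bd F i (tensor_bd F (Suc i) f) k = 0 k"
    using resolution_bd_bd[OF R const_vec_free[OF f]] by simp
qed

lemma tensor_boundaries_subset:
  assumes R: "graded_free_resolution n I F"
  shows "tensor_boundaries F i j \<subseteq> tensor_cycles F i j"
  using tensor_bd_in[OF R] tensor_bd_bd[OF R] by (cases i) (auto simp: tensor_boundaries_def)

lemma fin_dim_tensor_cycles:
  "fin_dim fun_scale (tensor_cycles (F :: 'k::field mpoly free_complex) i j)"
proof (cases i)
  case 0
  then show ?thesis using fin_dim_tensor_K[of F 0 j] by simp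
next
  case (Suc m)
  interpret t: Vector_Spaces.linear fun_scale fun_scale "tensor_bd F m" by (rule linear_tensor_bd)
  have fd: "fin_dim fun_scale (tensor_K F (Suc m) j)" using fin_dim_tensor_K by blast
  then have "t.vs1.subspace (tensor_K F (Suc m) j)" by (simp add: fin_dim_def)
  then have "t.vs1.subspace (tensor_cycles F (Suc m) j)"
    unfolding t.vs1.subspace_def by (auto simp: t.add t.scale)
  moreover have "tensor_cycles F (Suc m) j \<subseteq> tensor_K F (Suc m) j" by auto
  ultimately show ?thesis unfolding Suc by (rule fin_dim_subset[OF vector_space_fun fd])
qed

text \<open>
The resolution may have superfluous summands; in the Euler characteristic they cancel.
\<close>

lemma tensor_Euler_characteristic:
  fixes F :: "'k::field mpoly free_complex"
  assumes R: "graded_free_resolution n I F" and N: "\<forall>i>N. free_rank F i = 0"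
  shows "(\<Sum>i\<le>N. (-1) ^ i * int (card {k. k < free_rank F i \<and> shifts F i ! k = j})) =
    (\<Sum>i\<le>N. (-1) ^ i * int (homology_dim F i j))"
  unfolding homology_dim_def
proof (rule alternating_sum_telescope)
  show "card {k. k < free_rank F 0 \<and> shifts F 0 ! k = j} = K_dim (tensor_cycles F 0 j)"
    using fin_dim_tensor_K[of F 0 j] by simp
  show "card {k. k < free_rank F (Suc i) \<and> shifts F (Suc i) ! k = j} =
      K_dim (tensor_cycles F (Suc i) j) + K_dim (tensor_boundaries F i j)" for i
    using rank_nullity[OF linear_tensor_bd conjunct1[OF fin_dim_tensor_K[of F "Suc i" j]], of F i] fin_dim_tensor_K[of F "Suc i" j]
    by (simp add: tensor_boundaries_def)
  show "K_dim (tensor_boundaries F i j) \<le> K_dim (tensor_cycles F i j)" for i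
    by (rule dim_mono_fin[OF vector_space_fun fin_dim_tensor_cycles tensor_boundaries_subset[OF R]])
  show "card {k. k < free_rank F (Suc N) \<and> shifts F (Suc N) ! k = j} = 0" using N by simp
qed

text \<open>
The summands of the resolution are collected by their shift \<open>j\<close>, and the Euler characteristic
replaces their number by Betti numbers, of which only those with \<open>j = i + d\<close> are nonzero.
\<close>

lemma Hilbert_function_linear:
  fixes F :: "'k::field mpoly free_complex"
  assumes R: "graded_free_resolution n I F" and N: "\<forall>i>N. free_rank F i = 0"
    and lin: "\<And>i j. j \<noteq> int i + int d \<Longrightarrow> homology_dim F i j = 0"
  shows "int (vector_space.dim poly_scale (I \<inter> homog n e)) =
    (\<Sum>i\<le>N. (-1) ^ i * int (homology_dim F i (int i + int d)) * num_monomials {1..n} (e - int d - int i))"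
proof -
  let ?h = "num_monomials {1..n}"
  \<comment> \<open>A finite set that contains all shifts and all degrees in which a Betti number may be nonzero.\<close>
  define J where "J = (\<Union>i\<le>N. (\<lambda>k. shifts F i ! k) ` {..<free_rank F i}) \<union> (\<lambda>i. int i + int d) ` {..N}"
  have J: "finite J" by (auto simp: J_def)
  let ?c = "\<lambda>i j. int (card {k. k < free_rank F i \<and> shifts F i ! k = j})"
  have "(\<Sum>k<free_rank F i. ?h (e - shifts F i ! k)) = (\<Sum>j\<in>J. ?c i j * ?h (e - j))" if "i \<le> N" for i
  proof -
    have "(\<Sum>k<free_rank F i. ?h (e - shifts F i ! k)) =
        (\<Sum>j\<in>J. \<Sum>k\<in>{k\<in>{..<free_rank F i}. shifts F i ! k = j}. ?h (e - shifts F i ! k))"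
      using that by (intro sum.group[symmetric] J) (auto simp: J_def)
    also have "\<dots> = (\<Sum>j\<in>J. ?c i j * ?h (e - j))"
      by (rule sum.cong) (simp_all add: lessThan_def)
    finally show ?thesis .
  qed
  then have "int (vector_space.dim poly_scale (I \<inter> homog n e)) = (\<Sum>i\<le>N. (-1) ^ i * (\<Sum>j\<in>J. ?c i j * ?h (e - j)))"
    unfolding Hilbert_function_of_resolution[OF R N] by (intro sum.cong) simp_all
  also have "\<dots> = (\<Sum>j\<in>J. (\<Sum>i\<le>N. (-1) ^ i * ?c i j) * ?h (e - j))"
    unfolding sum_distrib_left sum_distrib_right by (subst sum.swap) (simp add: mult.assoc)
  also have "\<dots> = (\<Sum>j\<in>J. (\<Sum>i\<le>N. (-1) ^ i * int (homology_dim F i j)) * ?h (e - j))"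
    by (simp only: tensor_Euler_characteristic[OF R N])
  also have "\<dots> = (\<Sum>i\<le>N. \<Sum>j\<in>J. (-1) ^ i * int (homology_dim F i j) * ?h (e - j))"
    unfolding sum_distrib_right by (rule sum.swap)
  also have "\<dots> = (\<Sum>i\<le>N. (-1) ^ i * int (homology_dim F i (int i + int d)) * ?h (e - int d - int i))"
  proof (rule sum.cong)
    fix i assume i: "i \<in> {..N}"
    have "(\<Sum>j\<in>J. (-1) ^ i * int (homology_dim F i j) * ?h (e - j)) =
        (\<Sum>j\<in>{int i + int d}. (-1) ^ i * int (homology_dim F i j) * ?h (e - j))"
      by (rule sum.mono_neutral_right[OF J]) (use i lin in \<open>auto simp: J_def\<close>)
    then show "(\<Sum>j\<in>J. (-1) ^ i * int (homology_dim F i j) * ?h (e - j)) =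
        (-1) ^ i * int (homology_dim F i (int i + int d)) * ?h (e - int d - int i)"
      by (simp add: algebra_simps)
  qed simp
  finally show ?thesis .
qed

text \<open>
In degree \<open>d + i\<close> the \<open>i\<close>-th coefficient occurs with the factor \<open>h 0 = 1\<close>, and all later ones with
the value of \<open>h\<close> at a negative number, which is 0.
\<close>

lemma Hilbert_coefficients_unique:
  fixes a b :: "nat \<Rightarrow> int"
  assumes eq: "\<And>e. (\<Sum>i\<le>N. a i * num_monomials {1..n} (e - int d - int i)) = (\<Sum>i\<le>N. b i * num_monomials {1..n} (e - int d - int i))"
    and "i \<le> N"
  shows "a i = b i"
  using assms(2)
proof (induction i rule: less_induct)
  case (less i)
  have n0: "num_monomials {1..n} 0 = 1"
  proof -
    have "monomials {1..n} 0 = {0}" by (auto simp: monomials_def mdeg_eq_0_iff)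
    then show ?thesis by (simp add: num_monomials_def)
  qed
  have split: "(\<Sum>k\<le>N. c k * num_monomials {1..n} (int d + int i - int d - int k)) =
      (\<Sum>k<i. c k * num_monomials {1..n} (int d + int i - int d - int k)) + c i" for c
  proof -
    have "(\<Sum>k\<le>N. c k * num_monomials {1..n} (int d + int i - int d - int k)) =
        (\<Sum>k\<in>insert i {..<i}. c k * num_monomials {1..n} (int d + int i - int d - int k))"
      by (rule sum.mono_neutral_right) (use less.prems in \<open>auto simp: num_monomials_def\<close>)
    then show ?thesis by (simp add: n0 del: One_nat_def)
  qed
  have "(\<Sum>k<i. a k * num_monomials {1..n} (int d + int i - int d - int k)) = (\<Sum>k<i. b k * num_monomials {1..n} (int d + int i - int d - int k))"
  proof (rule sum.cong)
    fix k assume "k \<in> {..<i}"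
    then have "a k = b k" using less.IH[of k] less.prems by simp
    then show "a k * num_monomials {1..n} (int d + int i - int d - int k) = b k * num_monomials {1..n} (int d + int i - int d - int k)" by simp
  qed simp
  then show ?case using eq[of "int d + int i"] unfolding split by simp
qed

section \<open>The Taylor resolution\<close>

text \<open>
The sign of \<open>x\<close> in the boundary of the simplex \<open>insert x \<sigma>\<close>: its position among the vertices.
\<close>

definition below_sign :: "nat \<Rightarrow> nat set \<Rightarrow> 'a::comm_ring_1" where
  "below_sign x \<sigma> = (-1) ^ card {y \<in> \<sigma>. y < x}"

text \<open>
The coefficient at \<open>\<sigma>\<close> of the boundary of the chain \<open>c\<close> in the full simplex on the vertex set \<open>R\<close>;
the coefficients may lie in any commutative ring.
\<close>

definition simplicial_bd :: "nat set \<Rightarrow> (nat set \<Rightarrow> 'a::comm_ring_1) \<Rightarrow> nat set \<Rightarrow> 'a" where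
  "simplicial_bd R c \<sigma> = (\<Sum>x\<in>R - \<sigma>. below_sign x \<sigma> * c (insert x \<sigma>))"

lemma below_sign_insert_less:
  assumes "finite \<sigma>" "x \<notin> \<sigma>" "x < y"
  shows "below_sign y (insert x \<sigma>) = - below_sign y \<sigma>"
proof -
  have "{z \<in> insert x \<sigma>. z < y} = insert x {z \<in> \<sigma>. z < y}" using assms by auto
  then show ?thesis using assms by (simp add: below_sign_def)
qed

lemma below_sign_insert_greater:
  assumes "\<not> x < y"
  shows "below_sign y (insert x \<sigma>) = below_sign y \<sigma>"
proof -
  have "{z \<in> insert x \<sigma>. z < y} = {z \<in> \<sigma>. z < y}" using assms by auto
  then show ?thesis by (simp add: below_sign_def)
qed

text \<open>
The terms for \<open>(x, y)\<close> and \<open>(y, x)\<close> cancel.  They are paired off by \<open>x < y\<close>, because a sum that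
equals its negative need not vanish in characteristic 2.
\<close>

lemma simplicial_bd_bd:
  assumes "finite R" "\<sigma> \<subseteq> R"
  shows "simplicial_bd R (simplicial_bd R c) \<sigma> = 0"
proof -
  have f\<sigma>: "finite \<sigma>" using assms finite_subset by blast
  let ?g = "\<lambda>x y. below_sign x \<sigma> * (below_sign y (insert x \<sigma>) * c (insert y (insert x \<sigma>)))"
  let ?V = "R - \<sigma>"
  have fV: "finite ?V" using assms by simp
  have "simplicial_bd R (simplicial_bd R c) \<sigma> = (\<Sum>x\<in>?V. \<Sum>y\<in>?V. if x \<noteq> y then ?g x y else 0)"
    unfolding simplicial_bd_def sum_distrib_left
  proof (rule sum.cong)
    fix x assume "x \<in> ?V"
    show "(\<Sum>y\<in>R - insert x \<sigma>. ?g x y) = (\<Sum>y\<in>?V. if x \<noteq> y then ?g x y else 0)"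
      by (rule sum.mono_neutral_cong_left) (use fV in auto)
  qed simp
  also have "\<dots> = (\<Sum>x\<in>?V. \<Sum>y\<in>?V. (if x < y then ?g x y else 0) + (if y < x then ?g x y else 0))"
    by (intro sum.cong) auto
  also have "\<dots> = (\<Sum>x\<in>?V. \<Sum>y\<in>?V. if x < y then ?g x y else 0) + (\<Sum>y\<in>?V. \<Sum>x\<in>?V. if y < x then ?g x y else 0)"
    unfolding sum.distrib by (subst (3) sum.swap) simp
  also have "\<dots> = (\<Sum>x\<in>?V. \<Sum>y\<in>?V. if x < y then ?g x y + ?g y x else 0)"
    unfolding sum.distrib[symmetric] by (intro sum.cong) auto
  also have "\<dots> = 0"
  proof (intro sum.neutral ballI)
    fix x y assume "x \<in> ?V" "y \<in> ?V"
    then show "(if x < y then ?g x y + ?g y x else 0) = 0"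
      using below_sign_insert_less[OF f\<sigma>, of x y, where 'a='a] below_sign_insert_greater[of y x \<sigma>, where 'a='a]
      by (simp add: insert_commute algebra_simps)
  qed
  finally show ?thesis .
qed

text \<open>
A simplex is contracted to its least vertex \<open>j\<close>: adding \<open>j\<close> to every face is a homotopy
between the identity and zero.  The order of the vertices gives \<open>j\<close> the sign 1.
\<close>

lemma simplicial_contraction:
  assumes R: "finite R" "\<sigma> \<subseteq> R" "j \<in> R"
    and supp: "\<And>\<tau> x. c \<tau> \<noteq> 0 \<Longrightarrow> x \<in> \<tau> \<Longrightarrow> j \<le> x"
    and cyc: "j \<in> \<sigma> \<Longrightarrow> simplicial_bd R c (\<sigma> - {j}) = 0"
  shows "simplicial_bd R (\<lambda>\<tau>. if j \<in> \<tau> then c (\<tau> - {j}) else 0) \<sigma> = c \<sigma>"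
proof -
  have f\<sigma>: "finite \<sigma>" using R finite_subset by blast
  show ?thesis
  proof (cases "j \<in> \<sigma>")
    case False
    have "simplicial_bd R (\<lambda>\<tau>. if j \<in> \<tau> then c (\<tau> - {j}) else 0) \<sigma> =
        (\<Sum>x\<in>{j}. below_sign x \<sigma> * (if j \<in> insert x \<sigma> then c (insert x \<sigma> - {j}) else 0))"
      unfolding simplicial_bd_def by (rule sum.mono_neutral_right) (use R False in auto)
    also have "\<dots> = below_sign j \<sigma> * c \<sigma>" using False by simp
    also have "\<dots> = c \<sigma>"
    proof (cases "c \<sigma> = 0")
      case nz: False
      then have "{y \<in> \<sigma>. y < j} = {}" using supp[OF nz] by (auto simp: not_less)
      then have "below_sign j \<sigma> = (1 :: 'a)" by (simp add: below_sign_def del: Collect_empty_eq)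
      then show ?thesis by simp
    qed simp
    finally show ?thesis .
  next
    case True
    let ?\<tau> = "\<sigma> - {j}"
    have ins: "insert j ?\<tau> = \<sigma>" using True by auto
    have "R - ?\<tau> = insert j (R - \<sigma>)" using R True by auto
    then have "0 = below_sign j ?\<tau> * c \<sigma> + (\<Sum>x\<in>R - \<sigma>. below_sign x ?\<tau> * c (insert x ?\<tau>))"
      using cyc[OF True] True R ins unfolding simplicial_bd_def by simp
    also have "below_sign j ?\<tau> * c \<sigma> = c \<sigma>"
    proof (cases "c \<sigma> = 0")
      case nz: False
      then have "{y \<in> ?\<tau>. y < j} = {}" using supp[OF nz] by (auto simp: not_less)
      then have "below_sign j ?\<tau> = (1 :: 'a)" by (simp add: below_sign_def del: Collect_empty_eq)
      then show ?thesis by simp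
    qed simp
    also have "(\<Sum>x\<in>R - \<sigma>. below_sign x ?\<tau> * c (insert x ?\<tau>)) = (\<Sum>x\<in>R - \<sigma>. - (below_sign x \<sigma> * c (insert x ?\<tau>)))"
    proof (rule sum.cong)
      fix x assume x: "x \<in> R - \<sigma>"
      show "below_sign x ?\<tau> * c (insert x ?\<tau>) = - (below_sign x \<sigma> * c (insert x ?\<tau>))"
      proof (cases "c (insert x ?\<tau>) = 0")
        case False
        then have "j < x" using supp[OF False, of x] x True by (cases "x = j") auto
        then have "below_sign x (insert j ?\<tau>) = (- below_sign x ?\<tau> :: 'a)"
          using f\<sigma> by (intro below_sign_insert_less) auto
        then show ?thesis unfolding ins by simp
      qed simp
    qed simp
    also have "\<dots> = - (\<Sum>x\<in>R - \<sigma>. below_sign x \<sigma> * c (insert x ?\<tau>))" by (rule sum_negf)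
    finally have "c \<sigma> = (\<Sum>x\<in>R - \<sigma>. below_sign x \<sigma> * c (insert x ?\<tau>))" by simp
    also have "\<dots> = simplicial_bd R (\<lambda>\<tau>. if j \<in> \<tau> then c (\<tau> - {j}) else 0) \<sigma>"
      unfolding simplicial_bd_def
    proof (rule sum.cong)
      fix x assume "x \<in> R - \<sigma>"
      then have "insert x \<sigma> - {j} = insert x ?\<tau>" using True by auto
      then show "below_sign x \<sigma> * c (insert x ?\<tau>) = below_sign x \<sigma> * (if j \<in> insert x \<sigma> then c (insert x \<sigma> - {j}) else 0)"
        using True by simp
    qed simp
    finally show ?thesis by simp
  qed
qed

lemma lookup_sign_times: "lookup (below_sign x \<sigma> * (p :: 'k::field mpoly)) m = below_sign x \<sigma> * lookup p m"
proof -
  have "lookup ((-1) ^ k * p) m = (-1) ^ k * lookup p m" for k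
    by (induction k) simp_all
  then show ?thesis by (simp add: below_sign_def)
qed

lemma homog_sign: "p \<in> homog n e \<Longrightarrow> below_sign x \<sigma> * p \<in> homog n e"
proof -
  have "keys (below_sign x \<sigma> * p) \<subseteq> keys p"
    by (auto simp: in_keys_iff lookup_sign_times)
  then show "p \<in> homog n e \<Longrightarrow> below_sign x \<sigma> * p \<in> homog n e" unfolding homog_iff by blast
qed

text \<open>
The ideal is generated by the squarefree monomials with supports \<open>E 0, \<dots>, E (r - 1)\<close>.
\<close>

locale taylor =
  fixes n r :: nat and E :: "nat \<Rightarrow> nat set"
  assumes E: "\<And>j. j < r \<Longrightarrow> E j \<subseteq> {1..n}"
begin

text \<open>
The support of the least common multiple of the generators with index in \<open>\<sigma>\<close>.
\<close>

definition U :: "nat set \<Rightarrow> nat set" where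
  "U \<sigma> = (\<Union>j\<in>\<sigma>. E j)"

text \<open>
Indexed by cardinality: the module in homological degree \<open>i\<close> belongs to \<open>faces (Suc i)\<close>, and the
augmentation ends at the empty face.
\<close>

definition faces :: "nat \<Rightarrow> nat set set" where
  "faces k = {\<sigma>. \<sigma> \<subseteq> {..<r} \<and> card \<sigma> = k}"

lemma finite_faces: "finite (faces k)"
  by (rule finite_subset[of _ "Pow {..<r}"]) (auto simp: faces_def)

lemma faces_finite: "\<sigma> \<in> faces k \<Longrightarrow> finite \<sigma>"
  unfolding faces_def by (auto intro: finite_subset)

lemma faces_U: "\<sigma> \<in> faces k \<Longrightarrow> U \<sigma> \<subseteq> {1..n} \<and> finite (U \<sigma>)"
  using E finite_subset[of "U \<sigma>" "{1..n}"] unfolding faces_def U_def by blast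

lemma faces_insert: "\<sigma> \<in> faces k \<Longrightarrow> x \<in> {..<r} - \<sigma> \<Longrightarrow> insert x \<sigma> \<in> faces (Suc k)"
  using faces_finite[of \<sigma> k] by (auto simp: faces_def)

text \<open>
The faces of a given cardinality in an arbitrary order; the order numbers the basis of a module of
the complex.
\<close>

definition face :: "nat \<Rightarrow> nat \<Rightarrow> nat set" where
  "face k = (SOME h. bij_betw h {0..<card (faces k)} (faces k))"

lemma face_bij: "bij_betw (face k) {0..<card (faces k)} (faces k)"
  unfolding face_def by (rule someI_ex[OF ex_bij_betw_nat_finite[OF finite_faces]])

definition face_index :: "nat \<Rightarrow> nat set \<Rightarrow> nat" where
  "face_index k \<sigma> = the_inv_into {0..<card (faces k)} (face k) \<sigma>"

lemma face_index_face: "l < card (faces k) \<Longrightarrow> face_index k (face k l) = l"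
  unfolding face_index_def using face_bij[of k] by (simp add: the_inv_into_f_f bij_betw_def)

lemma face_face_index: "\<sigma> \<in> faces k \<Longrightarrow> face k (face_index k \<sigma>) = \<sigma> \<and> face_index k \<sigma> < card (faces k)"
  unfolding face_index_def using face_bij[of k]
  by (metis atLeastLessThan_iff bij_betw_def f_the_inv_into_f order_refl the_inv_into_into)

lemma face_in: "l < card (faces k) \<Longrightarrow> face k l \<in> faces k"
  using face_bij[of k] by (auto simp: bij_betw_def)

text \<open>
The module in homological degree \<open>i\<close> has one basis element for every set \<open>\<sigma>\<close> of \<open>i + 1\<close>
generators, of the degree of their least common multiple.  The map is the simplicial boundary with each
entry multiplied by the quotient of the two least common multiples.
\<close>

definition taylor_complex :: "'k::field mpoly free_complex" where
  "taylor_complex = \<lparr>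
     shifts = (\<lambda>i. map (\<lambda>k. int (card (U (face (Suc i) k)))) [0..<card (faces (Suc i))]),
     aug = (\<lambda>l. single (sqfree (U (face 1 l))) 1),
     bd = (\<lambda>i k l. \<Sum>x\<in>{..<r} - face (Suc i) k.
        if face (Suc (Suc i)) l = insert x (face (Suc i) k)
        then below_sign x (face (Suc i) k) *
          single (sqfree (U (face (Suc (Suc i)) l) - U (face (Suc i) k))) 1
        else 0) \<rparr>"

lemma rank_taylor: "free_rank taylor_complex i = card (faces (Suc i))"
  by (simp add: free_rank_def taylor_complex_def)

lemma shifts_taylor: "k < card (faces (Suc i)) \<Longrightarrow> shifts taylor_complex i ! k = int (card (U (face (Suc i) k)))"
  by (simp add: taylor_complex_def)

lemma aug_taylor: "aug taylor_complex l = single (sqfree (U (face 1 l))) 1"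
  by (simp add: taylor_complex_def)

lemma bd_taylor:
  "bd taylor_complex i k l = (\<Sum>x\<in>{..<r} - face (Suc i) k.
     if face (Suc (Suc i)) l = insert x (face (Suc i) k)
     then below_sign x (face (Suc i) k) *
       single (sqfree (U (face (Suc (Suc i)) l) - U (face (Suc i) k))) 1
     else 0)"
  by (simp add: taylor_complex_def)

text \<open>
Chains with polynomial coefficients in the full simplex such that the coefficient at \<open>\<sigma>\<close> is a
multiple of the least common multiple that belongs to \<open>\<sigma>\<close>.
\<close>

definition lcm_chains :: "nat \<Rightarrow> (nat set \<Rightarrow> 'k::field mpoly) set" where
  "lcm_chains k = {g. \<forall>\<sigma>. g \<sigma> \<in> polys n \<and> (g \<sigma> \<noteq> 0 \<longrightarrow> \<sigma> \<in> faces k) \<and>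
     (\<forall>m\<in>keys (g \<sigma>). U \<sigma> \<subseteq> keys m)}"

text \<open>
Multiplying the coordinate at \<open>\<sigma>\<close> by the least common multiple of \<open>\<sigma>\<close> turns the map of the
Taylor complex into the plain simplicial boundary and identifies the modules with the spaces
\<open>lcm_chains\<close>.
\<close>

definition emb :: "nat \<Rightarrow> (nat \<Rightarrow> 'k::field mpoly) \<Rightarrow> nat set \<Rightarrow> 'k mpoly" where
  "emb k f \<sigma> = (if \<sigma> \<in> faces k then single (sqfree (U \<sigma>)) 1 * f (face_index k \<sigma>) else 0)"

lemma emb_in:
  assumes f: "f \<in> free_module n taylor_complex i"
  shows "emb (Suc i) f \<in> lcm_chains (Suc i)"
proof -
  have "emb (Suc i) f \<sigma> \<in> polys n \<and> (\<forall>m\<in>keys (emb (Suc i) f \<sigma>). U \<sigma> \<subseteq> keys m)"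
    if \<sigma>: "\<sigma> \<in> faces (Suc i)" for \<sigma>
  proof
    have "f (face_index (Suc i) \<sigma>) \<in> polys n"
      using f face_face_index[OF \<sigma>] by (simp add: free_module_def rank_taylor)
    moreover have "single (sqfree (U \<sigma>)) 1 \<in> polys n"
      using faces_U[OF \<sigma>] by (intro polys_single) simp
    ultimately show "emb (Suc i) f \<sigma> \<in> polys n" using \<sigma> polys_mult by (simp add: emb_def)
    show "\<forall>m\<in>keys (emb (Suc i) f \<sigma>). U \<sigma> \<subseteq> keys m"
    proof
      fix m assume "m \<in> keys (emb (Suc i) f \<sigma>)"
      then obtain b where "m = sqfree (U \<sigma>) + b"
        using \<sigma> by (auto simp: emb_def in_keys_iff lookup_single_times split: if_splits)
      then show "U \<sigma> \<subseteq> keys m" using faces_U[OF \<sigma>] by (simp add: keys_add_monomial)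
    qed
  qed
  then show ?thesis by (auto simp: lcm_chains_def emb_def split: if_splits)
qed

lemma single_times_cancel:
  assumes "single a 1 * p = single a 1 * (q :: 'k::field mpoly)"
  shows "p = q"
proof (rule poly_mapping_eqI)
  fix m
  have "lookup (single a 1 * p) (a + m) = lookup (single a 1 * q) (a + m)"
    by (simp only: assms)
  then show "lookup p m = lookup q m"
    unfolding lookup_single_times_add by simp
qed

lemma emb_inj:
  assumes "f \<in> free_module n taylor_complex i" "f' \<in> free_module n taylor_complex i"
    and eq: "\<And>\<sigma>. \<sigma> \<in> faces (Suc i) \<Longrightarrow> emb (Suc i) f \<sigma> = emb (Suc i) f' \<sigma>"
  shows "f = f'"
proof
  fix l
  show "f l = f' l"
  proof (cases "l < card (faces (Suc i))")
    case True
    then have "face (Suc i) l \<in> faces (Suc i)" by (rule face_in)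
    from eq[OF this] this True show ?thesis
      by (auto simp: emb_def face_index_face intro: single_times_cancel)
  next
    case False
    then show ?thesis using assms by (simp add: free_module_def rank_taylor)
  qed
qed

lemma exists_quotient:
  assumes "finite X" "p \<in> polys n" "\<forall>m\<in>keys (p :: 'k::field mpoly). X \<subseteq> keys m"
  shows "\<exists>q\<in>polys n. single (sqfree X) 1 * q = p"
proof -
  define q where "q = Poly_Mapping.map_key (\<lambda>m. sqfree X + m) p"
  have "inj (\<lambda>m. sqfree X + m)" by (auto simp: inj_def)
  then have q: "lookup q m = lookup p (sqfree X + m)" for m
    unfolding q_def by (simp add: map_key.rep_eq)
  have "single (sqfree X) 1 * q = p"
  proof (rule poly_mapping_eqI)
    fix m
    show "lookup (single (sqfree X) 1 * q) m = lookup p m"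
    proof (cases "m \<in> keys p")
      case True
      then have "(m - sqfree X) + sqfree X = m" using assms by (intro subset_keys_imp_add) auto
      then have m: "m = sqfree X + (m - sqfree X)" by (simp add: add.commute)
      have "lookup (single (sqfree X) 1 * q) (sqfree X + (m - sqfree X)) = lookup p (sqfree X + (m - sqfree X))"
        unfolding lookup_single_times_add q by simp
      then show ?thesis unfolding m[symmetric] .
    next
      case False
      then show ?thesis by (auto simp: lookup_single_times q in_keys_iff)
    qed
  qed
  moreover have "q \<in> polys n" unfolding polys_def
  proof (intro CollectI ballI)
    fix m assume "m \<in> keys q"
    then have "sqfree X + m \<in> keys p" by (simp add: in_keys_iff q)
    then have "keys (sqfree X + m) \<subseteq> {1..n}" using assms(2) unfolding polys_def by blast
    then show "keys m \<subseteq> {1..n}" unfolding keys_add_monomial by blast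
  qed
  ultimately show ?thesis by blast
qed

lemma emb_surj:
  assumes g: "g \<in> lcm_chains (Suc i)"
  shows "\<exists>f\<in>free_module n taylor_complex i. emb (Suc i) f = g"
proof -
  have "\<exists>q\<in>polys n. single (sqfree (U \<sigma>)) 1 * q = g \<sigma>" if "\<sigma> \<in> faces (Suc i)" for \<sigma>
    by (rule exists_quotient) (use g faces_U[OF that] in \<open>auto simp: lcm_chains_def\<close>)
  then obtain q where q: "\<forall>\<sigma>\<in>faces (Suc i). q \<sigma> \<in> polys n \<and> single (sqfree (U \<sigma>)) 1 * q \<sigma> = g \<sigma>"
    by metis
  define f where "f = (\<lambda>l. if l < card (faces (Suc i)) then q (face (Suc i) l) else 0)"
  have "f \<in> free_module n taylor_complex i"
    using q face_in by (auto simp: free_module_def rank_taylor f_def)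
  moreover have "emb (Suc i) f = g"
  proof
    fix \<sigma>
    show "emb (Suc i) f \<sigma> = g \<sigma>"
      using q g face_face_index[of \<sigma> "Suc i"] by (auto simp: emb_def f_def lcm_chains_def)
  qed
  ultimately show ?thesis by blast
qed

lemma aug_taylor_homog:
  assumes "l < card (faces 1)"
  shows "aug (taylor_complex :: 'k::field mpoly free_complex) l \<in>
    homog n (shifts (taylor_complex :: 'k mpoly free_complex) 0 ! l)"
proof -
  have "U (face 1 l) \<subseteq> {1..n}" "finite (U (face 1 l))" using faces_U face_in[OF assms] by auto
  then have "sqfree (U (face 1 l)) \<in> monomials {1..n} (int (card (U (face 1 l))))"
    by (simp add: monomials_def)
  then show ?thesis
    using assms shifts_taylor[of l 0, where 'a='k] by (simp add: aug_taylor homog_single)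
qed

lemma bd_taylor_homog:
  assumes k: "k < card (faces (Suc i))" and l: "l < card (faces (Suc (Suc i)))"
  shows "bd (taylor_complex :: 'k::field mpoly free_complex) i k l \<in>
    homog n (shifts (taylor_complex :: 'k mpoly free_complex) (Suc i) ! l - shifts (taylor_complex :: 'k mpoly free_complex) i ! k)"
proof -
  let ?\<sigma> = "face (Suc i) k" and ?\<tau> = "face (Suc (Suc i)) l"
  have U: "U ?\<sigma> \<subseteq> {1..n}" "finite (U ?\<sigma>)" "U ?\<tau> \<subseteq> {1..n}" "finite (U ?\<tau>)"
    using faces_U face_in[OF k] face_in[OF l] by auto
  have "below_sign x ?\<sigma> * single (sqfree (U ?\<tau> - U ?\<sigma>)) (1::'k)
      \<in> homog n (int (card (U ?\<tau>)) - int (card (U ?\<sigma>)))" if "?\<tau> = insert x ?\<sigma>" for x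
  proof -
    have "U ?\<sigma> \<subseteq> U ?\<tau>" using that by (auto simp: U_def)
    then have "int (card (U ?\<tau> - U ?\<sigma>)) = int (card (U ?\<tau>)) - int (card (U ?\<sigma>))"
      using U by (simp add: card_Diff_subset card_mono of_nat_diff)
    then have "sqfree (U ?\<tau> - U ?\<sigma>) \<in> monomials {1..n} (int (card (U ?\<tau>)) - int (card (U ?\<sigma>)))"
      using U by (auto simp: monomials_def)
    then show ?thesis by (intro homog_sign homog_single)
  qed
  then have "(bd taylor_complex i k l :: 'k mpoly) \<in> homog n (int (card (U ?\<tau>)) - int (card (U ?\<sigma>)))"
    unfolding bd_taylor by (intro homog_sum) auto
  then show ?thesis using k l by (simp add: shifts_taylor)
qed

lemma emb_bd:
  assumes \<sigma>: "\<sigma> \<in> faces (Suc i)"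
  shows "emb (Suc i) (bd_map taylor_complex i f) \<sigma> = simplicial_bd {..<r} (emb (Suc (Suc i)) f) \<sigma>"
proof -
  let ?k = "face_index (Suc i) \<sigma>" and ?M = "card (faces (Suc (Suc i)))"
  have k: "face (Suc i) ?k = \<sigma>" "?k < card (faces (Suc i))" using face_face_index[OF \<sigma>] by auto
  let ?s = "\<lambda>X. single (sqfree X) (1::'a)"
  let ?\<tau> = "face (Suc (Suc i))"
  have "emb (Suc i) (bd_map taylor_complex i f) \<sigma> =
      ?s (U \<sigma>) * (\<Sum>l<?M. (\<Sum>x\<in>{..<r} - \<sigma>. if ?\<tau> l = insert x \<sigma> then below_sign x \<sigma> * ?s (U (?\<tau> l) - U \<sigma>) else 0) * f l)"
    using \<sigma> k by (simp only: emb_def bd_map_def rank_taylor bd_taylor if_True)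
  also have "\<dots> = (\<Sum>l<?M. \<Sum>x\<in>{..<r} - \<sigma>. if ?\<tau> l = insert x \<sigma> then below_sign x \<sigma> * (?s (U \<sigma>) * ?s (U (?\<tau> l) - U \<sigma>)) * f l else 0)"
    unfolding sum_distrib_left sum_distrib_right by (intro sum.cong refl) (simp add: algebra_simps)
  also have "\<dots> = (\<Sum>x\<in>{..<r} - \<sigma>. \<Sum>l<?M. if ?\<tau> l = insert x \<sigma> then below_sign x \<sigma> * (?s (U \<sigma>) * ?s (U (?\<tau> l) - U \<sigma>)) * f l else 0)"
    by (rule sum.swap)
  also have "\<dots> = (\<Sum>x\<in>{..<r} - \<sigma>. below_sign x \<sigma> * emb (Suc (Suc i)) f (insert x \<sigma>))"
  proof (rule sum.cong)
    fix x assume x: "x \<in> {..<r} - \<sigma>"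
    have in2: "insert x \<sigma> \<in> faces (Suc (Suc i))" by (rule faces_insert[OF \<sigma> x])
    let ?l = "face_index (Suc (Suc i)) (insert x \<sigma>)"
    have l: "?\<tau> ?l = insert x \<sigma>" "?l < ?M" using face_face_index[OF in2] by auto
    have "(\<Sum>l<?M. if ?\<tau> l = insert x \<sigma> then below_sign x \<sigma> * (?s (U \<sigma>) * ?s (U (?\<tau> l) - U \<sigma>)) * f l else 0) =
        (\<Sum>l\<in>{?l}. if ?\<tau> l = insert x \<sigma> then below_sign x \<sigma> * (?s (U \<sigma>) * ?s (U (?\<tau> l) - U \<sigma>)) * f l else 0)"
    proof (rule sum.mono_neutral_right)
      show "\<forall>a\<in>{..<?M} - {?l}. (if ?\<tau> a = insert x \<sigma> then below_sign x \<sigma> * (?s (U \<sigma>) * ?s (U (?\<tau> a) - U \<sigma>)) * f a else 0) = 0"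
      proof
        fix a assume a: "a \<in> {..<?M} - {?l}"
        then have "?\<tau> a \<noteq> insert x \<sigma>" using face_index_face[of a "Suc (Suc i)"] by auto
        then show "(if ?\<tau> a = insert x \<sigma> then below_sign x \<sigma> * (?s (U \<sigma>) * ?s (U (?\<tau> a) - U \<sigma>)) * f a else 0) = 0" by simp
      qed
    qed (use l in auto)
    also have "\<dots> = below_sign x \<sigma> * (?s (U \<sigma>) * ?s (U (insert x \<sigma>) - U \<sigma>)) * f ?l" using l by simp
    also have "?s (U \<sigma>) * ?s (U (insert x \<sigma>) - U \<sigma>) = ?s (U (insert x \<sigma>))"
    proof -
      have fin: "finite (U \<sigma>)" "finite (U (insert x \<sigma>))" using faces_U[OF \<sigma>] faces_U[OF in2] by auto
      have "U \<sigma> \<union> (U (insert x \<sigma>) - U \<sigma>) = U (insert x \<sigma>)" by (auto simp: U_def)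
      then have "sqfree (U \<sigma>) + sqfree (U (insert x \<sigma>) - U \<sigma>) = sqfree (U (insert x \<sigma>))"
        using sqfree_Un[of "U \<sigma>" "U (insert x \<sigma>) - U \<sigma>"] fin by simp
      then show ?thesis by (simp add: mult_single)
    qed
    finally show "(\<Sum>l<?M. if ?\<tau> l = insert x \<sigma> then below_sign x \<sigma> * (?s (U \<sigma>) * ?s (U (?\<tau> l) - U \<sigma>)) * f l else 0) =
        below_sign x \<sigma> * emb (Suc (Suc i)) f (insert x \<sigma>)"
      using in2 by (simp add: emb_def algebra_simps)
  qed simp
  finally show ?thesis unfolding simplicial_bd_def .
qed

lemma faces_1: "faces 1 = (\<lambda>x. {x}) ` {..<r}"
  by (auto simp: faces_def card_1_singleton_iff)

lemma faces_0: "faces 0 = {{}}"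
  by (auto simp: faces_def card_eq_0_iff dest: finite_subset[OF _ finite_lessThan])

lemma aug_emb: "aug_map taylor_complex f = simplicial_bd {..<r} (emb 1 f) {}"
proof -
  have "aug_map taylor_complex f = (\<Sum>l<card (faces 1). single (sqfree (U (face 1 l))) 1 * f l)"
    unfolding aug_map_def rank_taylor aug_taylor by simp
  also have "\<dots> = (\<Sum>l\<in>{0..<card (faces 1)}. emb 1 f (face 1 l))"
    using face_in[of _ 1] face_index_face[of _ 1] by (intro sum.cong) (auto simp: emb_def simp del: One_nat_def)
  also have "\<dots> = (\<Sum>\<sigma>\<in>faces 1. emb 1 f \<sigma>)"
    by (rule sum.reindex_bij_betw[OF face_bij])
  also have "\<dots> = (\<Sum>x<r. emb 1 f {x})"
    unfolding faces_1 by (subst sum.reindex) (auto simp: inj_on_def)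
  finally show ?thesis by (simp add: simplicial_bd_def below_sign_def)
qed

definition first_divisor :: "monomial \<Rightarrow> nat \<Rightarrow> bool" where
  "first_divisor m j \<longleftrightarrow> j < r \<and> E j \<subseteq> keys m \<and> (\<forall>i<j. \<not> E i \<subseteq> keys m)"

text \<open>
Coefficientwise at a monomial \<open>m\<close>, only generators dividing \<open>m\<close> are involved, and the
contraction to the first of them applies; which one it is depends on \<open>m\<close>.
\<close>

definition contract :: "(nat set \<Rightarrow> 'k::field mpoly) \<Rightarrow> nat set \<Rightarrow> 'k mpoly" where
  "contract g \<tau> = (\<Sum>j\<in>\<tau>. restr (\<lambda>m. first_divisor m j) (g (\<tau> - {j})))"

lemma first_divisor_unique: "first_divisor m i \<Longrightarrow> first_divisor m j \<Longrightarrow> i = j"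
  unfolding first_divisor_def by (metis linorder_neqE_nat)

lemma first_divisor_exists:
  assumes "j < r" "E j \<subseteq> keys m"
  shows "\<exists>i. first_divisor m i"
proof -
  define i where "i = (LEAST i. i < r \<and> E i \<subseteq> keys m)"
  have "i < r \<and> E i \<subseteq> keys m" unfolding i_def by (rule LeastI[of _ j]) (use assms in simp)
  moreover have "\<not> E k \<subseteq> keys m" if "k < i" for k
  proof
    assume "E k \<subseteq> keys m"
    moreover have "k < r" using that \<open>i < r \<and> _\<close> by simp
    ultimately have "i \<le> k" unfolding i_def by (intro Least_le) simp
    then show False using that by simp
  qed
  ultimately show ?thesis unfolding first_divisor_def by blast
qed

lemma lookup_contract:
  assumes "finite \<tau>" "first_divisor m j"
  shows "lookup (contract g \<tau>) m = (if j \<in> \<tau> then lookup (g (\<tau> - {j})) m else 0)"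
proof -
  have "lookup (contract g \<tau>) m = (\<Sum>i\<in>\<tau>. if i = j then lookup (g (\<tau> - {j})) m else 0)"
    unfolding contract_def lookup_sum lookup_restr
    by (rule sum.cong) (use assms first_divisor_unique in auto)
  then show ?thesis using assms(1) by simp
qed

lemma contract_in:
  assumes g: "g \<in> lcm_chains k"
  shows "contract g \<in> lcm_chains (Suc k)"
  unfolding lcm_chains_def
proof (intro CollectI allI conjI impI ballI)
  fix \<tau>
  show "contract g \<tau> \<in> polys n" unfolding contract_def
    using g by (intro polys_sum polys_restr) (simp add: lcm_chains_def)
  have key: "\<exists>j\<in>\<tau>. first_divisor m j \<and> m \<in> keys (g (\<tau> - {j}))"
    if "m \<in> keys (contract g \<tau>)" for m
  proof -
    from that have "m \<in> (\<Union>j\<in>\<tau>. keys (restr (\<lambda>m. first_divisor m j) (g (\<tau> - {j}))))"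
      unfolding contract_def by (rule subsetD[OF Poly_Mapping.keys_sum])
    then show ?thesis by (auto simp: keys_restr)
  qed
  {
    assume "contract g \<tau> \<noteq> 0"
    then obtain m where "m \<in> keys (contract g \<tau>)" by fastforce
    from key[OF this] obtain j where j: "j \<in> \<tau>" "first_divisor m j" "m \<in> keys (g (\<tau> - {j}))" by blast
    then have "g (\<tau> - {j}) \<noteq> 0" by auto
    then have "\<tau> - {j} \<in> faces k" using g by (simp add: lcm_chains_def)
    moreover have "j < r" using j(2) by (simp add: first_divisor_def)
    ultimately have "insert j (\<tau> - {j}) \<in> faces (Suc k)" by (intro faces_insert) auto
    then show "\<tau> \<in> faces (Suc k)" using j(1) by (simp add: insert_absorb)
  }
  fix m assume "m \<in> keys (contract g \<tau>)"
  from key[OF this] obtain j where j: "j \<in> \<tau>" "first_divisor m j" "m \<in> keys (g (\<tau> - {j}))" by blast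
  then have "U (\<tau> - {j}) \<subseteq> keys m" using g by (auto simp: lcm_chains_def)
  moreover have "E j \<subseteq> keys m" using j(2) by (simp add: first_divisor_def)
  ultimately show "U \<tau> \<subseteq> keys m" unfolding U_def by blast
qed

text \<open>
At a monomial \<open>m\<close> a chain in \<open>lcm_chains\<close> is supported on sets of generators that divide \<open>m\<close>,
the first of which is least among the vertices in question.
\<close>

lemma simplicial_bd_contract:
  assumes g: "g \<in> lcm_chains k" and \<sigma>: "\<sigma> \<in> faces k"
    and div: "\<And>m. m \<in> keys (g \<sigma>) \<Longrightarrow> \<exists>j<r. E j \<subseteq> keys m"
    and cyc: "\<And>j. j \<in> \<sigma> \<Longrightarrow> simplicial_bd {..<r} g (\<sigma> - {j}) = 0"
  shows "simplicial_bd {..<r} (contract g) \<sigma> = g \<sigma>"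
proof (rule poly_mapping_eqI)
  fix m
  have f\<sigma>: "finite \<sigma>" "\<sigma> \<subseteq> {..<r}" using \<sigma> faces_finite[OF \<sigma>] by (simp_all add: faces_def)
  have look: "lookup (simplicial_bd {..<r} h \<tau>) m = simplicial_bd {..<r} (\<lambda>\<tau>. lookup (h \<tau>) m) \<tau>"
    for h :: "nat set \<Rightarrow> 'a mpoly" and \<tau>
    by (simp add: simplicial_bd_def lookup_sum lookup_sign_times)
  show "lookup (simplicial_bd {..<r} (contract g) \<sigma>) m = lookup (g \<sigma>) m"
  proof (cases "\<exists>j. first_divisor m j")
    case True
    then obtain j where j: "first_divisor m j" by blast
    let ?c = "\<lambda>\<tau>. lookup (g \<tau>) m"
    have "simplicial_bd {..<r} (\<lambda>\<tau>. lookup (contract g \<tau>) m) \<sigma> =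
        simplicial_bd {..<r} (\<lambda>\<tau>. if j \<in> \<tau> then ?c (\<tau> - {j}) else 0) \<sigma>"
      unfolding simplicial_bd_def
    proof (rule sum.cong)
      fix x
      have "finite (insert x \<sigma>)" using f\<sigma> by simp
      from lookup_contract[OF this j, of g]
      show "below_sign x \<sigma> * lookup (contract g (insert x \<sigma>)) m =
          below_sign x \<sigma> * (if j \<in> insert x \<sigma> then ?c (insert x \<sigma> - {j}) else 0)" by simp
    qed simp
    also have "\<dots> = ?c \<sigma>"
    proof (rule simplicial_contraction)
      show "j \<in> {..<r}" using j by (simp add: first_divisor_def)
      show "simplicial_bd {..<r} ?c (\<sigma> - {j}) = 0" if "j \<in> \<sigma>"
        using cyc[OF that] look[of g "\<sigma> - {j}"] by simp
      fix \<tau> x assume nz: "?c \<tau> \<noteq> 0" and x: "x \<in> \<tau>"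
      then have "m \<in> keys (g \<tau>)" by (simp add: in_keys_iff)
      then have "U \<tau> \<subseteq> keys m" using g by (simp add: lcm_chains_def)
      then have "E x \<subseteq> keys m" using x by (auto simp: U_def)
      then show "j \<le> x" using j unfolding first_divisor_def by (cases "x < j") auto
    qed (use f\<sigma> in simp_all)
    finally show ?thesis unfolding look .
  next
    case False
    have "m \<notin> keys (g \<sigma>)"
    proof
      assume "m \<in> keys (g \<sigma>)"
      from div[OF this] obtain j where "j < r" "E j \<subseteq> keys m" by blast
      from first_divisor_exists[OF this] False show False by contradiction
    qed
    moreover have "lookup (contract g \<tau>) m = 0" for \<tau>
      unfolding contract_def lookup_sum lookup_restr using False by (intro sum.neutral) auto
    ultimately show ?thesis unfolding look by (simp add: simplicial_bd_def in_keys_iff)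
  qed
qed

lemma lcm_chains_divisible:
  assumes "g \<in> lcm_chains (Suc k)" "m \<in> keys (g \<sigma>)"
  shows "\<exists>j<r. E j \<subseteq> keys m"
proof -
  have "g \<sigma> \<noteq> 0" using assms(2) by auto
  then have "\<sigma> \<in> faces (Suc k)" "U \<sigma> \<subseteq> keys m" using assms by (auto simp: lcm_chains_def)
  moreover from this have "\<sigma> \<noteq> {}" "\<sigma> \<subseteq> {..<r}" by (auto simp: faces_def)
  ultimately obtain j where "j \<in> \<sigma>" "\<sigma> \<subseteq> {..<r}" by blast
  then show ?thesis using \<open>U \<sigma> \<subseteq> _\<close> by (auto simp: U_def)
qed

lemma simplicial_bd_emb_zero:
  assumes "\<And>\<sigma>. \<sigma> \<in> faces (Suc i) \<Longrightarrow> h \<sigma> = simplicial_bd {..<r} c \<sigma>" and "\<sigma> \<in> faces i"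
  shows "simplicial_bd {..<r} h \<sigma> = 0"
proof -
  have "simplicial_bd {..<r} h \<sigma> = simplicial_bd {..<r} (simplicial_bd {..<r} c) \<sigma>"
    unfolding simplicial_bd_def[of _ h] simplicial_bd_def[of _ "simplicial_bd {..<r} c"]
    using assms faces_insert[OF assms(2)] by (intro sum.cong) auto
  then show ?thesis using simplicial_bd_bd[of "{..<r}" \<sigma> c] assms(2) by (simp add: faces_def)
qed

lemma bd_map_free:
  assumes f: "f \<in> free_module n taylor_complex (Suc i)"
  shows "bd_map taylor_complex i f \<in> free_module n taylor_complex i"
  unfolding free_module_def
proof (intro CollectI conjI allI impI)
  fix k assume k: "k < free_rank taylor_complex i"
  then show "bd_map taylor_complex i f k \<in> polys n"
    using f homog_polys[OF bd_taylor_homog[of k i]]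
    by (auto simp: bd_map_def free_module_def rank_taylor intro!: polys_sum polys_mult)
qed (simp add: bd_map_def)

lemma remove_in_faces: "\<sigma> \<in> faces (Suc k) \<Longrightarrow> j \<in> \<sigma> \<Longrightarrow> \<sigma> - {j} \<in> faces k"
  using faces_finite[of \<sigma> "Suc k"] by (auto simp: faces_def)

text \<open>
Exactness is read off from the simplicial boundary: a cycle is the boundary of its contraction, and
both stay within \<open>lcm_chains\<close>.  The image of the augmentation is the case of the empty face.
\<close>

theorem taylor_resolution:
  "graded_free_resolution n {p \<in> polys n. \<forall>m\<in>keys p. \<exists>j<r. E j \<subseteq> keys m}
     (taylor_complex :: 'k::field mpoly free_complex)"
  unfolding graded_free_resolution_def
proof (intro conjI allI impI)
  let ?F = "taylor_complex :: 'k mpoly free_complex"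
  let ?I = "{p \<in> polys n. \<forall>m\<in>keys p. \<exists>j<r. E j \<subseteq> keys m} :: 'k mpoly set"
  show "aug ?F l \<in> homog n (shifts ?F 0 ! l)" if "l < free_rank ?F 0" for l
    using that aug_taylor_homog[of l] by (simp add: rank_taylor)
  show "bd ?F i k l \<in> homog n (shifts ?F (Suc i) ! l - shifts ?F i ! k)"
    if "k < free_rank ?F i" "l < free_rank ?F (Suc i)" for i k l
    using that bd_taylor_homog[of k i l] by (simp add: rank_taylor)
  have lift: "\<exists>h\<in>free_module n ?F (Suc i). bd_map ?F i h = f"
    if f: "f \<in> free_module n ?F i" and cyc: "\<And>\<sigma>. \<sigma> \<in> faces i \<Longrightarrow> simplicial_bd {..<r} (emb (Suc i) f) \<sigma> = 0" for i f
  proof -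
    let ?g = "emb (Suc i) f"
    have g: "?g \<in> lcm_chains (Suc i)" by (rule emb_in[OF f])
    obtain h where h: "h \<in> free_module n ?F (Suc i)" "emb (Suc (Suc i)) h = contract ?g"
      using emb_surj[OF contract_in[OF g]] by blast
    have "bd_map ?F i h = f"
    proof (rule emb_inj[OF bd_map_free[OF h(1)] f])
      fix \<sigma> assume \<sigma>: "\<sigma> \<in> faces (Suc i)"
      have "simplicial_bd {..<r} (contract ?g) \<sigma> = ?g \<sigma>"
        by (rule simplicial_bd_contract[OF g \<sigma>]) (use lcm_chains_divisible[OF g] cyc remove_in_faces[OF \<sigma>] in auto)
      then show "emb (Suc i) (bd_map ?F i h) \<sigma> = emb (Suc i) f \<sigma>"
        unfolding emb_bd[OF \<sigma>] h(2) .
    qed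
    then show ?thesis using h(1) by blast
  qed
  show "aug_map ?F ` free_module n ?F 0 = ?I"
  proof (intro equalityI subsetI)
    fix p assume "p \<in> aug_map ?F ` free_module n ?F 0"
    then obtain f where f: "f \<in> free_module n ?F 0" "p = aug_map ?F f" by blast
    have g: "emb 1 f \<in> lcm_chains 1" using emb_in[OF f(1)] by simp
    have p: "p = (\<Sum>x<r. emb 1 f {x})" unfolding f(2) aug_emb by (simp add: simplicial_bd_def below_sign_def)
    have "p \<in> polys n" unfolding p using g by (intro polys_sum) (simp add: lcm_chains_def)
    moreover have "\<exists>j<r. E j \<subseteq> keys m" if "m \<in> keys p" for m
    proof -
      have "m \<in> (\<Union>x\<in>{..<r}. keys (emb 1 f {x}))"
        using that unfolding p by (rule subsetD[OF Poly_Mapping.keys_sum])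
      then show ?thesis using lcm_chains_divisible[of "emb 1 f" 0] g by auto
    qed
    ultimately show "p \<in> ?I" by blast
  next
    fix p assume p: "p \<in> ?I"
    define g where "g = (\<lambda>\<sigma>::nat set. if \<sigma> = {} then p else 0)"
    have g: "g \<in> lcm_chains 0" using p by (auto simp: lcm_chains_def g_def faces_0 U_def)
    obtain f where f: "f \<in> free_module n ?F 0" "emb (Suc 0) f = contract g"
      using emb_surj[OF contract_in[OF g]] by blast
    have "simplicial_bd {..<r} (contract g) {} = g {}"
      by (rule simplicial_bd_contract[OF g]) (use p in \<open>auto simp: faces_0 g_def\<close>)
    then have "aug_map ?F f = p" unfolding aug_emb One_nat_def f(2) by (simp add: g_def)
    then show "p \<in> aug_map ?F ` free_module n ?F 0" using f(1) by blast
  qed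
  show "{f \<in> free_module n ?F 0. aug_map ?F f = 0} = bd_map ?F 0 ` free_module n ?F 1"
  proof (intro equalityI subsetI)
    fix f assume "f \<in> {f \<in> free_module n ?F 0. aug_map ?F f = 0}"
    then have f: "f \<in> free_module n ?F 0" "aug_map ?F f = 0" by auto
    from lift[OF f(1)] f(2) show "f \<in> bd_map ?F 0 ` free_module n ?F 1"
      unfolding aug_emb faces_0 One_nat_def by blast
  next
    fix f assume "f \<in> bd_map ?F 0 ` free_module n ?F 1"
    then obtain h where h: "h \<in> free_module n ?F (Suc 0)" "f = bd_map ?F 0 h" by auto
    have "simplicial_bd {..<r} (emb (Suc 0) f) {} = 0"
      by (rule simplicial_bd_emb_zero[of 0 _ "emb (Suc (Suc 0)) h"]) (use emb_bd[of _ 0 h] h(2) in \<open>auto simp: faces_0\<close>)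
    then show "f \<in> {f \<in> free_module n ?F 0. aug_map ?F f = 0}"
      using bd_map_free[OF h(1)] h(2) by (simp add: aug_emb)
  qed
  show "{f \<in> free_module n ?F (Suc i). bd_map ?F i f = 0} = bd_map ?F (Suc i) ` free_module n ?F (Suc (Suc i))" for i
  proof (intro equalityI subsetI)
    fix f assume "f \<in> {f \<in> free_module n ?F (Suc i). bd_map ?F i f = 0}"
    then have f: "f \<in> free_module n ?F (Suc i)" "bd_map ?F i f = 0" by auto
    have "simplicial_bd {..<r} (emb (Suc (Suc i)) f) \<sigma> = 0" if "\<sigma> \<in> faces (Suc i)" for \<sigma>
      using emb_bd[OF that, of f] f(2) by (simp add: emb_def zero_fun_def split: if_splits)
    from lift[OF f(1) this] show "f \<in> bd_map ?F (Suc i) ` free_module n ?F (Suc (Suc i))" by blast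
  next
    fix f assume "f \<in> bd_map ?F (Suc i) ` free_module n ?F (Suc (Suc i))"
    then obtain h where h: "h \<in> free_module n ?F (Suc (Suc i))" "f = bd_map ?F (Suc i) h" by auto
    have fr: "f \<in> free_module n ?F (Suc i)" unfolding h(2) by (rule bd_map_free[OF h(1)])
    have "bd_map ?F i f = (\<lambda>_. 0)"
    proof (rule emb_inj[OF bd_map_free[OF fr]])
      show "(\<lambda>_. 0) \<in> free_module n ?F i" by (simp add: free_module_def)
      fix \<sigma> assume \<sigma>: "\<sigma> \<in> faces (Suc i)"
      have "simplicial_bd {..<r} (emb (Suc (Suc i)) f) \<sigma> = 0"
        by (rule simplicial_bd_emb_zero[OF _ \<sigma>, of _ "emb (Suc (Suc (Suc i))) h"]) (use emb_bd[of _ "Suc i" h] h(2) in auto)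
      then show "emb (Suc i) (bd_map ?F i f) \<sigma> = emb (Suc i) (\<lambda>_. 0) \<sigma>"
        unfolding emb_bd[OF \<sigma>] by (simp add: emb_def)
    qed
    then show "f \<in> {f \<in> free_module n ?F (Suc i). bd_map ?F i f = 0}" using fr by (simp add: zero_fun_def)
  qed
  show "\<exists>N. \<forall>i\<ge>N. free_rank ?F i = 0"
  proof (intro exI[of _ r] allI impI)
    fix i assume "r \<le> i"
    have False if "\<sigma> \<in> faces (Suc i)" for \<sigma>
    proof -
      have "card \<sigma> \<le> card {..<r}" using that by (intro card_mono) (auto simp: faces_def)
      then show False using that \<open>r \<le> i\<close> by (simp add: faces_def)
    qed
    then have "faces (Suc i) = {}" by blast
    then show "free_rank ?F i = 0" by (simp add: rank_taylor)
  qed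
qed

end

theorem squarefree_ideal_has_resolution:
  assumes "finite W" "\<And>X. X \<in> W \<Longrightarrow> X \<subseteq> {1..n}"
  shows "\<exists>F. graded_free_resolution n (monomial_ideal n (sqfree ` W) :: 'k::field mpoly set) F"
proof -
  obtain h where h: "bij_betw h {0..<card W} W" using ex_bij_betw_nat_finite[OF assms(1)] by blast
  interpret taylor n "card W" h
  proof
    fix j assume "j < card W"
    then have "h j \<in> W" using h by (auto simp: bij_betw_def)
    then show "h j \<subseteq> {1..n}" by (rule assms(2))
  qed
  have "divisible W m \<longleftrightarrow> (\<exists>j<card W. h j \<subseteq> keys m)" for m
  proof -
    have "W = h ` {..<card W}" using h by (simp add: bij_betw_def atLeast0LessThan)
    then have "divisible W m \<longleftrightarrow> (\<exists>X\<in>h ` {..<card W}. X \<subseteq> keys m)" unfolding divisible_def by simp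
    then show ?thesis by auto
  qed
  then have "(monomial_ideal n (sqfree ` W) :: 'k mpoly set) =
      {p \<in> polys n. \<forall>m\<in>keys p. \<exists>j<card W. h j \<subseteq> keys m}"
    using monomial_ideal_eq[of W n] assms(2) by (simp add: Sup_le_iff)
  then show ?thesis using taylor_resolution[where 'k='k] by auto
qed

section \<open>Linear syzygies connect the generators\<close>

lemma lookup_times_sqfree:
  assumes "finite M" "finite X"
  shows "lookup ((c::'k::field mpoly) * single (sqfree X) 1) (sqfree M) =
    (if X \<subseteq> M then lookup c (sqfree (M - X)) else 0)"
proof (cases "X \<subseteq> M")
  case True
  have "sqfree M = sqfree X + sqfree (M - X)"
    using sqfree_Un[of X "M - X"] True assms finite_subset[of "M - X" M] by (simp add: Un_absorb1)
  then have "lookup (single (sqfree X) 1 * c) (sqfree M) = 1 * lookup c (sqfree (M - X))"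
    by (simp only: lookup_single_times_add)
  then show ?thesis using True by (simp add: mult.commute[of c])
next
  case False
  have "\<not> (\<exists>b. sqfree M = sqfree X + b)"
  proof
    assume "\<exists>b. sqfree M = sqfree X + b"
    then obtain b where "sqfree M = sqfree X + b" by blast
    then have "keys (sqfree M) = keys (sqfree X) \<union> keys b"
      by (simp only: keys_add_monomial)
    then show False using False assms by auto
  qed
  then show ?thesis using False by (simp add: mult.commute[of c] lookup_single_times)
qed

text \<open>
Each term of \<open>p\<close> is divided by one generator of the ideal that divides it.
\<close>

lemma ideal_element_combination:
  assumes W: "finite W" "\<And>X. X \<in> W \<Longrightarrow> X \<subseteq> {1..n} \<and> card X = d"
    and p: "p \<in> monomial_ideal n (sqfree ` W)" "(p :: 'k::field mpoly) \<in> homog n e"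
  shows "\<exists>a. (\<forall>X\<in>W. a X \<in> homog n (e - int d)) \<and> p = (\<Sum>X\<in>W. a X * single (sqfree X) 1)"
proof -
  have fin: "finite X" if "X \<in> W" for X using W(2)[OF that] finite_subset by blast
  have dv: "\<forall>m\<in>keys p. divisible W m"
    using p(1) monomial_ideal_eq[of W n, where 'k='k] W(2) by blast
  then have "\<forall>m\<in>keys p. \<exists>X. X \<in> W \<and> X \<subseteq> keys m" unfolding divisible_def by blast
  then obtain c where c: "\<forall>m\<in>keys p. c m \<in> W \<and> c m \<subseteq> keys m" by (rule bchoice[THEN exE])
  let ?K = "\<lambda>X. {m \<in> keys p. c m = X}"
  define a where "a = (\<lambda>X. \<Sum>m\<in>?K X. single (m - sqfree X) (lookup p m))"
  have quot: "(m - sqfree X) + sqfree X = m" if "X \<in> W" "m \<in> ?K X" for X m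
    using subset_keys_imp_add[of X m] fin[OF that(1)] c that(2) by auto
  have "a X \<in> homog n (e - int d)" if X: "X \<in> W" for X
    unfolding a_def
  proof (intro homog_sum homog_single)
    fix m assume m: "m \<in> ?K X"
    have "m \<in> monomials {1..n} e" using p(2) m unfolding homog_iff by blast
    moreover have "mdeg m = mdeg (m - sqfree X) + d"
      using mdeg_add[of "m - sqfree X" "sqfree X"] quot[OF X m] fin[OF X] W(2)[OF X] by simp
    moreover have "keys (m - sqfree X) \<subseteq> keys m"
      using keys_add_monomial[of "m - sqfree X" "sqfree X"] quot[OF X m] by auto
    ultimately show "m - sqfree X \<in> monomials {1..n} (e - int d)" by (auto simp: monomials_def)
  qed
  moreover have "p = (\<Sum>X\<in>W. a X * single (sqfree X) 1)"
  proof -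
    have "(\<Sum>X\<in>W. a X * single (sqfree X) 1) = (\<Sum>X\<in>W. \<Sum>m\<in>?K X. single m (lookup p m))"
    proof (rule sum.cong)
      fix X assume X: "X \<in> W"
      show "a X * single (sqfree X) 1 = (\<Sum>m\<in>?K X. single m (lookup p m))"
        unfolding a_def sum_distrib_right
      proof (rule sum.cong)
        fix m assume m: "m \<in> ?K X"
        show "single (m - sqfree X) (lookup p m) * single (sqfree X) 1 = single m (lookup p m)"
          using quot[OF X m] by (simp add: mult_single)
      qed simp
    qed simp
    also have "\<dots> = (\<Sum>m\<in>keys p. single m (lookup p m))"
      using c by (intro sum.group W(1)) auto
    finally show ?thesis by (simp add: poly_expand)
  qed
  ultimately show ?thesis by blast
qed

text \<open>
A functional on the syzygies \<open>\<sigma>\<close> of the generators: the part coming from the generators in \<open>\<A>\<close>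
of the coefficient of the monomial \<open>M\<close> in \<open>\<Sum> \<sigma> X * X\<close>.
\<close>

definition split_functional :: "nat set set \<Rightarrow> nat set \<Rightarrow> (nat set \<Rightarrow> 'k::field mpoly) \<Rightarrow> 'k" where
  "split_functional \<A> M \<sigma> = (\<Sum>X\<in>{X\<in>\<A>. X \<subseteq> M}. lookup (\<sigma> X) (sqfree (M - X)))"

text \<open>
If \<open>g\<close> is a nonconstant monomial, only \<open>M\<close> divided by \<open>g\<close> matters.  By \<open>sep\<close> the generators dividing
this quotient all lie in \<open>\<A>\<close> or all in \<open>\<B>\<close>: the functional sees either the full coefficient of a
syzygy, which is 0, or an empty sum.  Hence it vanishes on syzygies that are multiples of
syzygies of smaller degree.
\<close>

lemma split_functional_times_syzygy:
  fixes \<tau> :: "nat set \<Rightarrow> 'k::field mpoly"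
  assumes fin: "finite M" "finite \<A>" "finite \<B>" "\<And>X. X \<in> \<A> \<union> \<B> \<Longrightarrow> finite X" and disj: "\<A> \<inter> \<B> = {}"
    and syz: "(\<Sum>X\<in>\<A> \<union> \<B>. \<tau> X * single (sqfree X) 1) = 0"
    and sep: "\<And>N X Y. N \<subset> M \<Longrightarrow> X \<in> \<A> \<Longrightarrow> Y \<in> \<B> \<Longrightarrow> X \<subseteq> N \<Longrightarrow> Y \<subseteq> N \<Longrightarrow> False"
  shows "split_functional \<A> M (\<lambda>X. g * \<tau> X) = lookup g 0 * split_functional \<A> M \<tau>"
proof -
  have mono: "split_functional \<A> M (\<lambda>X. single \<mu> c * \<tau> X) = (if \<mu> = 0 then c * split_functional \<A> M \<tau> else 0)" for \<mu> c
  proof (cases "\<mu> = 0")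
    case True
    then show ?thesis using lookup_single_times_add[of 0 c]
      by (simp add: split_functional_def sum_distrib_left)
  next
    case nz: False
    let ?N = "keys \<mu>"
    show ?thesis
    proof (cases "\<mu> = sqfree ?N \<and> ?N \<subseteq> M")
      case False
      have "lookup (single \<mu> c * \<tau> X) (sqfree (M - X)) = 0" for X
      proof -
        have "\<not> (\<exists>b. sqfree (M - X) = \<mu> + b)"
        proof
          assume "\<exists>b. sqfree (M - X) = \<mu> + b"
          then obtain b where b: "sqfree (M - X) = \<mu> + b" by blast
          have le: "lookup \<mu> i \<le> (if i \<in> M - X then 1 else 0)" for i
            using arg_cong[OF b, of "\<lambda>m. lookup m i"] fin(1) by (simp add: lookup_add lookup_sqfree)
          have "\<mu> = sqfree ?N"
          proof (rule poly_mapping_eqI)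
            fix i show "lookup \<mu> i = lookup (sqfree ?N) i"
              using le[of i] by (auto simp: lookup_sqfree in_keys_iff split: if_splits)
          qed
          moreover have "?N \<subseteq> M"
          proof
            fix i assume "i \<in> ?N"
            then show "i \<in> M" using le[of i] by (auto simp: in_keys_iff split: if_splits)
          qed
          ultimately show False using False by blast
        qed
        then show ?thesis by (simp add: lookup_single_times)
      qed
      then show ?thesis using nz by (simp add: split_functional_def)
    next
      case True
      then have \<mu>: "\<mu> = sqfree ?N" "?N \<subseteq> M" by auto
      have ne: "?N \<noteq> {}" using nz by simp
      let ?M = "M - ?N"
      have psub: "?M \<subset> M" using \<mu>(2) ne by blast
      have look: "lookup (single \<mu> c * \<tau> X) (sqfree (M - X)) =
          (if X \<subseteq> ?M then c * lookup (\<tau> X) (sqfree (?M - X)) else 0)" if X: "X \<subseteq> M" for X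
      proof (cases "X \<subseteq> ?M")
        case True
        then have "M - X = ?N \<union> (?M - X)" using \<mu>(2) by blast
        then have "sqfree (M - X) = sqfree ?N + sqfree (?M - X)" using fin(1) sqfree_Un[of ?N "?M - X"] by auto
        then have "sqfree (M - X) = \<mu> + sqfree (?M - X)" using \<mu>(1) by simp
        then show ?thesis using True by simp
      next
        case False
        have "\<not> (\<exists>b. sqfree (M - X) = \<mu> + b)"
        proof
          assume "\<exists>b. sqfree (M - X) = \<mu> + b"
          then obtain b where "sqfree (M - X) = \<mu> + b" by blast
          then have "keys (sqfree (M - X)) = ?N \<union> keys b" by (simp only: keys_add_monomial)
          then have "?N \<subseteq> M - X" using fin(1) by auto
          then show False using False X by blast
        qed
        then show ?thesis using False by (simp add: lookup_single_times)
      qed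
      have "split_functional \<A> M (\<lambda>X. single \<mu> c * \<tau> X) =
          (\<Sum>X\<in>{X\<in>\<A>. X \<subseteq> M}. if X \<subseteq> ?M then c * lookup (\<tau> X) (sqfree (?M - X)) else 0)"
        unfolding split_functional_def by (rule sum.cong) (use look in auto)
      also have "\<dots> = (\<Sum>X\<in>{X\<in>\<A>. X \<subseteq> ?M}. c * lookup (\<tau> X) (sqfree (?M - X)))"
        by (rule sum.mono_neutral_cong_right) (use fin(2) in auto)
      also have "\<dots> = 0"
      proof (cases "\<exists>Y\<in>\<B>. Y \<subseteq> ?M")
        case True
        then have "{X\<in>\<A>. X \<subseteq> ?M} = {}" using sep[OF psub] by blast
        then show ?thesis by (simp only: sum.empty)
      next
        case False
        have "0 = lookup (\<Sum>X\<in>\<A> \<union> \<B>. \<tau> X * single (sqfree X) 1) (sqfree ?M)"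
          unfolding syz by simp
        also have "\<dots> = (\<Sum>X\<in>\<A> \<union> \<B>. if X \<subseteq> ?M then lookup (\<tau> X) (sqfree (?M - X)) else 0)"
          unfolding lookup_sum
        proof (rule sum.cong)
          fix X assume "X \<in> \<A> \<union> \<B>"
          then have "finite X" by (rule fin(4))
          then show "lookup (\<tau> X * single (sqfree X) 1) (sqfree ?M) =
              (if X \<subseteq> ?M then lookup (\<tau> X) (sqfree (?M - X)) else 0)"
            by (rule lookup_times_sqfree[rotated]) (use fin(1) in simp)
        qed simp
        also have "\<dots> = (\<Sum>X\<in>{X\<in>\<A>. X \<subseteq> ?M}. lookup (\<tau> X) (sqfree (?M - X)))"
          by (rule sum.mono_neutral_cong_right) (use fin(2,3) False in auto)
        finally show ?thesis by (simp add: sum_distrib_left[symmetric])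
      qed
      finally show ?thesis using nz by simp
    qed
  qed
  have "g * \<tau> X = (\<Sum>m\<in>keys g. single m (lookup g m) * \<tau> X)" for X
    by (subst poly_expand[of g, symmetric]) (simp only: sum_distrib_right)
  then have "split_functional \<A> M (\<lambda>X. g * \<tau> X) =
      (\<Sum>m\<in>keys g. split_functional \<A> M (\<lambda>X. single m (lookup g m) * \<tau> X))"
    unfolding split_functional_def lookup_sum by (simp only: lookup_sum) (rule sum.swap)
  also have "\<dots> = (\<Sum>m\<in>keys g. if m = 0 then lookup g 0 * split_functional \<A> M \<tau> else 0)"
    unfolding mono by (rule sum.cong) auto
  also have "\<dots> = lookup g 0 * split_functional \<A> M \<tau>"
    by (simp add: in_keys_iff)
  finally show ?thesis .
qed

lemma split_functional_sum:
  "split_functional \<A> M (\<lambda>X. \<Sum>l\<in>A. \<sigma> l X) = (\<Sum>l\<in>A. split_functional \<A> M (\<sigma> l))"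
  unfolding split_functional_def lookup_sum by (rule sum.swap)

lemma homog_0_const:
  assumes "p \<in> homog n 0"
  shows "p = single 0 (lookup p 0)"
proof (rule poly_mapping_eqI)
  fix m
  show "lookup p m = lookup (single 0 (lookup p 0)) m"
  proof (cases "m \<in> keys p")
    case True
    then have "mdeg m = 0" using assms by (auto simp: homog_def)
    then show ?thesis by (simp add: mdeg_eq_0_iff)
  next
    case False
    then show ?thesis by (auto simp: in_keys_iff lookup_single when_def)
  qed
qed

text \<open>
Take \<open>P\<close> and \<open>Q\<close> with smallest union \<open>M\<close> for which the claim fails.  The syzygy
$(M/P)\,e_P - (M/Q)\,e_Q$ has degree \<open>card M > d + 1\<close>, and the split functional is 1 on it.  On the
other hand, lifted to $F_0$ it is the image of an element \<open>g\<close> of $F_1$ of degree \<open>card M\<close>.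
By \<open>split_functional_times_syzygy\<close> the functional only depends on the constant coefficients of
\<open>g\<close>.  They form a cycle in \<open>F \<otimes> K\<close>, which is a boundary as the homology vanishes in this degree,
and on boundaries the functional is zero.
\<close>

theorem linear_syzygies_connect:
  fixes F :: "'k::field mpoly free_complex"
  assumes fin: "finite \<A>" "finite \<B>" and disj: "\<A> \<inter> \<B> = {}"
    and W: "\<And>X. X \<in> \<A> \<union> \<B> \<Longrightarrow> X \<subseteq> {1..n} \<and> card X = d"
    and R: "graded_free_resolution n (monomial_ideal n (sqfree ` (\<A> \<union> \<B>))) F"
    and lin: "\<And>j. j \<noteq> int d + 1 \<Longrightarrow> homology_dim F 1 j = 0"
    and "P \<in> \<A>" "Q \<in> \<B>"
  shows "\<exists>P'\<in>\<A>. \<exists>Q'\<in>\<B>. P' \<union> Q' \<subseteq> P \<union> Q \<and> card (P' \<union> Q') = Suc d"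
  using assms(7,8)
proof (induction "card (P \<union> Q)" arbitrary: P Q rule: less_induct)
  case less
  show ?case
  proof (rule ccontr)
    assume none: "\<not> ?thesis"
    let ?W = "\<A> \<union> \<B>"
    let ?I = "monomial_ideal n (sqfree ` ?W) :: 'k mpoly set"
    let ?x = "\<lambda>X. single (sqfree X) (1::'k)"
    define M where "M = P \<union> Q"
    have finX: "finite X" if "X \<in> ?W" for X using W[OF that] finite_subset by blast
    have fW: "finite ?W" using fin by simp
    have PQ: "P \<in> ?W" "Q \<in> ?W" using less.prems by auto
    have fPQ: "finite P" "finite Q" "finite M" using finX PQ by (auto simp: M_def)
    have MN: "M \<subseteq> {1..n}" using W[OF PQ(1)] W[OF PQ(2)] by (simp add: M_def)
    have PneQ: "P \<noteq> Q" using less.prems disj by blast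
    have sep: False if "N \<subset> M" "X \<in> \<A>" "Y \<in> \<B>" "X \<subseteq> N" "Y \<subseteq> N" for N X Y
    proof -
      have sub: "X \<union> Y \<subset> P \<union> Q" using that M_def by blast
      have "card (X \<union> Y) < card (P \<union> Q)" by (rule psubset_card_mono[OF _ sub]) (use fPQ in simp)
      from less.hyps[OF this that(2,3)] none sub show False by blast
    qed
    define e where "e = int (card M)"
    have P_psub: "P \<subset> M" "Q \<subset> M"
      using PneQ card_subset_eq[OF fPQ(2), of P] card_subset_eq[OF fPQ(1), of Q] W[OF PQ(1)] W[OF PQ(2)]
      by (auto simp: M_def)
    have e_ne: "e \<noteq> int d + 1"
    proof
      assume "e = int d + 1"
      then have "card (P \<union> Q) = Suc d" by (simp add: e_def M_def)
      then show False using none less.prems by blast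
    qed

    have "\<exists>a. (\<forall>X\<in>?W. a X \<in> homog n (shifts F 0 ! l - int d)) \<and> aug F l = (\<Sum>X\<in>?W. a X * ?x X)"
      if l: "l < free_rank F 0" for l
    proof (rule ideal_element_combination[OF fW W])
      let ?u = "\<lambda>k. if k = l then 1 else 0 :: 'k mpoly"
      have "?u \<in> free_module n F 0" using l by (auto simp: free_module_def polys_def)
      then have "aug_map F ?u \<in> ?I" using resolution_image_aug[OF R] by blast
      moreover have "aug_map F ?u = aug F l"
        unfolding aug_map_def using l by (simp add: if_distrib cong: if_cong)
      ultimately show "aug F l \<in> ?I" by simp
      show "aug F l \<in> homog n (shifts F 0 ! l)" by (rule resolution_aug_homog[OF R l])
    qed
    then have "\<forall>l\<in>{..<free_rank F 0}. \<exists>a. (\<forall>X\<in>?W. a X \<in> homog n (shifts F 0 ! l - int d)) \<and> aug F l = (\<Sum>X\<in>?W. a X * ?x X)"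
      by blast
    then obtain a where a: "\<forall>l\<in>{..<free_rank F 0}. (\<forall>X\<in>?W. a l X \<in> homog n (shifts F 0 ! l - int d)) \<and> aug F l = (\<Sum>X\<in>?W. a l X * ?x X)"
      by (rule bchoice[THEN exE])
    \<comment> \<open>A lift of the augmentation to the free module on the generators: \<open>\<phi> f\<close> has the coordinates of
      \<open>aug_map F f\<close> in terms of the generators.\<close>
    define \<phi> where "\<phi> = (\<lambda>(f :: nat \<Rightarrow> 'k mpoly) X. \<Sum>l<free_rank F 0. f l * a l X)"
    have \<phi>_aug: "(\<Sum>X\<in>?W. \<phi> f X * ?x X) = aug_map F f" for f
    proof -
      have "(\<Sum>X\<in>?W. \<phi> f X * ?x X) = (\<Sum>X\<in>?W. \<Sum>l<free_rank F 0. f l * (a l X * ?x X))"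
        by (simp add: \<phi>_def sum_distrib_right mult.assoc)
      also have "\<dots> = (\<Sum>l<free_rank F 0. f l * (\<Sum>X\<in>?W. a l X * ?x X))"
        unfolding sum_distrib_left by (rule sum.swap)
      also have "\<dots> = aug_map F f"
        unfolding aug_map_def by (rule sum.cong) (use a in \<open>auto simp: mult.commute\<close>)
      finally show ?thesis .
    qed

    have gen: "\<exists>f\<in>degree_piece n F 0 (int d). aug_map F f = ?x X" if X: "X \<in> ?W" for X
    proof -
      have "?x X \<in> homog n (int d)"
        using W[OF X] finX[OF X] by (intro homog_single) (simp add: monomials_def)
      moreover have "?x X \<in> ?I"
      proof -
        have "?I = {p \<in> polys n. \<forall>m\<in>keys p. divisible ?W m}"
          by (rule monomial_ideal_eq) (use W in blast)
        moreover have "?x X \<in> polys n" using W[OF X] finX[OF X] by (intro polys_single) simp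
        moreover have "divisible ?W (sqfree X)" using X finX[OF X] by (auto simp: divisible_def)
        ultimately show ?thesis by simp
      qed
      ultimately have "?x X \<in> aug_map F ` degree_piece n F 0 (int d)"
        using aug_map_degree_piece[OF R, of "int d"] by simp
      then show ?thesis by auto
    qed
    \<comment> \<open>The coordinates of a generator have degree 0 and are constant; distinct monomials are independent.\<close>
    have \<phi>_gen: "\<phi> f X = (if X = Y then 1 else 0)"
      if f: "f \<in> degree_piece n F 0 (int d)" "aug_map F f = ?x Y" and Y: "Y \<in> ?W" and X: "X \<in> ?W" for f X Y
    proof -
      have h: "\<phi> f Z = single 0 (lookup (\<phi> f Z) 0)" if Z: "Z \<in> ?W" for Z
      proof (rule homog_0_const[of _ n])
        show "\<phi> f Z \<in> homog n 0" unfolding \<phi>_def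
        proof (rule homog_sum)
          fix l assume l: "l \<in> {..<free_rank F 0}"
          have "f l \<in> homog n (int d - shifts F 0 ! l)" using f(1) l by (simp add: degree_piece_def)
          moreover have "a l Z \<in> homog n (shifts F 0 ! l - int d)" using a l Z by blast
          ultimately show "f l * a l Z \<in> homog n 0" by (rule homog_mult) simp
        qed
      qed
      have eqXY: "sqfree Y = sqfree X \<longleftrightarrow> X = Y" using sqfree_inj[OF finX[OF Y] finX[OF X]] by blast
      have "lookup (?x Y) (sqfree X) = lookup (\<Sum>Z\<in>?W. \<phi> f Z * ?x Z) (sqfree X)"
        unfolding \<phi>_aug f(2) ..
      also have "\<dots> = (\<Sum>Z\<in>?W. if Z = X then lookup (\<phi> f X) 0 else 0)"
        unfolding lookup_sum
      proof (rule sum.cong)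
        fix Z assume Z: "Z \<in> ?W"
        have "\<phi> f Z * ?x Z = single (sqfree Z) (lookup (\<phi> f Z) 0)"
          by (subst h[OF Z]) (simp add: mult_single)
        then show "lookup (\<phi> f Z * ?x Z) (sqfree X) = (if Z = X then lookup (\<phi> f X) 0 else 0)"
          using sqfree_inj[OF finX[OF Z] finX[OF X]] by (auto simp: lookup_single when_def)
      qed simp
      also have "\<dots> = lookup (\<phi> f X) 0" using X fW by simp
      finally have "lookup (\<phi> f X) 0 = (if X = Y then 1 else 0)"
        using eqXY by (simp add: lookup_single when_def)
      then show ?thesis using h[OF X] by simp
    qed
    obtain fP where fP: "fP \<in> degree_piece n F 0 (int d)" "aug_map F fP = ?x P" using gen[OF PQ(1)] by blast
    obtain fQ where fQ: "fQ \<in> degree_piece n F 0 (int d)" "aug_map F fQ = ?x Q" using gen[OF PQ(2)] by blast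
    \<comment> \<open>The syzygy between \<open>P\<close> and \<open>Q\<close>, lifted to the resolution.\<close>
    define z where "z = (\<lambda>k. ?x (M - P) * fP k - ?x (M - Q) * fQ k)"
    have shift: "?x (M - X) * f k \<in> homog n (e - shifts F 0 ! k)"
      if "X \<subseteq> M" "X \<in> ?W" "f \<in> degree_piece n F 0 (int d)" "k < free_rank F 0" for X f k
    proof (rule homog_mult)
      have "card (M - X) = card M - d" using card_Diff_subset[OF finX[OF that(2)] that(1)] W[OF that(2)] by simp
      moreover have "d \<le> card M" using card_mono[OF fPQ(3) that(1)] W[OF that(2)] by simp
      ultimately have c: "int (card (M - X)) = e - int d" by (simp add: e_def)
      have "finite (M - X)" "M - X \<subseteq> {1..n}" using fPQ(3) MN by auto
      then have "sqfree (M - X) \<in> monomials {1..n} (e - int d)" using c by (simp add: monomials_def)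
      then show "?x (M - X) \<in> homog n (e - int d)" by (rule homog_single)
      show "f k \<in> homog n (int d - shifts F 0 ! k)" using that by (simp add: degree_piece_def)
    qed simp
    have zk: "z k \<in> homog n (e - shifts F 0 ! k)" if "k < free_rank F 0" for k
      unfolding z_def using shift[of P fP k] shift[of Q fQ k] PQ fP(1) fQ(1) that
      by (intro homog_diff) (auto simp: M_def)
    have zdeg: "z \<in> degree_piece n F 0 e"
      using zk homog_polys[OF zk] fP(1) fQ(1) by (auto simp: degree_piece_def free_module_def z_def)
    have xx: "?x (M - X) * ?x X = ?x M" if "X \<subseteq> M" for X
    proof -
      have "finite X" "finite (M - X)" "(M - X) \<union> X = M" "(M - X) \<inter> X = {}"
        using fPQ(3) finite_subset[OF that] that by auto
      then have "sqfree M = sqfree (M - X) + sqfree X" using sqfree_Un[of "M - X" X] by simp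
      then show ?thesis by (simp add: mult_single)
    qed
    have "aug_map F z = ?x (M - P) * aug_map F fP - ?x (M - Q) * aug_map F fQ"
      by (simp add: aug_map_def z_def sum_distrib_left sum_subtractf algebra_simps)
    also have "\<dots> = 0" using xx[of P] xx[of Q] fP(2) fQ(2) by (simp add: M_def)
    finally have "z \<in> bd_map F 0 ` degree_piece n F 1 e"
      using zdeg bd_map_degree_piece_exact_0[OF R, of e] by blast
    then obtain g where g: "g \<in> degree_piece n F 1 e" "z = bd_map F 0 g" by blast
    have \<phi>z: "\<phi> z X = ?x (M - P) * \<phi> fP X - ?x (M - Q) * \<phi> fQ X" for X
      by (simp add: \<phi>_def z_def sum_distrib_left sum_subtractf algebra_simps)
    have \<Lambda>z: "split_functional \<A> M (\<phi> z) = 1"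
    proof -
      have QA: "Q \<notin> \<A>" using less.prems disj by blast
      have "split_functional \<A> M (\<phi> z) = (\<Sum>X\<in>{X\<in>\<A>. X \<subseteq> M}. if X = P then 1 else 0)"
        unfolding split_functional_def
      proof (rule sum.cong)
        fix X assume X: "X \<in> {X\<in>\<A>. X \<subseteq> M}"
        then have "X \<in> ?W" "X \<noteq> Q" using QA by auto
        then have "\<phi> z X = (if X = P then ?x (M - P) else 0)"
          unfolding \<phi>z using \<phi>_gen[OF fP PQ(1)] \<phi>_gen[OF fQ PQ(2)] by simp
        then show "lookup (\<phi> z X) (sqfree (M - X)) = (if X = P then 1 else 0)" by simp
      qed simp
      also have "\<dots> = 1" using less.prems fin(1) by (subst sum.delta) (auto simp: M_def)
      finally show ?thesis .
    qed

    \<comment> \<open>The syzygy of the generators that belongs to the \<open>l\<close>-th basis element of the next module.\<close>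
    define \<tau> where "\<tau> = (\<lambda>l X. \<Sum>k<free_rank F 0. bd F 0 k l * a k X)"
    have syz: "(\<Sum>X\<in>?W. \<tau> l X * ?x X) = 0" if l: "l < free_rank F 1" for l
    proof -
      let ?u = "\<lambda>k. if k = l then 1 else 0 :: 'k mpoly"
      have "?u \<in> free_module n F 1" using l by (auto simp: free_module_def polys_def)
      then have "bd_map F 0 ?u \<in> {f \<in> free_module n F 0. aug_map F f = 0}" using resolution_exact_0[OF R] by blast
      then have "0 = (\<Sum>X\<in>?W. \<phi> (bd_map F 0 ?u) X * ?x X)" unfolding \<phi>_aug by simp
      also have "\<phi> (bd_map F 0 ?u) = \<tau> l"
      proof
        fix X
        have "bd_map F 0 ?u k = bd F 0 k l" if "k < free_rank F 0" for k
          using that l by (simp add: bd_map_def if_distrib cong: if_cong)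
        then show "\<phi> (bd_map F 0 ?u) X = \<tau> l X" by (simp add: \<phi>_def \<tau>_def)
      qed
      finally show ?thesis by simp
    qed
    have \<Lambda>: "split_functional \<A> M (\<phi> (bd_map F 0 h)) =
        (\<Sum>l<free_rank F 1. lookup (h l) 0 * split_functional \<A> M (\<tau> l))" for h
    proof -
      have "\<phi> (bd_map F 0 h) = (\<lambda>X. \<Sum>l<free_rank F 1. h l * \<tau> l X)"
      proof
        fix X
        have "\<phi> (bd_map F 0 h) X = (\<Sum>k<free_rank F 0. \<Sum>l<free_rank F 1. h l * (bd F 0 k l * a k X))"
          unfolding \<phi>_def by (rule sum.cong) (auto simp: bd_map_def sum_distrib_right sum_distrib_left algebra_simps)
        also have "\<dots> = (\<Sum>l<free_rank F 1. h l * \<tau> l X)"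
          unfolding \<tau>_def sum_distrib_left by (rule sum.swap)
        finally show "\<phi> (bd_map F 0 h) X = (\<Sum>l<free_rank F 1. h l * \<tau> l X)" .
      qed
      then have "split_functional \<A> M (\<phi> (bd_map F 0 h)) = (\<Sum>l<free_rank F 1. split_functional \<A> M (\<lambda>X. h l * \<tau> l X))"
        by (simp only: split_functional_sum)
      also have "\<dots> = (\<Sum>l<free_rank F 1. lookup (h l) 0 * split_functional \<A> M (\<tau> l))"
      proof (rule sum.cong)
        fix l assume "l \<in> {..<free_rank F 1}"
        then show "split_functional \<A> M (\<lambda>X. h l * \<tau> l X) = lookup (h l) 0 * split_functional \<A> M (\<tau> l)"
          using split_functional_times_syzygy[OF fPQ(3) fin finX disj syz sep] by simp
      qed simp
      finally show ?thesis .
    qed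

    \<comment> \<open>The class of \<open>g\<close> in the tensor product with \<open>K\<close>.\<close>
    define c where "c = (\<lambda>l. lookup (g l) 0)"
    have "c \<in> tensor_K F (Suc 0) e" unfolding tensor_K_def
    proof (intro CollectI allI impI)
      fix l assume "c l \<noteq> 0"
      then have nz: "0 \<in> keys (g l)" by (simp add: c_def in_keys_iff)
      then have "g l \<noteq> 0" by auto
      then have l: "l < free_rank F (Suc 0)" using g(1) by (auto simp: degree_piece_def free_module_def not_less[symmetric])
      then have "g l \<in> homog n (e - shifts F (Suc 0) ! l)" using g(1) by (simp add: degree_piece_def)
      then have "int (mdeg 0) = e - shifts F (Suc 0) ! l" using nz unfolding homog_def by blast
      then show "l < free_rank F (Suc 0) \<and> shifts F (Suc 0) ! l = e" using l by simp
    qed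
    moreover have "tensor_bd F 0 c = 0"
    proof
      fix k
      have ne: "sqfree (M - P) \<noteq> 0" "sqfree (M - Q) \<noteq> 0"
      proof -
        have "M - P \<noteq> {}" "M - Q \<noteq> {}" using P_psub by auto
        then show "sqfree (M - P) \<noteq> 0" "sqfree (M - Q) \<noteq> 0"
          using keys_sqfree[of "M - P"] keys_sqfree[of "M - Q"] fPQ(3) by fastforce+
      qed
      have "tensor_bd F 0 c k = lookup (z k) 0" unfolding c_def tensor_bd_lookup g(2) ..
      also have "\<dots> = 0" unfolding z_def lookup_minus lookup_times_0 using ne by (simp add: lookup_single when_def)
      finally show "tensor_bd F 0 c k = 0 k" by simp
    qed
    ultimately have c: "c \<in> tensor_cycles F 1 e" by simp
    have "tensor_boundaries F 1 e = tensor_cycles F 1 e"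
    proof (rule subspace_eq_of_dim_eq[OF vector_space_fun fin_dim_tensor_cycles])
      show "tensor_boundaries F 1 e \<subseteq> tensor_cycles F 1 e" by (rule tensor_boundaries_subset[OF R])
      have "fin_dim fun_scale (tensor_boundaries F 1 e)"
        unfolding tensor_boundaries_def by (rule fin_dim_image[OF linear_tensor_bd conjunct1[OF fin_dim_tensor_K]])
      then show "module.subspace fun_scale (tensor_boundaries F 1 e)" by (simp add: fin_dim_def)
      show "K_dim (tensor_cycles F 1 e) \<le> K_dim (tensor_boundaries F 1 e)"
        using lin[OF e_ne] by (simp add: homology_dim_def)
    qed
    then obtain h where h: "h \<in> tensor_K F (Suc 1) e" "c = tensor_bd F 1 h"
      using c unfolding tensor_boundaries_def by blast
    have "bd_map F 0 (bd_map F (Suc 0) (const_vec h)) = 0"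
      by (rule resolution_bd_bd[OF R]) (use const_vec_free[OF h(1)] in simp)
    moreover have "\<phi> 0 = (\<lambda>X. 0)" by (simp add: \<phi>_def)
    ultimately have "0 = (\<Sum>l<free_rank F 1. lookup (bd_map F (Suc 0) (const_vec h) l) 0 * split_functional \<A> M (\<tau> l))"
      using \<Lambda>[of "bd_map F (Suc 0) (const_vec h)"] by (simp add: split_functional_def)
    also have "\<dots> = (\<Sum>l<free_rank F 1. c l * split_functional \<A> M (\<tau> l))"
      unfolding h(2) tensor_bd_const by simp
    also have "\<dots> = split_functional \<A> M (\<phi> z)" unfolding g(2) \<Lambda> c_def ..
    finally show False using \<Lambda>z by simp
  qed
qed

section \<open>Structure of incompletely lexsegment ideals with linear resolution\<close>

lemma spread_setsD:
  assumes "X \<in> spread_sets n d t"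
  shows "X \<subseteq> {1..n}" "card X = d" "t_spread t X" "finite X"
  using assms finite_subset[of X "{1..n}"] by (auto simp: spread_sets_def)

lemma spread_sets_nonempty: "X \<in> spread_sets n d t \<Longrightarrow> d > 0 \<Longrightarrow> X \<noteq> {}"
  by (auto simp: spread_sets_def)

lemma spread_sets_above:
  assumes "X \<in> spread_sets n d t" "Y \<in> spread_sets n d' t" "1 \<in> X" "1 \<notin> Y"
  shows "lex_above X Y"
proof -
  have "0 \<notin> X" "0 \<notin> Y" using assms(1,2) by (auto simp: spread_sets_def)
  then show ?thesis using assms(3,4) unfolding lex_above_def by (intro bexI[of _ 1]) auto
qed

lemma t_spread_insert_below:
  assumes "t_spread t X" "\<And>x. x \<in> X \<Longrightarrow> a + t \<le> x"
  shows "t_spread t (insert a X)"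
  unfolding t_spread_def
proof (intro ballI impI)
  fix x y assume h: "x \<in> insert a X" "y \<in> insert a X" "x < y"
  consider "x \<in> X" "y \<in> X" | "x = a" "y \<in> X" | "x \<in> X" "y = a" using h by auto
  then show "x + t \<le> y"
  proof cases
    case 1 then show ?thesis using assms(1) h(3) unfolding t_spread_def by blast
  next
    case 2 then show ?thesis using assms(2) by blast
  next
    case 3 then show ?thesis using assms(2)[of x] h(3) by simp
  qed
qed

lemma t_spread_remove_Min:
  assumes "finite X" "t_spread t X" "x \<in> X - {Min X}"
  shows "Min X + t \<le> x"
proof -
  have "Min X < x" using Min_le[OF assms(1), of x] assms(3) by (simp add: le_neq_implies_less)
  moreover have "Min X \<in> X" using assms by (intro Min_in) auto
  ultimately show ?thesis using assms unfolding t_spread_def by blast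
qed

lemma spread_sets_insert_below:
  assumes "X \<in> spread_sets n d t" "1 \<le> a" "a \<le> n" "t > 0" "\<And>x. x \<in> X \<Longrightarrow> a + t \<le> x"
  shows "insert a X \<in> spread_sets n (Suc d) t"
proof -
  have "a \<notin> X" using assms(4,5) by fastforce
  then show ?thesis using assms(2,3) spread_setsD[OF assms(1)] t_spread_insert_below[OF _ assms(5)]
    by (auto simp: spread_sets_def)
qed

lemma spread_sets_remove:
  assumes "X \<in> spread_sets n (Suc d) t" "a \<in> X"
  shows "X - {a} \<in> spread_sets n d t"
  using spread_setsD[OF assms(1)] assms(2) t_spread_subset[of t X "X - {a}"]
  by (auto simp: spread_sets_def)

text \<open>
Two sets of \<open>d\<close> elements with \<open>d + 1\<close> elements in their union arise from each other by
exchanging one element.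
\<close>

lemma neighbours_exchange:
  assumes "finite P" "finite Q" "card P = d" "card Q = d" "card (P \<union> Q) = Suc d" "a \<in> P" "a \<notin> Q"
  shows "\<exists>b. b \<notin> P \<and> Q = insert b (P - {a})"
proof -
  have "card (P \<union> Q) = card P + card (Q - P)"
    using card_Un_disjoint[of P "Q - P"] assms(1,2) by (simp add: Un_Diff_cancel)
  then have "card (Q - P) = 1" using assms by simp
  then obtain b where b: "Q - P = {b}" by (auto simp: card_1_singleton_iff)
  have "card (P \<union> Q) = card Q + card (P - Q)"
    using card_Un_disjoint[of Q "P - Q"] assms(1,2) by (simp add: Un_Diff_cancel Un_commute)
  then have "card (P - Q) = 1" using assms by simp
  then obtain c where c: "P - Q = {c}" by (auto simp: card_1_singleton_iff)
  have "a \<in> P - Q" using assms(6,7) by simp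
  then have "P - Q = {a}" unfolding c by simp
  then have "b \<notin> P" "Q = insert b (P - {a})" using b by auto
  then show ?thesis by blast
qed

text \<open>
The set \<open>Y\<close> is the support of a monomial that lies in both segment ideals but not in the ideal of \<open>W\<close>.
Its divisor \<open>Q\<close> is below \<open>B\<close>.  Replacing \<open>Min Q\<close> by 1 gives another divisor, which must be above \<open>A\<close>;
so \<open>Q - {Min Q}\<close> is above \<open>A - {1}\<close>, and the elements of \<open>A - {1}\<close> are at least \<open>Min Q + t\<close>.

Two neighbouring generators with and without 1 have the form \<open>insert 1 Z\<close> and \<open>insert j Z\<close> with
\<open>Z\<close> not above \<open>A - {1}\<close>.  Connecting \<open>A\<close> to \<open>B\<close> gives such a \<open>Z\<close> between \<open>A - {1}\<close> and
\<open>B - {Min B}\<close>, which excludes \<open>Min Q = Min B\<close>.  Let \<open>T\<close> be the least spread set.  Connecting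
\<open>insert 1 T\<close> to the generator with the elements \<open>Min B\<close>, \<open>Min B + t\<close> and those of \<open>T - {Min T}\<close> leaves
\<open>Z = T\<close> as the only possibility, whence \<open>insert (Min B) T\<close> is not below \<open>B\<close>.
\<close>

lemma incomplete_structure:
  assumes t: "t > 0" and AB: "A \<in> spread_sets n (Suc d) t" "B \<in> spread_sets n (Suc d) t"
    and A1: "1 \<in> A" and B1: "1 \<notin> B"
    and W_def: "W = {X \<in> spread_sets n (Suc d) t. lex_geq A X \<and> lex_geq X B}"
    and PY: "P \<in> spread_sets n (Suc d) t" "lex_geq P B" "P \<subseteq> Y"
    and QY: "Q \<in> spread_sets n (Suc d) t" "lex_geq A Q" "Q \<subseteq> Y"
    and none: "\<And>X. X \<in> W \<Longrightarrow> \<not> X \<subseteq> Y"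
    and conn: "\<And>P Q. P \<in> W \<Longrightarrow> 1 \<in> P \<Longrightarrow> Q \<in> W \<Longrightarrow> 1 \<notin> Q \<Longrightarrow>
      \<exists>P'\<in>W. \<exists>Q'\<in>W. 1 \<in> P' \<and> 1 \<notin> Q' \<and> P' \<union> Q' \<subseteq> P \<union> Q \<and> card (P' \<union> Q') = Suc (Suc d)"
  shows "0 < d \<and> (\<forall>x\<in>A - {1}. Min B + t < x) \<and> (\<forall>Z\<in>spread_sets n d t. lex_geq Z (B - {Min B}))"
proof -
  let ?S = "spread_sets n (Suc d) t" and ?S' = "spread_sets n d t"
  define l where "l = Min B"
  have fin: "finite X" and ne: "X \<noteq> {}" and pos: "x \<in> X \<Longrightarrow> 1 \<le> x \<and> x \<le> n" if "X \<in> ?S" for X x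
    using spread_setsD[OF that] spread_sets_nonempty[OF that] by auto
  have lB: "l \<in> B" unfolding l_def using fin[OF AB(2)] ne[OF AB(2)] by simp
  have Bl: "l \<le> x" if "x \<in> B" for x unfolding l_def using fin[OF AB(2)] that by simp
  have l1: "1 < l" using pos[OF AB(2) lB] lB B1 by (cases "l = 1") auto
  have above_B: "lex_geq X B" if "X \<in> ?S" "1 \<in> X" for X
    using spread_sets_above[OF that(1) AB(2) that(2) B1] by (simp add: lex_geq_def)
  have A_above: "lex_above A X" if "X \<in> ?S" "1 \<notin> X" for X
    by (rule spread_sets_above[OF AB(1) that(1) A1 that(2)])
  define A' where "A' = A - {1}"
  define B' where "B' = B - {l}"
  have A: "A = insert 1 A'" "1 \<notin> A'" and B: "B = insert l B'" "l \<notin> B'"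
    using A1 lB by (auto simp: A'_def B'_def)
  have A'S: "A' \<in> ?S'" unfolding A'_def by (rule spread_sets_remove[OF AB(1) A1])
  have B'S: "B' \<in> ?S'" unfolding B'_def by (rule spread_sets_remove[OF AB(2) lB])

  have "1 \<in> P"
  proof (rule ccontr)
    assume "1 \<notin> P"
    then have "lex_geq A P" using A_above[OF PY(1)] by (simp add: lex_geq_def)
    then show False using none[of P] PY by (simp add: W_def)
  qed
  then have Y1: "1 \<in> Y" using PY(3) by blast
  have BQ: "lex_above B Q" using none[of Q] QY not_lex_geq[of Q B] by (auto simp: W_def)
  define q where "q = Min Q"
  define Q' where "Q' = Q - {q}"
  have qQ: "q \<in> Q" unfolding q_def using fin[OF QY(1)] ne[OF QY(1)] by simp
  have Q: "Q = insert q Q'" "q \<notin> Q'" using qQ by (auto simp: Q'_def)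
  have lq: "l \<le> q" unfolding l_def q_def
    using lex_geq_Min_le[OF fin[OF AB(2)] fin[OF QY(1)] ne[OF AB(2)] ne[OF QY(1)]] BQ by (simp add: lex_geq_def)
  have Q't: "q + t \<le> x" if "x \<in> Q'" for x
    using t_spread_remove_Min[OF fin[OF QY(1)] spread_setsD(3)[OF QY(1)]] that by (simp add: Q'_def q_def)
  have Q'S: "Q' \<in> ?S'" unfolding Q'_def by (rule spread_sets_remove[OF QY(1) qQ])
  have Q'1: "1 \<notin> Q'" using Q't[of 1] lq l1 by auto
  have n1: "1 \<le> n" using pos[OF AB(1) A1] by simp
  have CS: "insert 1 Q' \<in> ?S"
  proof (rule spread_sets_insert_below[OF Q'S _ n1 t])
    show "1 + t \<le> x" if "x \<in> Q'" for x using Q't[OF that] lq l1 by simp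
  qed simp
  have "insert 1 Q' \<subseteq> Y" using Y1 QY(3) by (auto simp: Q'_def)
  then have "\<not> lex_geq A (insert 1 Q')" using none[of "insert 1 Q'"] CS above_B[OF CS] by (auto simp: W_def)
  then have Q'A': "lex_above Q' A'"
    using not_lex_geq lex_above_insert_iff[OF Q'1 A(2)] A(1) by simp
  then have "Q' \<noteq> {}" by (auto simp: lex_above_def)
  then have d: "0 < d" using spread_setsD(2,4)[OF Q'S] by auto
  have fin': "finite X" and ne': "X \<noteq> {}" if "X \<in> ?S'" for X
    using spread_setsD(4)[OF that] spread_sets_nonempty[OF that d] by auto
  have "Min Q' \<le> Min A'"
    using lex_geq_Min_le[OF fin'[OF Q'S] fin'[OF A'S] ne'[OF Q'S] ne'[OF A'S]] Q'A' by (simp add: lex_geq_def)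
  moreover have "q + t \<le> Min Q'" using Q't fin'[OF Q'S] ne'[OF Q'S] by simp
  ultimately have qA': "q + t \<le> Min A'" by simp
  have A'low: "Min A' \<le> z" if "Z \<in> ?S'" "lex_geq A' Z" "z \<in> Z" for Z z
    using lex_geq_Min_le[OF fin'[OF A'S] fin'[OF that(1)] ne'[OF A'S] ne'[OF that(1)] that(2)]
      Min_le[OF fin'[OF that(1)] that(3)] by simp

  have AW: "A \<in> W" using AB above_B[OF AB(1) A1] by (simp add: W_def)
  have BW: "B \<in> W" using AB A_above[OF AB(2) B1] by (simp add: W_def lex_geq_def)
  have form: "\<exists>j Z. j \<noteq> 1 \<and> j \<notin> Z \<and> 1 \<notin> Z \<and> P1 = insert 1 Z \<and> Q1 = insert j Z \<and> Z \<in> ?S' \<and> lex_geq A' Z"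
    if h: "P1 \<in> W" "Q1 \<in> W" "1 \<in> P1" "1 \<notin> Q1" "card (P1 \<union> Q1) = Suc (Suc d)" for P1 Q1
  proof -
    have S: "P1 \<in> ?S" "Q1 \<in> ?S" "lex_geq A P1" using h by (auto simp: W_def)
    obtain j where j: "j \<notin> P1" "Q1 = insert j (P1 - {1})"
      using neighbours_exchange[OF fin[OF S(1)] fin[OF S(2)] _ _ h(5,3,4)] spread_setsD(2)[OF S(1)] spread_setsD(2)[OF S(2)]
      by auto
    have P1: "P1 = insert 1 (P1 - {1})" using h(3) by auto
    have "lex_geq A' (P1 - {1})"
      using S(3) lex_geq_insert_iff[OF A(2), of "P1 - {1}"] P1 A(1) by simp
    then show ?thesis using j h(3) P1 spread_sets_remove[OF S(1) h(3)] by (intro exI[of _ j] exI[of _ "P1 - {1}"]) auto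
  qed
  have min_le_l: "\<exists>x\<in>Q1. x \<le> l" if "Q1 \<in> W" for Q1
  proof -
    have S: "Q1 \<in> ?S" "lex_geq Q1 B" using that by (auto simp: W_def)
    have "Min Q1 \<le> l" unfolding l_def
      by (rule lex_geq_Min_le[OF fin[OF S(1)] fin[OF AB(2)] ne[OF S(1)] ne[OF AB(2)] S(2)])
    moreover have "Min Q1 \<in> Q1" using fin[OF S(1)] ne[OF S(1)] by simp
    ultimately show ?thesis by blast
  qed
  obtain P1 Q1 where c1: "P1 \<in> W" "Q1 \<in> W" "1 \<in> P1" "1 \<notin> Q1" "P1 \<union> Q1 \<subseteq> A \<union> B" "card (P1 \<union> Q1) = Suc (Suc d)"
    using conn[OF AW A1 BW B1] by blast
  obtain j Z where Z: "j \<noteq> 1" "j \<notin> Z" "1 \<notin> Z" "Q1 = insert j Z" "Z \<in> ?S'" "lex_geq A' Z"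
    using form[OF c1(1-4,6)] by blast
  have Zl: "l < z" if "z \<in> Z" for z using A'low[OF Z(5,6) that] qA' lq t by simp
  have jl: "j = l"
  proof -
    from min_le_l[OF c1(2)] obtain x where x: "x \<in> Q1" "x \<le> l" by blast
    then have "x = j" using Z(4) Zl[of x] by auto
    moreover have "x \<in> A' \<union> B" using x(1) c1(4,5) A(1) by auto
    moreover have "l < x" if "x \<in> A'" using A'low[OF A'S _ that] qA' lq t by simp
    ultimately show ?thesis using Bl[of x] x(2) by auto
  qed
  have "lex_geq Q1 B" using c1(2) by (simp add: W_def)
  then have ZB': "lex_geq Z B'" using lex_geq_insert_iff[of l Z B'] Z(2,4) jl B by simp
  have A'B': "lex_geq A' B'" by (rule lex_geq_trans[OF Z(6) ZB'])
  have "q \<noteq> l"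
  proof
    assume "q = l"
    then have "lex_above B' Q'" using BQ lex_above_insert_iff[of l B' Q'] B Q by simp
    moreover have "lex_geq Q' B'" using A'B' Q'A' lex_geq_trans[of Q' A' B'] by (simp add: lex_geq_def)
    ultimately show False using not_lex_geq by blast
  qed
  then have lA': "l + t < Min A'" using lq qA' by simp

  have A'sub: "A' \<subseteq> {1..n}" "t_spread t A'" "card A' = d" using spread_setsD[OF A'S] by auto
  have "\<exists>T. T \<subseteq> {1..n} \<and> t_spread t T \<and> card T = card A' \<and> {1..n} \<subseteq> fin_cover t T"
    by (rule fin_cover_exists[OF _ A'sub(1,2) ne'[OF A'S] t]) simp
  then obtain T where T: "T \<subseteq> {1..n}" "t_spread t T" "card T = d" "{1..n} \<subseteq> fin_cover t T"
    unfolding A'sub(3) by blast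
  have TS: "T \<in> ?S'" using T by (simp add: spread_sets_def)
  have Tmin: "lex_geq X T" if X: "X \<in> ?S'" for X
    using fin_cover_lex_min[OF fin'[OF TS] ne'[OF TS] T(1,4) fin'[OF X]] spread_setsD[OF X] T(3) by simp
  have Tlow: "Min A' \<le> x" if "x \<in> T" for x by (rule A'low[OF TS Tmin[OF A'S] that])
  \<comment> \<open>With \<open>l + t\<close> in place of \<open>Min T\<close>, the generator \<open>insert l V\<close> offers few variables beyond
    those of \<open>T\<close>, and none of these can occur in a set that is not above \<open>A - {1}\<close>.\<close>
  define V where "V = insert (l + t) (T - {Min T})"
  have MT: "Min T \<in> T" using fin'[OF TS] ne'[OF TS] by simp
  have An: "Min A' \<le> n"
  proof -
    have "Min A' \<in> A'" using fin'[OF A'S] ne'[OF A'S] by simp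
    then show ?thesis using A'sub(1) by auto
  qed
  obtain d' where d': "d = Suc d'" using d by (cases d) auto
  have TmS: "T - {Min T} \<in> spread_sets n d' t"
    by (rule spread_sets_remove[OF _ MT]) (use TS d' in simp)
  have VS: "V \<in> ?S'" unfolding V_def d'
  proof (rule spread_sets_insert_below[OF TmS _ _ t])
    show "1 \<le> l + t" "l + t \<le> n" using l1 lA' An by auto
    show "l + t + t \<le> x" if "x \<in> T - {Min T}" for x
      using t_spread_remove_Min[OF fin'[OF TS] T(2) that] Tlow[OF MT] lA' by simp
  qed
  have "Min V < Min A'"
  proof -
    have "Min V \<le> l + t" using fin'[OF VS] by (intro Min_le) (auto simp: V_def)
    then show ?thesis using lA' by simp
  qed
  then have VA': "lex_above V A'"
    by (intro lex_above_if_Min_less[OF fin'[OF VS] fin'[OF A'S] ne'[OF VS] ne'[OF A'S]])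
  have Vlow: "l + t \<le> x" if "x \<in> V" for x using that Tlow[of x] lA' by (auto simp: V_def)
  have lV: "l \<notin> V" using Vlow[of l] t by auto
  have T1: "1 \<notin> T" using Tlow[of 1] lA' l1 by auto
  have P2W: "insert 1 T \<in> W"
  proof -
    have "insert 1 T \<in> ?S"
    proof (rule spread_sets_insert_below[OF TS _ n1 t])
      show "1 + t \<le> x" if "x \<in> T" for x using Tlow[OF that] lA' l1 by simp
    qed simp
    moreover have "lex_geq A (insert 1 T)" using lex_geq_insert_iff[OF A(2) T1] Tmin[OF A'S] A(1) by simp
    ultimately show ?thesis using above_B by (simp add: W_def)
  qed
  have Q21: "1 \<notin> insert l V" using l1 Vlow[of 1] by auto
  have Q2W: "insert l V \<in> W"
  proof -
    have S: "insert l V \<in> ?S"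
      by (rule spread_sets_insert_below[OF VS _ _ t Vlow]) (use l1 pos[OF AB(2) lB] in auto)
    have "lex_geq V B'" using VA' A'B' lex_geq_trans[of V A' B'] by (simp add: lex_geq_def)
    then have "lex_geq (insert l V) B" using lex_geq_insert_iff[OF lV B(2)] B(1) by simp
    then show ?thesis using S A_above[OF S Q21] by (simp add: W_def lex_geq_def)
  qed
  obtain P3 Q3 where c3: "P3 \<in> W" "Q3 \<in> W" "1 \<in> P3" "1 \<notin> Q3" "P3 \<union> Q3 \<subseteq> insert 1 T \<union> insert l V" "card (P3 \<union> Q3) = Suc (Suc d)"
    using conn[OF P2W _ Q2W Q21] by blast
  obtain k Z' where Z': "k \<noteq> 1" "k \<notin> Z'" "1 \<notin> Z'" "Q3 = insert k Z'" "Z' \<in> ?S'" "lex_geq A' Z'"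
    using form[OF c3(1-4,6)] by blast
  have Z'l: "l + t < z" if "z \<in> Z'" for z using A'low[OF Z'(5,6) that] lA' by simp
  have "Z' \<subseteq> T"
  proof
    fix z assume z: "z \<in> Z'"
    then have "z \<in> insert 1 T \<union> insert l V" using Z'(4) c3(5) by blast
    then show "z \<in> T" using Z'l[OF z] Z'(3) z by (auto simp: V_def)
  qed
  then have Z'T: "Z' = T" using card_subset_eq[OF fin'[OF TS]] spread_setsD(2)[OF Z'(5)] T(3) by simp
  have "k = l"
  proof -
    from min_le_l[OF c3(2)] obtain x where x: "x \<in> Q3" "x \<le> l" by blast
    then have "x = k" using Z'(4) Z'l[of x] by auto
    moreover have "x \<in> insert 1 T \<union> insert l V" using x(1) c3(5) by blast
    moreover have "x \<notin> T" using Tlow[of x] lA' x(2) by auto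
    moreover have "x \<notin> V" using Vlow[of x] t x(2) by auto
    ultimately show ?thesis using Z'(1) by auto
  qed
  moreover have "lex_geq Q3 B" using c3(2) by (simp add: W_def)
  ultimately have "lex_geq T B'" using lex_geq_insert_iff[of l T B'] Z'(2,4) Z'T B by simp
  then have "B' = T" using Tmin[OF B'S] lex_geq_antisym by blast
  moreover have "l + t < x" if "x \<in> A'" for x using lA' Min_le[OF fin'[OF A'S] that] by simp
  ultimately show ?thesis using d Tmin unfolding A'_def B'_def l_def by blast
qed

section \<open>Betti numbers and Hilbert functions of lexsegment ideals\<close>

text \<open>
The Hilbert function is assumed in the form that a linear resolution would give it; the coefficients
are then the Betti numbers.
\<close>

lemma betti_from_Hilbert_function:
  fixes W :: "nat set set" and c :: "nat \<Rightarrow> int"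
  assumes W: "finite W" "\<Union>W \<subseteq> {1..n}"
    and lin: "linear_resolution n d (monomial_ideal n (sqfree ` W) :: 'k::field mpoly set)"
    and H: "\<And>N e. n \<le> N \<Longrightarrow> int (card {m \<in> monomials {1..n} e. divisible W m}) =
      (\<Sum>i\<le>N. (-1) ^ i * c i * num_monomials {1..n} (e - int d - int i))"
  shows "int (betti n (monomial_ideal n (sqfree ` W) :: 'k mpoly set) i) = c i"
proof -
  let ?I = "monomial_ideal n (sqfree ` W) :: 'k mpoly set"
  define F where "F = (SOME F. graded_free_resolution n ?I F)"
  have R: "graded_free_resolution n ?I F" unfolding F_def
    by (rule someI_ex) (rule squarefree_ideal_has_resolution[OF W(1)], use W(2) in blast)
  have gb: "graded_betti n ?I k j = homology_dim F k j" for k j by (simp add: graded_betti_def F_def)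
  have vanish: "homology_dim F k j = 0" if "j \<noteq> int k + int d" for k j
  proof -
    have "\<forall>i j. j \<noteq> int d \<longrightarrow> graded_betti n ?I i (int i + j) = 0"
      using lin unfolding linear_resolution_def by (elim conjE)
    then have "j - int k \<noteq> int d \<longrightarrow> graded_betti n ?I k (int k + (j - int k)) = 0" by blast
    then show ?thesis using that by (simp add: gb)
  qed
  obtain N1 where N1: "\<forall>i\<ge>N1. free_rank F i = 0"
    using R unfolding graded_free_resolution_def by (elim conjE) (erule exE)
  \<comment> \<open>Both expansions of the Hilbert function are brought to the same number of terms.\<close>
  define N where "N = max i (max n N1)"
  have N: "\<forall>i>N. free_rank F i = 0" "n \<le> N" "i \<le> N" using N1 by (auto simp: N_def)
  have I: "?I = {p \<in> polys n. \<forall>m\<in>keys p. divisible W m}"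
    by (rule monomial_ideal_eq[OF W(2)])
  have "(-1) ^ i * int (homology_dim F i (int i + int d)) = (-1) ^ i * c i"
  proof (rule Hilbert_coefficients_unique[where a = "\<lambda>i. (-1) ^ i * int (homology_dim F i (int i + int d))" and b = "\<lambda>i. (-1) ^ i * c i" and N = N])
    show "i \<le> N" by (rule N(3))
    fix e
    have "?I \<inter> homog n e = {p \<in> homog n e. \<forall>m\<in>keys p. divisible W m}"
    proof -
      have "homog n e \<subseteq> (polys n :: 'k mpoly set)" by (auto simp: homog_def)
      then show ?thesis unfolding I by blast
    qed
    then have "int (card {m \<in> monomials {1..n} e. divisible W m}) = int (vector_space.dim poly_scale (?I \<inter> homog n e))"
      using dim_divisible_piece[of n e "divisible W", where 'a='k] by simp
    moreover have "int (vector_space.dim poly_scale (?I \<inter> homog n e)) =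
        (\<Sum>i\<le>N. (-1) ^ i * int (homology_dim F i (int i + int d)) * num_monomials {1..n} (e - int d - int i))"
      by (rule Hilbert_function_linear[OF R N(1)]) (rule vanish)
    ultimately show "(\<Sum>i\<le>N. (-1) ^ i * int (homology_dim F i (int i + int d)) * num_monomials {1..n} (e - int d - int i)) =
        (\<Sum>i\<le>N. (-1) ^ i * c i * num_monomials {1..n} (e - int d - int i))"
      using H[OF N(2), of e] by simp
  qed
  then have "int (homology_dim F i (int i + int d)) = c i" by simp
  moreover have "betti n ?I i = homology_dim F i (int i + int d)"
  proof -
    have "betti n ?I i = (\<Sum>j\<in>{int i + int d}. homology_dim F i j)"
      unfolding betti_def gb proof (rule sum.mono_neutral_left)
      have "j = int i + int d" if "homology_dim F i j \<noteq> 0" for j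
        by (rule ccontr) (use that vanish[of j i] in simp)
      then show "{j. homology_dim F i j \<noteq> 0} \<subseteq> {int i + int d}" by blast
    qed auto
    then show ?thesis by simp
  qed
  ultimately show ?thesis by simp
qed

lemma lexseg_sets:
  assumes "t > 0" "A \<in> spread_sets n d t" "B \<in> spread_sets n d t"
  shows "lexseg n d t (sqfree A) (sqfree B) = sqfree ` {X \<in> spread_sets n d t. lex_geq A X \<and> lex_geq X B}"
    and "init_lexseg n d t (sqfree B) = sqfree ` {X \<in> spread_sets n d t. lex_geq X B}"
    and "final_lexseg n d t (sqfree A) = sqfree ` {X \<in> spread_sets n d t. lex_geq A X}"
proof -
  have "slex_ge (sqfree X) (sqfree Y) \<longleftrightarrow> lex_geq X Y" if "X \<in> spread_sets n d t" "Y \<in> spread_sets n d t" for X Y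
    using slex_ge_sqfree[OF spread_setsD(4)[OF that(1)] spread_setsD(4)[OF that(2)]] spread_setsD(2)[OF that(1)] spread_setsD(2)[OF that(2)] by simp
  note eq = this
  show "lexseg n d t (sqfree A) (sqfree B) = sqfree ` {X \<in> spread_sets n d t. lex_geq A X \<and> lex_geq X B}"
    unfolding lexseg_def spread_monomials_eq[OF assms(1)] using eq assms(2,3) by auto
  show "init_lexseg n d t (sqfree B) = sqfree ` {X \<in> spread_sets n d t. lex_geq X B}"
    unfolding init_lexseg_def spread_monomials_eq[OF assms(1)] using eq assms(3) by auto
  show "final_lexseg n d t (sqfree A) = sqfree ` {X \<in> spread_sets n d t. lex_geq A X}"
    unfolding final_lexseg_def spread_monomials_eq[OF assms(1)] using eq assms(2) by auto
qed

lemma finite_spread_sets: "finite (spread_sets n d t)"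
  by (rule finite_subset[of _ "Pow {1..n}"]) (auto simp: spread_sets_def)

lemma inj_on_sqfree: "inj_on sqfree (spread_sets n d t)"
  by (rule inj_onI) (rule sqfree_inj[OF spread_setsD(4) spread_setsD(4)])

lemma sum_sqfree:
  assumes "\<And>X. X \<in> W \<Longrightarrow> X \<in> spread_sets n d t"
  shows "(\<Sum>w\<in>sqfree ` W. f w) = (\<Sum>X\<in>W. f (sqfree X))"
  using inj_on_subset[OF inj_on_sqfree[of n d t], of W] assms by (subst sum.reindex) auto

lemma monomial_in_ideal_iff:
  assumes "\<Union>W \<subseteq> {1..n}" "keys m \<subseteq> {1..n}"
  shows "(single m 1 :: 'k::field mpoly) \<in> monomial_ideal n (sqfree ` W) \<longleftrightarrow> divisible W m"
proof -
  have "(single m 1 :: 'k mpoly) \<in> polys n" by (rule polys_single[OF assms(2)])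
  then show ?thesis unfolding monomial_ideal_eq[OF assms(1)] by simp
qed

text \<open>
Ideals generated by monomials can be compared on monomials.
\<close>

lemma ideals_equal_iff:
  assumes "\<Union>W \<subseteq> {1..n}" "\<Union>W1 \<subseteq> {1..n}" "\<Union>W2 \<subseteq> {1..n}"
  shows "(monomial_ideal n (sqfree ` W) :: 'k::field mpoly set) =
      monomial_ideal n (sqfree ` W1) \<inter> monomial_ideal n (sqfree ` W2) \<longleftrightarrow>
    (\<forall>m. keys m \<subseteq> {1..n} \<longrightarrow> (divisible W m \<longleftrightarrow> divisible W1 m \<and> divisible W2 m))"
    (is "?l \<longleftrightarrow> ?r")
proof
  assume l: ?l
  show ?r
  proof (intro allI impI)
    fix m :: monomial assume m: "keys m \<subseteq> {1..n}"
    show "divisible W m \<longleftrightarrow> divisible W1 m \<and> divisible W2 m"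
      using monomial_in_ideal_iff[OF assms(1) m, where 'k='k] monomial_in_ideal_iff[OF assms(2) m, where 'k='k]
        monomial_in_ideal_iff[OF assms(3) m, where 'k='k] l by simp
  qed
next
  assume r: ?r
  have "(\<forall>m\<in>keys p. divisible W m) \<longleftrightarrow>
      (\<forall>m\<in>keys p. divisible W1 m) \<and> (\<forall>m\<in>keys p. divisible W2 m)"
    if "p \<in> polys n" for p :: "'k mpoly"
  proof -
    have "divisible W m \<longleftrightarrow> divisible W1 m \<and> divisible W2 m" if "m \<in> keys p" for m
      using r that \<open>p \<in> polys n\<close> unfolding polys_def by blast
    then show ?thesis by blast
  qed
  then show ?l
    unfolding monomial_ideal_eq[OF assms(1)] monomial_ideal_eq[OF assms(2)] monomial_ideal_eq[OF assms(3)] by blast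
qed

text \<open>
Inclusion and exclusion for the ideals of the initial segment of \<open>B\<close> and the final segment of \<open>A\<close>:
their intersection is the ideal of \<open>W\<close>, and together they generate the ideal of all spread sets.
The contributions of the initial segment cancel against those of all spread sets and leave the sets
strictly below \<open>B\<close>.
\<close>

lemma Hilbert_function_complete:
  assumes t: "t > 0" and d: "d > 0" and AB: "A \<in> spread_sets n d t" "B \<in> spread_sets n d t" "lex_above A B"
    and W: "W = {X \<in> spread_sets n d t. lex_geq A X \<and> lex_geq X B}"
    and complete: "\<And>m. keys m \<subseteq> {1..n} \<Longrightarrow>
      divisible W m \<longleftrightarrow> divisible {X \<in> spread_sets n d t. lex_geq X B} m \<and> divisible {X \<in> spread_sets n d t. lex_geq A X} m"
    and N: "n \<le> N"
  shows "int (card {m \<in> monomials {1..n} e. divisible W m}) =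
    (\<Sum>i\<le>N. (-1) ^ i *
      ((\<Sum>X\<in>{X \<in> spread_sets n d t. lex_geq A X}. int ((n - Min X - (d - 1) * t) choose i)) -
       (\<Sum>X\<in>{X \<in> spread_sets n d t. lex_geq B X} - {B}. int ((Max X - (d - 1) * t - 1) choose i))) *
      num_monomials {1..n} (e - int d - int i))"
proof -
  let ?S = "spread_sets n d t"
  let ?J = "{X \<in> ?S. lex_geq X B}" and ?F = "{X \<in> ?S. lex_geq A X}" and ?L = "{X \<in> ?S. lex_geq B X} - {B}"
  let ?D = "\<lambda>W. {m \<in> monomials {1..n} e. divisible W m}"
  let ?h = "\<lambda>i. num_monomials {1..n} (e - int d - int i)"
  have fS: "finite ?S" by (rule finite_spread_sets)
  have finD: "finite (?D W)" for W using finite_monomials[of "{1..n}" e] by simp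
  have cover: "?J \<union> ?F = ?S"
  proof -
    have "lex_geq A X" if "\<not> lex_geq X B" for X
      using that AB(3) not_lex_geq[of X B] lex_above_trans[of A B X] by (simp add: lex_geq_def)
    then show ?thesis by blast
  qed
  have "divisible ?S m \<longleftrightarrow> divisible ?J m \<or> divisible ?F m" for m
    using cover unfolding divisible_def by blast
  then have "?D ?J \<union> ?D ?F = ?D ?S" by blast
  moreover have "?D ?J \<inter> ?D ?F = ?D W" using complete unfolding monomials_def by blast
  ultimately have count: "card (?D ?J) + card (?D ?F) = card (?D ?S) + card (?D W)"
    using card_Un_Int[OF finD[of ?J] finD[of ?F]] by simp
  have J: "int (card (?D ?J)) = (\<Sum>X\<in>?J. \<Sum>i\<le>N. (-1) ^ i * int ((Max X - (d - 1) * t - 1) choose i) * ?h i)"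
    unfolding divisible_def
  proof (rule Hilbert_function_initial_segment[OF t d _ N])
    show "Z \<in> ?J" if "X \<in> ?J" "Z \<subseteq> {1..n}" "card Z = d" "t_spread t Z" "lex_geq Z X" for X Z
      using that lex_geq_trans[of Z X B] by (simp add: spread_sets_def)
  qed (simp_all add: spread_sets_def)
  have S: "int (card (?D ?S)) = (\<Sum>X\<in>?S. \<Sum>i\<le>N. (-1) ^ i * int ((Max X - (d - 1) * t - 1) choose i) * ?h i)"
    unfolding divisible_def
    by (rule Hilbert_function_initial_segment[OF t d _ N]) (simp_all add: spread_sets_def)
  have "int (card {m \<in> monomials ({1..n} - {}) e. \<exists>X\<in>?F. X \<subseteq> keys m}) =
      (\<Sum>X\<in>?F. \<Sum>i\<le>N. (-1) ^ i * int ((card ({} :: nat set) + (n - Min X - (d - 1) * t)) choose i) * ?h i)"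
  proof (rule Hilbert_function_final_segment[OF t d N])
    show "Z \<in> ?F" if "X \<in> ?F" "Z \<in> ?S" "lex_geq X Z" for X Z
      using that lex_geq_trans[of A X Z] by simp
  qed simp_all
  then have F: "int (card (?D ?F)) = (\<Sum>X\<in>?F. \<Sum>i\<le>N. (-1) ^ i * int ((n - Min X - (d - 1) * t) choose i) * ?h i)"
    by (simp add: divisible_def)
  have "X \<in> ?L \<longleftrightarrow> X \<in> ?S \<and> \<not> lex_geq X B" for X
    using not_lex_geq[of X B] lex_above_asym[of B X] by (auto simp: lex_geq_def)
  then have L: "?L = ?S - ?J" by blast
  have split: "(\<Sum>X\<in>?S. f X) = (\<Sum>X\<in>?J. f X) + (\<Sum>X\<in>?L. f X)" for f :: "nat set \<Rightarrow> int"
    unfolding L using sum.subset_diff[of ?J ?S f] fS by simp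
  have "int (card (?D W)) = int (card (?D ?F)) - (int (card (?D ?S)) - int (card (?D ?J)))"
    using count by simp
  also have "\<dots> = (\<Sum>X\<in>?F. \<Sum>i\<le>N. (-1) ^ i * int ((n - Min X - (d - 1) * t) choose i) * ?h i)
      - (\<Sum>X\<in>?L. \<Sum>i\<le>N. (-1) ^ i * int ((Max X - (d - 1) * t - 1) choose i) * ?h i)"
    unfolding F S J split by simp
  also have "\<dots> = (\<Sum>i\<le>N. \<Sum>X\<in>?F. (-1) ^ i * int ((n - Min X - (d - 1) * t) choose i) * ?h i)
      - (\<Sum>i\<le>N. \<Sum>X\<in>?L. (-1) ^ i * int ((Max X - (d - 1) * t - 1) choose i) * ?h i)"
    by (subst (1 2) sum.swap) simp
  also have "\<dots> = (\<Sum>i\<le>N. (-1) ^ i *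
      ((\<Sum>X\<in>?F. int ((n - Min X - (d - 1) * t) choose i)) -
       (\<Sum>X\<in>?L. int ((Max X - (d - 1) * t - 1) choose i))) * ?h i)"
    by (simp add: sum_subtractf[symmetric] sum_distrib_left sum_distrib_right algebra_simps)
  finally show ?thesis .
qed

text \<open>
Monomials in the ideal of \<open>W\<close> are split into the multiples of generators without 1 and the others.
If \<open>insert 1 Z\<close> divides \<open>m\<close> and so does some \<open>j\<close> with \<open>2 \<le> j \<le> Min B\<close>, then \<open>insert j Z\<close> is a
generator without 1 dividing \<open>m\<close>: it is not below \<open>B\<close> because \<open>B - {Min B}\<close> is the least spread
set.  Conversely a generator without 1 has such a \<open>j\<close> as its least element.  The others are
therefore $x_1$ times the multiples of the sets \<open>Z\<close> in the variables outside \<open>{2..Min B}\<close>.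
\<close>

lemma Hilbert_function_incomplete:
  assumes t: "t > 0" and d: "d > 0" and AB: "A \<in> spread_sets n (Suc d) t" "B \<in> spread_sets n (Suc d) t"
    and A1: "1 \<in> A" and B1: "1 \<notin> B"
    and W: "W = {X \<in> spread_sets n (Suc d) t. lex_geq A X \<and> lex_geq X B}"
    and low: "\<And>x. x \<in> A - {1} \<Longrightarrow> Min B + t < x"
    and last: "\<And>Z. Z \<in> spread_sets n d t \<Longrightarrow> lex_geq Z (B - {Min B})"
    and N: "n \<le> N"
  shows "int (card {m \<in> monomials {1..n} e. divisible W m}) =
    (\<Sum>i\<le>N. (-1) ^ i *
      ((\<Sum>X\<in>{X \<in> W. Min X \<ge> 2}. int ((Max X - d * t - 2) choose i)) +
       (\<Sum>Z\<in>{Z \<in> spread_sets n d t. lex_geq (A - {1}) Z}. int (((Min B - 1) + (n - Min Z - (d - 1) * t)) choose i))) *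
      num_monomials {1..n} (e - int (Suc d) - int i))"
proof -
  let ?S = "spread_sets n (Suc d) t" and ?S' = "spread_sets n d t"
  let ?h = "\<lambda>i. num_monomials {1..n} (e - int (Suc d) - int i)"
  define l where "l = Min B"
  define \<B> where "\<B> = {X \<in> W. Min X \<ge> 2}"
  define \<Z> where "\<Z> = {Z \<in> ?S'. lex_geq (A - {1}) Z}"
  have fin: "finite X" and ne: "X \<noteq> {}" and pos: "x \<in> X \<Longrightarrow> 1 \<le> x \<and> x \<le> n" if "X \<in> ?S" for X x
    using spread_setsD[OF that] spread_sets_nonempty[OF that] by auto
  have fin': "finite X" and ne': "X \<noteq> {}" and pos': "x \<in> X \<Longrightarrow> 1 \<le> x \<and> x \<le> n" if "X \<in> ?S'" for X x
    using spread_setsD[OF that] spread_sets_nonempty[OF that d] by auto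
  have lB: "l \<in> B" unfolding l_def using fin[OF AB(2)] ne[OF AB(2)] by simp
  have l1: "1 < l" using pos[OF AB(2) lB] lB B1 by (cases "l = 1") auto
  have ln: "l \<le> n" using pos[OF AB(2) lB] by simp
  have Min2: "Min X \<ge> 2 \<longleftrightarrow> 1 \<notin> X" if "X \<in> ?S" for X
  proof
    assume "Min X \<ge> 2"
    then show "1 \<notin> X" using Min_le[OF fin[OF that], of 1] by auto
  next
    assume "1 \<notin> X"
    moreover have "Min X \<in> X" using fin[OF that] ne[OF that] by simp
    ultimately have "Min X \<noteq> 1" "1 \<le> Min X" using pos[OF that] by auto
    then show "Min X \<ge> 2" by simp
  qed
  have above_B: "lex_geq X B" if "X \<in> ?S" "1 \<in> X" for X
    using spread_sets_above[OF that(1) AB(2) that(2) B1] by (simp add: lex_geq_def)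
  have A_above: "lex_geq A X" if "X \<in> ?S" "1 \<notin> X" for X
    using spread_sets_above[OF AB(1) that(1) A1 that(2)] by (simp add: lex_geq_def)
  have \<B>: "X \<in> \<B> \<longleftrightarrow> X \<in> ?S \<and> 1 \<notin> X \<and> lex_geq X B" for X
    using A_above Min2 by (auto simp: \<B>_def W)
  have A: "A = insert 1 (A - {1})" using A1 by auto
  have A'S: "A - {1} \<in> ?S'" by (rule spread_sets_remove[OF AB(1) A1])
  have B: "B = insert l (B - {l})" using lB by auto
  have \<Z>low: "l + t < z" if "Z \<in> \<Z>" "z \<in> Z" for Z z
  proof -
    have Z: "Z \<in> ?S'" "lex_geq (A - {1}) Z" using that by (auto simp: \<Z>_def)
    have "Min (A - {1}) \<le> Min Z"
      by (rule lex_geq_Min_le[OF fin'[OF A'S] fin'[OF Z(1)] ne'[OF A'S] ne'[OF Z(1)] Z(2)])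
    moreover have "Min (A - {1}) \<in> A - {1}" using fin'[OF A'S] ne'[OF A'S] by (rule Min_in)
    moreover have "Min Z \<le> z" using fin'[OF Z(1)] that(2) by (rule Min_le)
    ultimately show ?thesis using low[of "Min (A - {1})"] by (simp add: l_def)
  qed
  have n1: "1 \<le> n" using pos[OF AB(1) A1] by simp
  have one: "insert 1 Z \<in> W" if Z: "Z \<in> \<Z>" for Z
  proof -
    have S: "insert 1 Z \<in> ?S"
      by (rule spread_sets_insert_below[OF _ _ n1 t]) (use Z \<Z>low[OF Z] l1 in \<open>fastforce simp: \<Z>_def\<close>)+
    have "1 \<notin> Z" using \<Z>low[OF Z, of 1] l1 by auto
    then have "lex_geq A (insert 1 Z)" using lex_geq_insert_iff[of 1 "A - {1}" Z] Z A by (simp add: \<Z>_def)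
    then show ?thesis using S above_B[OF S] by (simp add: W)
  qed
  have two: "insert j Z \<in> \<B>" if Z: "Z \<in> \<Z>" and j: "2 \<le> j" "j \<le> l" for Z j
  proof -
    have ZS: "Z \<in> ?S'" using Z by (simp add: \<Z>_def)
    have S: "insert j Z \<in> ?S"
      by (rule spread_sets_insert_below[OF ZS _ _ t]) (use \<Z>low[OF Z] j ln in fastforce)+
    have nin: "1 \<notin> insert j Z" using \<Z>low[OF Z, of 1] l1 j by auto
    have "lex_geq (insert j Z) B"
    proof (cases "j = l")
      case True
      have "l \<notin> Z" using \<Z>low[OF Z, of l] by auto
      then show ?thesis using lex_geq_insert_iff[of l Z "B - {l}"] last[OF ZS] B True by (simp add: l_def)
    next
      case False
      have "Min (insert j Z) \<le> j" using fin[OF S] by (intro Min_le) auto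
      then have "Min (insert j Z) < Min B" using False j by (simp add: l_def)
      then show ?thesis
        using lex_above_if_Min_less[OF fin[OF S] fin[OF AB(2)] ne[OF S] ne[OF AB(2)]] by (simp add: lex_geq_def)
    qed
    then show ?thesis using S nin by (simp add: \<B>)
  qed
  let ?D = "{m \<in> monomials {1..n} e. divisible W m}"
  let ?DB = "{m \<in> monomials {1..n} e. divisible \<B> m}"
  let ?V = "{1..n} - {2..l}"
  let ?E = "{m \<in> monomials ?V (e - 1). divisible \<Z> m}"
  have eqD: "?D = ?DB \<union> (\<lambda>m. m + sqfree {1}) ` ?E"
  proof (intro equalityI subsetI)
    fix m assume m: "m \<in> ?D"
    show "m \<in> ?DB \<union> (\<lambda>m. m + sqfree {1}) ` ?E"
    proof (cases "divisible \<B> m")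
      case True
      then show ?thesis using m by simp
    next
      case False
      obtain X where X: "X \<in> W" "X \<subseteq> keys m" using m by (auto simp: divisible_def)
      have XS: "X \<in> ?S" "lex_geq A X" "lex_geq X B" using X(1) by (auto simp: W)
      have X1: "1 \<in> X" using False X XS \<B>[of X] unfolding divisible_def by blast
      define Z where "Z = X - {1}"
      have "lex_geq (A - {1}) Z"
        using lex_geq_insert_iff[of 1 "A - {1}" Z] XS(2) A X1 by (simp add: Z_def insert_absorb)
      then have Z: "Z \<in> \<Z>" using spread_sets_remove[OF XS(1) X1] by (simp add: Z_def \<Z>_def)
      have Zm: "Z \<subseteq> keys m" "1 \<notin> Z" using X(2) by (auto simp: Z_def)
      have no: "j \<notin> keys m" if "j \<in> {2..l}" for j
      proof
        assume "j \<in> keys m"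
        then have "divisible \<B> m" using two[OF Z, of j] that Zm unfolding divisible_def by (intro bexI[of _ "insert j Z"]) auto
        then show False using False by simp
      qed
      have eq: "(m - sqfree {1}) + sqfree {1} = m" using X(2) X1 by (intro subset_keys_imp_add) auto
      have km: "keys m = keys (m - sqfree {1}) \<union> {1}"
        using keys_add_monomial[of "m - sqfree {1}" "sqfree {1}"] unfolding eq by simp
      have "mdeg m = mdeg (m - sqfree {1}) + 1"
        using mdeg_add[of "m - sqfree {1}" "sqfree {1}"] unfolding eq by simp
      moreover have "keys (m - sqfree {1}) \<subseteq> ?V"
        using m no km by (auto simp: monomials_def simp del: One_nat_def)
      ultimately have "m - sqfree {1} \<in> monomials ?V (e - 1)" using m by (auto simp: monomials_def)
      moreover have "divisible \<Z> (m - sqfree {1})" using Z Zm km unfolding divisible_def by blast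
      ultimately have "m - sqfree {1} \<in> ?E" by simp
      from imageI[OF this, of "\<lambda>m. m + sqfree {1}"] show ?thesis unfolding eq by blast
    qed
  next
    fix m assume "m \<in> ?DB \<union> (\<lambda>m. m + sqfree {1}) ` ?E"
    then consider "m \<in> ?DB" | k where "k \<in> ?E" "m = k + sqfree {1}" by blast
    then show "m \<in> ?D"
    proof cases
      case 1
      then show ?thesis unfolding divisible_def \<B>_def by blast
    next
      case 2
      then obtain Z where Z: "Z \<in> \<Z>" "Z \<subseteq> keys k" by (auto simp: divisible_def)
      have km: "keys m = keys k \<union> {1}" unfolding 2(2) by (simp add: keys_add_monomial)
      have "divisible W m" using one[OF Z(1)] Z(2) km unfolding divisible_def by (intro bexI[of _ "insert 1 Z"]) auto
      moreover have "m \<in> monomials {1..n} e" using 2 km n1 by (auto simp: monomials_def mdeg_add)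
      ultimately show ?thesis by simp
    qed
  qed
  have "?DB \<inter> (\<lambda>m. m + sqfree {1}) ` ?E = {}"
  proof (rule ccontr)
    assume "?DB \<inter> (\<lambda>m. m + sqfree {1}) ` ?E \<noteq> {}"
    then obtain k where k: "k \<in> ?E" "divisible \<B> (k + sqfree {1})" by blast
    then obtain X where X: "X \<in> \<B>" "X \<subseteq> keys k \<union> {1}" by (auto simp: divisible_def keys_add_monomial)
    have XS: "X \<in> ?S" "1 \<notin> X" "lex_geq X B" using X(1) by (simp_all add: \<B>)
    have "Min X \<le> l" unfolding l_def
      by (rule lex_geq_Min_le[OF fin[OF XS(1)] fin[OF AB(2)] ne[OF XS(1)] ne[OF AB(2)] XS(3)])
    moreover have MX: "Min X \<in> X" using fin[OF XS(1)] ne[OF XS(1)] by simp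
    moreover have "2 \<le> Min X" using Min2[OF XS(1)] XS(2) by simp
    ultimately have "Min X \<in> {2..l}" "Min X \<in> keys k" using X(2) XS(2) by auto
    then show False using k(1) by (auto simp: monomials_def)
  qed
  moreover have "card ((\<lambda>m. m + sqfree {1}) ` ?E) = card ?E" by (rule card_image) (auto simp: inj_on_def)
  moreover have "finite ?DB" "finite ?E" using finite_monomials[of "{1..n}" e] finite_monomials[of ?V "e - 1"] by simp_all
  ultimately have count: "card ?D = card ?DB + card ?E" unfolding eqD by (simp add: card_Un_disjoint)
  have DB: "int (card ?DB) = (\<Sum>X\<in>\<B>. \<Sum>i\<le>N. (-1) ^ i * int ((Max X - (Suc d - 1) * t - 2) choose i) * ?h i)"
    unfolding divisible_def
  proof (rule Hilbert_function_initial_segment[OF t _ _ N])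
    show "X \<subseteq> {2..n} \<and> card X = Suc d \<and> t_spread t X" if "X \<in> \<B>" for X
    proof -
      have XS: "X \<in> ?S" "1 \<notin> X" using that by (simp_all add: \<B>)
      have "2 \<le> x" if "x \<in> X" for x using pos[OF XS(1) that] XS(2) that by (cases "x = 1") auto
      then show ?thesis using spread_setsD[OF XS(1)] by auto
    qed
    show "Z \<in> \<B>" if "X \<in> \<B>" "Z \<subseteq> {2..n}" "card Z = Suc d" "t_spread t Z" "lex_geq Z X" for X Z
      using that lex_geq_trans[of Z X B] unfolding \<B> spread_sets_def by auto
  qed simp_all
  have "int (card {m \<in> monomials ({1..n} - {2..l}) (e - 1). \<exists>X\<in>\<Z>. X \<subseteq> keys m}) =
      (\<Sum>X\<in>\<Z>. \<Sum>i\<le>N. (-1) ^ i * int ((card {2..l} + (n - Min X - (d - 1) * t)) choose i) * num_monomials {1..n} (e - 1 - int d - int i))"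
  proof (rule Hilbert_function_final_segment[OF t d N])
    show "{2..l} \<subseteq> {1..n}" using ln by auto
    show "X \<in> ?S' \<and> (\<forall>g\<in>{2..l}. g < Min X)" if "X \<in> \<Z>" for X
    proof -
      have XS: "X \<in> ?S'" using that by (simp add: \<Z>_def)
      have "Min X \<in> X" using fin'[OF XS] ne'[OF XS] by simp
      then show ?thesis using \<Z>low[OF that] XS by fastforce
    qed
    show "Z \<in> \<Z>" if "X \<in> \<Z>" "Z \<in> ?S'" "lex_geq X Z" for X Z
      using that lex_geq_trans[of "A - {1}" X Z] by (simp add: \<Z>_def)
  qed
  moreover have "e - 1 - int d = e - int (Suc d)" by simp
  ultimately have E: "int (card ?E) = (\<Sum>X\<in>\<Z>. \<Sum>i\<le>N. (-1) ^ i * int (((l - 1) + (n - Min X - (d - 1) * t)) choose i) * ?h i)"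
    unfolding divisible_def by (simp only: card_atLeastAtMost) simp
  have "int (card ?D) = (\<Sum>i\<le>N. \<Sum>X\<in>\<B>. (-1) ^ i * int ((Max X - d * t - 2) choose i) * ?h i) +
      (\<Sum>i\<le>N. \<Sum>X\<in>\<Z>. (-1) ^ i * int (((l - 1) + (n - Min X - (d - 1) * t)) choose i) * ?h i)"
    unfolding count of_nat_add DB E by (subst (1 2) sum.swap) simp
  also have "\<dots> = (\<Sum>i\<le>N. (-1) ^ i *
      ((\<Sum>X\<in>\<B>. int ((Max X - d * t - 2) choose i)) +
       (\<Sum>X\<in>\<Z>. int (((l - 1) + (n - Min X - (d - 1) * t)) choose i))) * ?h i)"
    by (simp add: sum.distrib[symmetric] sum_distrib_left sum_distrib_right algebra_simps)
  finally show ?thesis unfolding \<B>_def \<Z>_def l_def .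
qed

section \<open>The formulas for the Betti numbers\<close>

lemma sqfree_minus_single:
  assumes "finite A" "1 \<in> A"
  shows "sqfree A - single 1 1 = sqfree (A - {1})"
  by (rule poly_mapping_eqI) (use assms in \<open>auto simp: lookup_minus lookup_sqfree lookup_single when_def\<close>)

lemma sum_sqfree_min_max:
  assumes "\<And>X. X \<in> W \<Longrightarrow> X \<in> spread_sets n d t"
  shows "(\<Sum>w\<in>sqfree ` W. f (min_var w) (max_var w)) = (\<Sum>X\<in>W. f (Min X) (Max X))"
proof -
  have "f (min_var (sqfree X)) (max_var (sqfree X)) = f (Min X) (Max X)" if "X \<in> W" for X
    using spread_setsD(4)[OF assms[OF that]] by (simp add: min_var_def max_var_def)
  moreover have "(\<Sum>w\<in>sqfree ` W. f (min_var w) (max_var w)) = (\<Sum>X\<in>W. f (min_var (sqfree X)) (max_var (sqfree X)))"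
    by (rule sum_sqfree) (rule assms)
  ultimately show ?thesis by simp
qed

theorem theorem3p1:
  fixes n d t :: nat
    and u v :: monomial
    and I :: "'k::field mpoly set"
  assumes "n \<ge> 1" and "d \<ge> 1" and "t \<ge> 1"
    and "n \<ge> 1 + (d - 1) * t"
    and "u \<in> spread_monomials n d t" and "v \<in> spread_monomials n d t"
    and "min_var u = 1" and "min_var v > 1"
    and "I = monomial_ideal n (lexseg n d t u v)"
    and "linear_resolution n d I"
  shows
    "(completely_lexseg TYPE('k) n d t u v \<longrightarrow>
        (\<forall>i. int (betti n I i) =
           (\<Sum>w\<in>final_lexseg n d t u. int ((n - min_var w - (d - 1) * t) choose i))
           - (\<Sum>w\<in>final_lexseg n d t v - {v}. int ((max_var w - (d - 1) * t - 1) choose i)))) \<and>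
     (incompletely_lexseg TYPE('k) n d t u v \<longrightarrow>
        (\<forall>i. betti n I i =
           (\<Sum>w\<in>{w \<in> lexseg n d t u v. min_var w \<ge> 2}. (max_var w - (d - 1) * t - 2) choose i)
           + (\<Sum>j=0..i. \<Sum>w\<in>final_lexseg n (d - 1) t (u - Poly_Mapping.single 1 1).
                ((min_var v - 1) choose j) * ((n - min_var w - (d - 2) * t) choose (i - j)))))"
proof -
  have t: "t > 0" and d: "d > 0" using assms(2,3) by auto
  obtain A B where uv: "u = sqfree A" "v = sqfree B" and AB: "A \<in> spread_sets n d t" "B \<in> spread_sets n d t"
    using assms(5,6) unfolding spread_monomials_eq[OF t] by blast
  let ?S = "spread_sets n d t"
  note fin = spread_setsD(4)
  have ne: "X \<noteq> {}" if "X \<in> ?S" for X using spread_sets_nonempty[OF that d] .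
  have MinA: "Min A = 1" and MinB: "Min B > 1"
    using assms(7,8) fin[OF AB(1)] fin[OF AB(2)] by (simp_all add: uv min_var_def)
  have A1: "1 \<in> A" using Min_in[OF fin[OF AB(1)] ne[OF AB(1)]] MinA by simp
  have B1: "1 \<notin> B" using Min_le[OF fin[OF AB(2)], of 1] MinB by auto
  have above: "lex_above A B"
    by (rule spread_sets_above[OF AB A1 B1])
  define W where "W = {X \<in> ?S. lex_geq A X \<and> lex_geq X B}"
  let ?J = "{X \<in> ?S. lex_geq X B}" and ?F = "{X \<in> ?S. lex_geq A X}"
  have seg: "lexseg n d t u v = sqfree ` W" "init_lexseg n d t v = sqfree ` ?J" "final_lexseg n d t u = sqfree ` ?F"
    unfolding uv W_def by (rule lexseg_sets[OF t AB])+
  have I: "I = monomial_ideal n (sqfree ` W)" using assms(9) seg(1) by simp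
  have sub: "\<Union>W \<subseteq> {1..n}" "\<Union>?J \<subseteq> {1..n}" "\<Union>?F \<subseteq> {1..n}"
    unfolding W_def using spread_setsD(1)[of _ n d t] by blast+
  have finW: "finite W" unfolding W_def using finite_spread_sets by simp
  have complete_iff: "completely_lexseg TYPE('k) n d t u v \<longleftrightarrow>
      (\<forall>m. keys m \<subseteq> {1..n} \<longrightarrow> (divisible W m \<longleftrightarrow> divisible ?J m \<and> divisible ?F m))"
    unfolding completely_lexseg_def seg by (rule ideals_equal_iff[OF sub])
  have lin: "linear_resolution n d (monomial_ideal n (sqfree ` W) :: 'k mpoly set)"
    using assms(10) I by simp
  show ?thesis
  proof (intro conjI impI allI)
    fix i
    assume "completely_lexseg TYPE('k) n d t u v"
    then have "\<forall>m. keys m \<subseteq> {1..n} \<longrightarrow> (divisible W m \<longleftrightarrow> divisible ?J m \<and> divisible ?F m)"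
      unfolding complete_iff .
    then have cmp: "divisible W m \<longleftrightarrow> divisible ?J m \<and> divisible ?F m" if "keys m \<subseteq> {1..n}" for m
      using that by (elim allE[of _ m] impE)
    let ?L = "{X \<in> ?S. lex_geq B X} - {B}"
    have "final_lexseg n d t v = sqfree ` {X \<in> ?S. lex_geq B X}"
      unfolding uv by (rule lexseg_sets(3)[OF t AB(2,2)])
    moreover have "sqfree ` {X \<in> ?S. lex_geq B X} - {v} = sqfree ` ?L"
      using inj_on_image_set_diff[OF inj_on_sqfree[of n d t], of "{X \<in> ?S. lex_geq B X}" "{B}"] AB(2)
      by (simp add: uv subset_iff)
    ultimately have fv: "final_lexseg n d t v - {v} = sqfree ` ?L" by simp
    have "int (betti n I i) = (\<Sum>X\<in>?F. int ((n - Min X - (d - 1) * t) choose i)) -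
       (\<Sum>X\<in>?L. int ((Max X - (d - 1) * t - 1) choose i))"
      unfolding I
    proof (rule betti_from_Hilbert_function[OF finW sub(1) lin])
      fix N e assume "n \<le> N"
      show "int (card {m \<in> monomials {1..n} e. divisible W m}) =
        (\<Sum>i\<le>N. (-1) ^ i * ((\<Sum>X\<in>?F. int ((n - Min X - (d - 1) * t) choose i)) -
          (\<Sum>X\<in>?L. int ((Max X - (d - 1) * t - 1) choose i))) * num_monomials {1..n} (e - int d - int i))"
        by (rule Hilbert_function_complete[OF t d AB above W_def _ \<open>n \<le> N\<close>]) (rule cmp)
    qed
    moreover have "(\<Sum>w\<in>sqfree ` ?F. int ((n - min_var w - (d - 1) * t) choose i)) =
        (\<Sum>X\<in>?F. int ((n - Min X - (d - 1) * t) choose i))"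
      by (rule sum_sqfree_min_max[where f = "\<lambda>a b. int ((n - a - (d - 1) * t) choose i)" and n = n and d = d and t = t]) simp
    moreover have "(\<Sum>w\<in>sqfree ` ?L. int ((max_var w - (d - 1) * t - 1) choose i)) =
        (\<Sum>X\<in>?L. int ((Max X - (d - 1) * t - 1) choose i))"
      by (rule sum_sqfree_min_max[where f = "\<lambda>a b. int ((b - (d - 1) * t - 1) choose i)" and n = n and d = d and t = t]) simp
    ultimately show "int (betti n I i) =
           (\<Sum>w\<in>final_lexseg n d t u. int ((n - min_var w - (d - 1) * t) choose i))
           - (\<Sum>w\<in>final_lexseg n d t v - {v}. int ((max_var w - (d - 1) * t - 1) choose i))"
      unfolding seg(3) fv by simp
  next
    fix i
    assume "incompletely_lexseg TYPE('k) n d t u v"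
    then obtain m where m: "keys m \<subseteq> {1..n}" "\<not> (divisible W m \<longleftrightarrow> divisible ?J m \<and> divisible ?F m)"
      unfolding complete_iff by blast
    have "divisible ?J m \<and> divisible ?F m" if "divisible W m" using that unfolding divisible_def W_def by blast
    then have mJF: "divisible ?J m" "divisible ?F m" "\<not> divisible W m" using m(2) by blast+
    obtain d' where d': "d = Suc d'" using d by (cases d) auto
    obtain P where P: "P \<in> ?S" "lex_geq P B" "P \<subseteq> keys m" using mJF(1) by (auto simp: divisible_def)
    obtain Q where Q: "Q \<in> ?S" "lex_geq A Q" "Q \<subseteq> keys m" using mJF(2) by (auto simp: divisible_def)
    let ?A = "{X \<in> W. 1 \<in> X}" and ?B = "{X \<in> W. 1 \<notin> X}"
    have WAB: "?A \<union> ?B = W" by blast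
    \<comment> \<open>The resolution by which \<open>graded_betti\<close> is defined.\<close>
    define F where "F = (SOME F. graded_free_resolution n (monomial_ideal n (sqfree ` W) :: 'k mpoly set) F)"
    have "\<exists>F. graded_free_resolution n (monomial_ideal n (sqfree ` W) :: 'k mpoly set) F"
      by (rule squarefree_ideal_has_resolution[OF finW]) (use sub(1) in blast)
    then have R: "graded_free_resolution n (monomial_ideal n (sqfree ` W)) F" unfolding F_def by (rule someI_ex)
    have van: "homology_dim F 1 j = 0" if "j \<noteq> int d + 1" for j
    proof -
      have "\<forall>i j. j \<noteq> int d \<longrightarrow> graded_betti n (monomial_ideal n (sqfree ` W) :: 'k mpoly set) i (int i + j) = 0"
        using lin unfolding linear_resolution_def by (elim conjE)
      then have "j - 1 \<noteq> int d \<longrightarrow> graded_betti n (monomial_ideal n (sqfree ` W) :: 'k mpoly set) 1 (int 1 + (j - 1)) = 0" by blast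
      then show ?thesis using that by (simp add: graded_betti_def F_def)
    qed
    have conn: "\<exists>P'\<in>W. \<exists>Q'\<in>W. 1 \<in> P' \<and> 1 \<notin> Q' \<and> P' \<union> Q' \<subseteq> P \<union> Q \<and> card (P' \<union> Q') = Suc (Suc d')"
      if PQ: "P \<in> W" "1 \<in> P" "Q \<in> W" "1 \<notin> Q" for P Q
    proof -
      have "\<exists>P'\<in>?A. \<exists>Q'\<in>?B. P' \<union> Q' \<subseteq> P \<union> Q \<and> card (P' \<union> Q') = Suc d"
      proof (rule linear_syzygies_connect)
        show "graded_free_resolution n (monomial_ideal n (sqfree ` (?A \<union> ?B))) F" unfolding WAB by (rule R)
        show "X \<subseteq> {1..n} \<and> card X = d" if "X \<in> ?A \<union> ?B" for X
          using that spread_setsD(1,2)[of X n d t] by (auto simp: W_def)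
        show "homology_dim F 1 j = 0" if "j \<noteq> int d + 1" for j by (rule van[OF that])
      qed (use finW PQ in auto)
      then show ?thesis unfolding d' by blast
    qed
    have str: "0 < d' \<and> (\<forall>x\<in>A - {1}. Min B + t < x) \<and> (\<forall>Z\<in>spread_sets n d' t. lex_geq Z (B - {Min B}))"
    proof (rule incomplete_structure[OF t _ _ A1 B1 _ _ P(2,3) _ Q(2,3)])
      show "\<exists>P'\<in>W. \<exists>Q'\<in>W. 1 \<in> P' \<and> 1 \<notin> Q' \<and> P' \<union> Q' \<subseteq> P \<union> Q \<and> card (P' \<union> Q') = Suc (Suc d')"
        if "P \<in> W" "1 \<in> P" "Q \<in> W" "1 \<notin> Q" for P Q by (rule conn[OF that])
      show "\<not> X \<subseteq> keys m" if "X \<in> W" for X using mJF(3) that unfolding divisible_def by blast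
      show "W = {X \<in> spread_sets n (Suc d') t. lex_geq A X \<and> lex_geq X B}" unfolding W_def d' ..
    qed (use AB P(1) Q(1) d' in simp_all)
    define \<Z> where "\<Z> = {Z \<in> spread_sets n d' t. lex_geq (A - {1}) Z}"
    have A'S: "A - {1} \<in> spread_sets n d' t" by (rule spread_sets_remove[OF _ A1]) (use AB(1) d' in simp)
    have fu: "final_lexseg n (d - 1) t (u - single 1 1) = sqfree ` \<Z>"
      unfolding uv sqfree_minus_single[OF fin[OF AB(1)] A1] d' \<Z>_def diff_Suc_1 by (rule lexseg_sets(3)[OF t A'S A'S])
    have low2: "{w \<in> lexseg n d t u v. min_var w \<ge> 2} = sqfree ` {X \<in> W. Min X \<ge> 2}"
    proof -
      have "min_var (sqfree X) = Min X" if "X \<in> W" for X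
        using fin[of X n d t] that by (simp add: min_var_def W_def)
      then show ?thesis unfolding seg(1) by auto
    qed
    have vB: "min_var v = Min B" unfolding uv using fin[OF AB(2)] by (simp add: min_var_def)
    have "int (betti n I i) = (\<Sum>X\<in>{X \<in> W. Min X \<ge> 2}. int ((Max X - d' * t - 2) choose i)) +
       (\<Sum>Z\<in>\<Z>. int (((Min B - 1) + (n - Min Z - (d' - 1) * t)) choose i))"
      unfolding I
    proof (rule betti_from_Hilbert_function[OF finW sub(1) lin])
      fix N e assume N: "n \<le> N"
      show "int (card {m \<in> monomials {1..n} e. divisible W m}) =
        (\<Sum>i\<le>N. (-1) ^ i * ((\<Sum>X\<in>{X \<in> W. Min X \<ge> 2}. int ((Max X - d' * t - 2) choose i)) +
           (\<Sum>Z\<in>\<Z>. int (((Min B - 1) + (n - Min Z - (d' - 1) * t)) choose i))) * num_monomials {1..n} (e - int d - int i))"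
        unfolding \<Z>_def d'
      proof (rule Hilbert_function_incomplete[OF t _ _ _ A1 B1 _ _ _ N])
        show "W = {X \<in> spread_sets n (Suc d') t. lex_geq A X \<and> lex_geq X B}" unfolding W_def d' ..
      qed (use AB str d' in simp_all)
    qed
    moreover have "(\<Sum>w\<in>sqfree ` {X \<in> W. Min X \<ge> 2}. (max_var w - d' * t - 2) choose i) =
        (\<Sum>X\<in>{X \<in> W. Min X \<ge> 2}. (Max X - d' * t - 2) choose i)"
      by (rule sum_sqfree_min_max[where f = "\<lambda>a b. (b - d' * t - 2) choose i" and n = n and d = d and t = t]) (simp add: W_def)
    moreover have "(\<Sum>j=0..i. \<Sum>w\<in>sqfree ` \<Z>. ((Min B - 1) choose j) * ((n - min_var w - (d' - 1) * t) choose (i - j))) =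
        (\<Sum>Z\<in>\<Z>. ((Min B - 1) + (n - Min Z - (d' - 1) * t)) choose i)"
    proof -
      have "(\<Sum>j=0..i. \<Sum>w\<in>sqfree ` \<Z>. ((Min B - 1) choose j) * ((n - min_var w - (d' - 1) * t) choose (i - j))) =
          (\<Sum>w\<in>sqfree ` \<Z>. ((Min B - 1) + (n - min_var w - (d' - 1) * t)) choose i)"
        by (subst sum.swap) (simp add: vandermonde[symmetric] atMost_atLeast0)
      also have "\<dots> = (\<Sum>Z\<in>\<Z>. ((Min B - 1) + (n - Min Z - (d' - 1) * t)) choose i)"
        by (rule sum_sqfree_min_max[where f = "\<lambda>a b. ((Min B - 1) + (n - a - (d' - 1) * t)) choose i" and n = n and d = d' and t = t]) (simp add: \<Z>_def)
      finally show ?thesis .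
    qed
    moreover have "d - 1 = d'" "d - 2 = d' - 1" using d' by auto
    ultimately have "int (betti n I i) = int (
           (\<Sum>w\<in>{w \<in> lexseg n d t u v. min_var w \<ge> 2}. (max_var w - (d - 1) * t - 2) choose i)
           + (\<Sum>j=0..i. \<Sum>w\<in>final_lexseg n (d - 1) t (u - single 1 1).
                ((min_var v - 1) choose j) * ((n - min_var w - (d - 2) * t) choose (i - j))))"
      unfolding fu low2 vB by (simp only: of_nat_add of_nat_sum)
    then show "betti n I i =
           (\<Sum>w\<in>{w \<in> lexseg n d t u v. min_var w \<ge> 2}. (max_var w - (d - 1) * t - 2) choose i)
           + (\<Sum>j=0..i. \<Sum>w\<in>final_lexseg n (d - 1) t (u - single 1 1).
                ((min_var v - 1) choose j) * ((n - min_var w - (d - 2) * t) choose (i - j)))"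
      by (rule of_nat_eq_iff[THEN iffD1])
  qed
qed

end
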